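(* Let $\alpha\in(0,1]$, $\mathcal{L}$, $\{Z_i\}$, $S_n$ be as in the context, satisfying (A1) and (A2), and let $(\tilde\zeta_t)_{t\in[0,1]}$ under $\tilde{\mathbb{E}}$ be the nonlinear Lévy process constructed from $\{Z_i\}$ as described in the context. For $\phi\in C_{b,Lip}(\mathbb{R}^d)$ define $u(t,x)=\tilde{\mathbb{E}}[\phi(x+\tilde\zeta_t)]$, $(t,x)\in[0,1]\times\mathbb{R}^d$. Then $u$ is the unique viscosity solution of $$\partial_tu(t,x)-\sup_{F_\mu\in\mathcal{L}}\Big\{\int_{\mathbb{R}^d}\delta^\alpha_\lambda u(t,x)F_\mu(d\lambda)\Big\}=0,\qquad u(0,x)=\phi(x),\qquad (t,x)\in[0,1]\times\mathbb{R}^d,$$ where $\delta^\alpha_\lambda u(t,x)=u(t,x+\lambda)-u(t,x)-\langle D_xu(t,x),\lambda\mathbb{1}_{\{|\lambda|\le1\}}\rangle$ if $\alpha=1$ and $u(t,x+\lambda)-u(t,x)$ if $\alpha\in(0,1)$.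
   Context: Sublinear expectation space $(\Omega,\mathcal{H},\hat{\mathbb{E}})$: $\hat{\mathbb{E}}$ monotone, constant preserving, sub-additive, positively homogeneous; random variables need only satisfy $\varphi(X)\in\mathcal{H}$ for bounded Lipschitz $\varphi$. $\{Z_i\}$ is an i.i.d. sequence of $\mathbb{R}^d$-valued random variables (identically distributed, each independent from its predecessors in the sense $\hat{\mathbb{E}}[\varphi(X,Y)]=\hat{\mathbb{E}}[\hat{\mathbb{E}}[\varphi(x,Y)]_{x=X}]$) with $\hat{\mathbb{E}}[|Z_i|]=\infty$, $S_n=\sum_{i\le n}Z_i$. $F_\mu(B)=\int_S\mu(dz)\int_0^\infty\mathbb{1}_B(rz)r^{-1-\alpha}dr$ for symmetric finite $\mu$ on the unit sphere $S$; $\mathcal{L}=\{F_\mu:\mu(S)\in(\underline{\Lambda},\overline{\Lambda})\}$ with given $\underline{\Lambda},\overline{\Lambda}>0$. (A1): $\sup_n\hat{\mathbb{E}}[|n^{-1/\alpha}S_n|^\delta]<\infty$ for some $0<\delta<\alpha$. (A2): there is $l$ with $l(s)\to0$ as $s\to0$ such that for all $\varphi\in C_b^3(\mathbb{R}^d)$ and $x$, $\frac1s|\hat{\mathbb{E}}[\varphi(x+s^{1/\alpha}Z_1)-\varphi(x)]-s\sup_{F_\mu\in\mathcal{L}}\int\delta^\alpha_\lambda\varphi(x)F_\mu(d\lambda)|\le l(s)$ (with $\delta^\alpha_\lambda$ as in the claim, for functions of $x$). The process: $\tilde\zeta_t(\omega)=\omega_t$ is the canonical process on the space of $\mathbb{R}^d$-valued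 càdlàg paths on $[0,1]$ starting at 0, and $\tilde{\mathbb{E}}$ is the sublinear expectation on bounded Lipschitz functions of finitely many increments obtained by the paper's construction from weak limits of normalized sums: under it $\tilde\zeta$ is a nonlinear Lévy process, $n^{-1/\alpha}S_n$ converges in distribution to $\tilde\zeta_1$, and for each $s\in[0,1]$ there are dyadic $s_k\downarrow s$ and, for each $k$, integers $n_i^*\to\infty$ with $\tilde{\mathbb{E}}[\varphi(\tilde\zeta_s)]=\lim_k\lim_i\hat{\mathbb{E}}[\varphi((s_k/n_i^* )^{1/\alpha}S_{n_i^*})]$ for bounded Lipschitz $\varphi$. Viscosity solution: a bounded upper (resp. lower) semicontinuous $u$ is a sub- (resp. super-)solution if $u(0,\cdot)\le\phi$ (resp. $\ge$) and for each $(t,x)\in(0,1]\times\mathbb{R}^d$, $\partial_t\psi(t,x)-\sup_{F_\mu\in\mathcal{L}}\int\delta^\alpha_\lambda\psi(t,x)F_\mu(d\lambda)\le0$ (resp. $\ge0$) whenever $\psi\in C_b^{2,3}((0,1]\times\mathbb{R}^d)$ satisfies $\psi\ge u$ (resp. $\le$) and $\psi(t,x)=u(t,x)$; a viscosity solution is a bounded continuous function that is both. *)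

theory Defs
  imports "HOL-Analysis.Analysis"
begin

definition sublinear_expectation :: "('w \<Rightarrow> real) set \<Rightarrow> (('w \<Rightarrow> real) \<Rightarrow> real) \<Rightarrow> bool" where
  "sublinear_expectation H E \<longleftrightarrow>
     (\<forall>c. (\<lambda>_. c) \<in> H) \<and>
     (\<forall>X\<in>H. \<forall>Y\<in>H. (\<lambda>w. X w + Y w) \<in> H) \<and>
     (\<forall>X\<in>H. \<forall>c. (\<lambda>w. c * X w) \<in> H) \<and>
     (\<forall>X\<in>H. \<forall>Y\<in>H. (\<forall>w. X w \<le> Y w) \<longrightarrow> E X \<le> E Y) \<and>
     (\<forall>c. E (\<lambda>_. c) = c) \<and>
     (\<forall>X\<in>H. \<forall>Y\<in>H. E (\<lambda>w. X w + Y w) \<le> E X + E Y) \<and>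
     (\<forall>X\<in>H. \<forall>c\<ge>0. E (\<lambda>w. c * X w) = c * E X)"

definition bdd_lip :: "('v::metric_space \<Rightarrow> real) \<Rightarrow> bool" where
  "bdd_lip f \<longleftrightarrow> (\<exists>B. \<forall>x. \<bar>f x\<bar> \<le> B) \<and> (\<exists>L. \<forall>x y. \<bar>f x - f y\<bar> \<le> L * dist x y)"

text \<open>Bounded Lipschitz functions of \<open>(x_0,\<dots>,x_{n-1}, y)\<close>, where the first argument
  is a sequence of which only the first n entries matter.\<close>
definition bdd_lip_n :: "nat \<Rightarrow> ((nat \<Rightarrow> 'v::real_normed_vector) \<Rightarrow> 'v \<Rightarrow> real) \<Rightarrow> bool" where
  "bdd_lip_n n f \<longleftrightarrow> (\<exists>B. \<forall>x y. \<bar>f x y\<bar> \<le> B) \<and>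
     (\<exists>L. \<forall>x x' y y'. \<bar>f x y - f x' y'\<bar> \<le> L * ((\<Sum>i<n. norm (x i - x' i)) + norm (y - y')))"

definition random_var :: "('w \<Rightarrow> real) set \<Rightarrow> ('w \<Rightarrow> 'v::metric_space) \<Rightarrow> bool" where
  "random_var H X \<longleftrightarrow> (\<forall>\<phi>. bdd_lip \<phi> \<longrightarrow> (\<lambda>w. \<phi> (X w)) \<in> H)"

definition indep_from :: "('w \<Rightarrow> real) set \<Rightarrow> (('w \<Rightarrow> real) \<Rightarrow> real) \<Rightarrow> nat
     \<Rightarrow> (nat \<Rightarrow> 'w \<Rightarrow> 'v::real_normed_vector) \<Rightarrow> ('w \<Rightarrow> 'v) \<Rightarrow> bool" where
  "indep_from H E n X Y \<longleftrightarrow>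
     (\<forall>\<phi>. bdd_lip_n n \<phi> \<longrightarrow>
        (\<lambda>w. \<phi> (\<lambda>i. X i w) (Y w)) \<in> H \<and>
        (\<lambda>w. E (\<lambda>w'. \<phi> (\<lambda>i. X i w) (Y w'))) \<in> H \<and>
        E (\<lambda>w. \<phi> (\<lambda>i. X i w) (Y w)) = E (\<lambda>w. E (\<lambda>w'. \<phi> (\<lambda>i. X i w) (Y w'))))"

definition ident_distr :: "(('w \<Rightarrow> real) \<Rightarrow> real) \<Rightarrow> ('w \<Rightarrow> 'v::metric_space)
     \<Rightarrow> (('w' \<Rightarrow> real) \<Rightarrow> real) \<Rightarrow> ('w' \<Rightarrow> 'v) \<Rightarrow> bool" where
  "ident_distr E X E' Y \<longleftrightarrow> (\<forall>\<phi>. bdd_lip \<phi> \<longrightarrow> E (\<lambda>w. \<phi> (X w)) = E' (\<lambda>w. \<phi> (Y w)))"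

definition iid_seq :: "('w \<Rightarrow> real) set \<Rightarrow> (('w \<Rightarrow> real) \<Rightarrow> real) \<Rightarrow> (nat \<Rightarrow> 'w \<Rightarrow> 'v::real_normed_vector) \<Rightarrow> bool" where
  "iid_seq H E Z \<longleftrightarrow> (\<forall>i. random_var H (Z i)) \<and> (\<forall>i. ident_distr E (Z i) E (Z 0)) \<and>
     (\<forall>n. indep_from H E n Z (Z n))"

text \<open>Upper expectation \<open>E[g(X)] \<le> C\<close> for a nonnegative continuous g, where
  \<open>E[g(X)] := sup {E[\<phi>(X)] : \<phi> bounded Lipschitz, \<phi> \<le> g}\<close>.\<close>
definition upper_exp_le :: "(('w \<Rightarrow> real) \<Rightarrow> real) \<Rightarrow> ('w \<Rightarrow> 'v::metric_space) \<Rightarrow> ('v \<Rightarrow> real) \<Rightarrow> real \<Rightarrow> bool" where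
  "upper_exp_le E X g C \<longleftrightarrow> (\<forall>\<phi>. bdd_lip \<phi> \<and> (\<forall>y. \<phi> y \<le> g y) \<longrightarrow> E (\<lambda>w. \<phi> (X w)) \<le> C)"

definition upper_exp_infinite :: "(('w \<Rightarrow> real) \<Rightarrow> real) \<Rightarrow> ('w \<Rightarrow> 'v::metric_space) \<Rightarrow> ('v \<Rightarrow> real) \<Rightarrow> bool" where
  "upper_exp_infinite E X g \<longleftrightarrow> (\<forall>C. \<not> upper_exp_le E X g C)"

text \<open>f is C^k with bounded derivatives (C_b^k), expressed through the family of
  iterated partial derivatives along basis vectors: P bs = the partial derivative in the
  directions listed in bs (innermost last), all existing, continuous and bounded.\<close>
definition Cb_k :: "nat \<Rightarrow> ('v::euclidean_space \<Rightarrow> real) \<Rightarrow> bool" where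
  "Cb_k k f \<longleftrightarrow> (\<exists>P :: 'v list \<Rightarrow> 'v \<Rightarrow> real.
     P [] = f \<and>
     (\<forall>bs b x. length bs < k \<and> set (b # bs) \<subseteq> Basis \<longrightarrow>
        ((\<lambda>h. P bs (x + h *\<^sub>R b)) has_real_derivative P (b # bs) x) (at 0)) \<and>
     (\<forall>bs. length bs \<le> k \<and> set bs \<subseteq> Basis \<longrightarrow>
        continuous_on UNIV (P bs) \<and> (\<exists>B. \<forall>x. \<bar>P bs x\<bar> \<le> B)))"

text \<open>\<open>C_b^{2,3}((0,1] \<times> R^d)\<close>: twice continuously differentiable in t and three times
  in x, with all these derivatives continuous and bounded on \<open>(0,1] \<times> R^d\<close>
  (t-derivatives at t = 1 are one-sided, i.e. within (0,1]).\<close>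
definition Cb_23 :: "(real \<Rightarrow> 'v::euclidean_space \<Rightarrow> real) \<Rightarrow> bool" where
  "Cb_23 \<psi> \<longleftrightarrow>
    (\<exists>T :: nat \<Rightarrow> real \<Rightarrow> 'v \<Rightarrow> real. T 0 = \<psi> \<and>
       (\<forall>i t x. i < 2 \<and> t \<in> {0<..1} \<longrightarrow>
          ((\<lambda>s. T i s x) has_real_derivative T (Suc i) t x) (at t within {0<..1})) \<and>
       (\<forall>i\<le>2. continuous_on ({0<..1} \<times> UNIV) (\<lambda>(t,x). T i t x) \<and>
          (\<exists>B. \<forall>t\<in>{0<..1}. \<forall>x. \<bar>T i t x\<bar> \<le> B))) \<and>
    (\<exists>P :: 'v list \<Rightarrow> real \<Rightarrow> 'v \<Rightarrow> real. P [] = \<psi> \<and>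
       (\<forall>bs b t x. length bs < 3 \<and> set (b # bs) \<subseteq> Basis \<and> t \<in> {0<..1} \<longrightarrow>
          ((\<lambda>h. P bs t (x + h *\<^sub>R b)) has_real_derivative P (b # bs) t x) (at 0)) \<and>
       (\<forall>bs. length bs \<le> 3 \<and> set bs \<subseteq> Basis \<longrightarrow>
          continuous_on ({0<..1} \<times> UNIV) (\<lambda>(t,x). P bs t x) \<and>
          (\<exists>B. \<forall>t\<in>{0<..1}. \<forall>x. \<bar>P bs t x\<bar> \<le> B)))"

text \<open>\<open>\<delta>^\<alpha>_\<lambda> f(x)\<close>; \<open>\<langle>Df(x), \<lambda>\<rangle>\<close> is the directional derivative of f at x along \<lambda>.\<close>
definition delta_op :: "real \<Rightarrow> ('v::euclidean_space \<Rightarrow> real) \<Rightarrow> 'v \<Rightarrow> 'v \<Rightarrow> real" where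
  "delta_op \<alpha> f x l = f (x + l) - f x -
     (if \<alpha> = 1 \<and> norm l \<le> 1 then deriv (\<lambda>h. f (x + h *\<^sub>R l)) 0 else 0)"

definition sphere_measures :: "'v::euclidean_space measure set" where
  "sphere_measures = {\<mu>. space \<mu> = sphere 0 1 \<and> sets \<mu> = sets (restrict_space borel (sphere 0 1)) \<and>
      finite_measure \<mu> \<and> (\<forall>A \<in> sets \<mu>. emeasure \<mu> (uminus ` A) = emeasure \<mu> A)}"

text \<open>The family \<open>\<L> = {F_\<mu> : \<mu>(S) \<in> (\<Lambda>lo, \<Lambda>up)}\<close>, parametrized by \<mu>.\<close>
definition levy_family :: "real \<Rightarrow> real \<Rightarrow> 'v::euclidean_space measure set" where
  "levy_family Llo Lup = {\<mu> \<in> sphere_measures. measure \<mu> (space \<mu>) \<in> {Llo<..<Lup}}"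

text \<open>\<open>\<integral> \<delta>^\<alpha>_\<lambda> f(x) F_\<mu>(d\<lambda>) = \<integral>_S \<mu>(dz) \<integral>_0^\<infinity> \<delta>^\<alpha>_{rz} f(x) r^{-1-\<alpha>} dr\<close>.\<close>
definition levy_int :: "real \<Rightarrow> 'v::euclidean_space measure \<Rightarrow> ('v \<Rightarrow> real) \<Rightarrow> 'v \<Rightarrow> real" where
  "levy_int \<alpha> \<mu> f x =
     (\<integral>z. (LINT r:{0<..}|lborel. delta_op \<alpha> f x (r *\<^sub>R z) * r powr (-1 - \<alpha>)) \<partial>\<mu>)"

definition levy_gen :: "real \<Rightarrow> real \<Rightarrow> real \<Rightarrow> ('v::euclidean_space \<Rightarrow> real) \<Rightarrow> 'v \<Rightarrow> real" where
  "levy_gen \<alpha> Llo Lup f x = (SUP \<mu> \<in> levy_family Llo Lup. levy_int \<alpha> \<mu> f x)"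

definition usc_on :: "'a::topological_space set \<Rightarrow> ('a \<Rightarrow> real) \<Rightarrow> bool" where
  "usc_on A f \<longleftrightarrow> (\<forall>p\<in>A. \<forall>e>0. eventually (\<lambda>q. f q < f p + e) (at p within A))"

definition lsc_on :: "'a::topological_space set \<Rightarrow> ('a \<Rightarrow> real) \<Rightarrow> bool" where
  "lsc_on A f \<longleftrightarrow> (\<forall>p\<in>A. \<forall>e>0. eventually (\<lambda>q. f p - e < f q) (at p within A))"

definition bounded_fun :: "(real \<Rightarrow> 'v \<Rightarrow> real) \<Rightarrow> bool" where
  "bounded_fun u \<longleftrightarrow> (\<exists>B. \<forall>t\<in>{0..1}. \<forall>x. \<bar>u t x\<bar> \<le> B)"

definition time_deriv :: "(real \<Rightarrow> 'v \<Rightarrow> real) \<Rightarrow> real \<Rightarrow> 'v \<Rightarrow> real" where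
  "time_deriv \<psi> t x = vector_derivative (\<lambda>s. \<psi> s x) (at t within {0<..1})"

definition visc_sub :: "real \<Rightarrow> real \<Rightarrow> real \<Rightarrow> ('v::euclidean_space \<Rightarrow> real) \<Rightarrow> (real \<Rightarrow> 'v \<Rightarrow> real) \<Rightarrow> bool" where
  "visc_sub \<alpha> Llo Lup \<phi> u \<longleftrightarrow> bounded_fun u \<and> usc_on ({0..1} \<times> UNIV) (\<lambda>(t,x). u t x) \<and>
     (\<forall>x. u 0 x \<le> \<phi> x) \<and>
     (\<forall>t\<in>{0<..1}. \<forall>x. \<forall>\<psi>. Cb_23 \<psi> \<and> (\<forall>s\<in>{0<..1}. \<forall>y. u s y \<le> \<psi> s y) \<and> \<psi> t x = u t x \<longrightarrow>
        time_deriv \<psi> t x - levy_gen \<alpha> Llo Lup (\<psi> t) x \<le> 0)"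

definition visc_super :: "real \<Rightarrow> real \<Rightarrow> real \<Rightarrow> ('v::euclidean_space \<Rightarrow> real) \<Rightarrow> (real \<Rightarrow> 'v \<Rightarrow> real) \<Rightarrow> bool" where
  "visc_super \<alpha> Llo Lup \<phi> u \<longleftrightarrow> bounded_fun u \<and> lsc_on ({0..1} \<times> UNIV) (\<lambda>(t,x). u t x) \<and>
     (\<forall>x. u 0 x \<ge> \<phi> x) \<and>
     (\<forall>t\<in>{0<..1}. \<forall>x. \<forall>\<psi>. Cb_23 \<psi> \<and> (\<forall>s\<in>{0<..1}. \<forall>y. \<psi> s y \<le> u s y) \<and> \<psi> t x = u t x \<longrightarrow>
        time_deriv \<psi> t x - levy_gen \<alpha> Llo Lup (\<psi> t) x \<ge> 0)"

definition visc_sol :: "real \<Rightarrow> real \<Rightarrow> real \<Rightarrow> ('v::euclidean_space \<Rightarrow> real) \<Rightarrow> (real \<Rightarrow> 'v \<Rightarrow> real) \<Rightarrow> bool" where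
  "visc_sol \<alpha> Llo Lup \<phi> u \<longleftrightarrow> continuous_on ({0..1} \<times> UNIV) (\<lambda>(t,x). u t x) \<and>
     visc_sub \<alpha> Llo Lup \<phi> u \<and> visc_super \<alpha> Llo Lup \<phi> u"

definition cadlag_on01 :: "(real \<Rightarrow> 'v::metric_space) \<Rightarrow> bool" where
  "cadlag_on01 p \<longleftrightarrow> (\<forall>t\<in>{0..<1}. continuous (at_right t) p) \<and>
     (\<forall>t\<in>{0<..1}. \<exists>l. (p \<longlongrightarrow> l) (at_left t))"

definition nonlinear_levy :: "('w \<Rightarrow> real) set \<Rightarrow> (('w \<Rightarrow> real) \<Rightarrow> real) \<Rightarrow> (real \<Rightarrow> 'w \<Rightarrow> 'v::real_normed_vector) \<Rightarrow> bool" where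
  "nonlinear_levy H E \<zeta> \<longleftrightarrow> sublinear_expectation H E \<and>
     (\<forall>w. \<zeta> 0 w = 0) \<and> (\<forall>w. cadlag_on01 (\<lambda>t. \<zeta> t w)) \<and>
     (\<forall>t\<in>{0..1}. random_var H (\<zeta> t)) \<and>
     (\<forall>s t. 0 \<le> s \<and> 0 \<le> t \<and> t + s \<le> 1 \<longrightarrow>
        ident_distr E (\<lambda>w. \<zeta> (t + s) w - \<zeta> t w) E (\<zeta> s) \<and>
        (\<forall>n tt. (\<forall>i<n. tt i \<in> {0..t}) \<longrightarrow>
           indep_from H E n (\<lambda>i. \<zeta> (tt i)) (\<lambda>w. \<zeta> (t + s) w - \<zeta> t w)))"

definition dyadic :: "real \<Rightarrow> bool" where
  "dyadic r \<longleftrightarrow> (\<exists>m j :: nat. r = real m / 2 ^ j)"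

end

theory Submission
  imports Defs
begin

text \<open>
  Because \<open>\<mu>\<close> is symmetric, the generator only sees the second differences
  \<open>f(x + \<lambda>) + f(x - \<lambda>) - 2 f(x)\<close>, for every \<open>\<alpha> \<le> 1\<close>. Telescoping (A2) along the partial sums, with
  (A1) controlling how far they have moved, gives
  \<open>\<bar>E'[f(x + \<zeta>_s)] - f(x) - s G f(x)\<bar> = O(s^{1 + \<delta>/\<alpha>})\<close> for \<open>f \<in> C_b^3\<close>; together with the dynamic programming
  principle \<open>u(t + s, x) = E'[u(s, x + \<zeta>_t)]\<close> this makes u a viscosity solution.

  Uniqueness is a comparison principle proved by doubling the variables. The operator is translation
  invariant and of order at most one, so no second-order information (Ishii's lemma) is needed: the
  coupling penalty contributes only \<open>O(\<rho>^{2 - \<alpha>})\<close> on a ball of radius \<open>\<rho>\<close>, and outside that ball the test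
  functions may be taken arbitrarily close to u and v themselves. All penalties are bounded
  (built from \<open>1 / (1 + |z|^2)\<close>), so that they are admissible test functions as they stand.
\<close>

section \<open>Functions with bounded continuous partial derivatives\<close>

text \<open>A test function has to touch u over all of (0,1] x R^d and be bounded and smooth there,
  so no argument may be purely local. A function that is explicit only near the contact point is
  therefore glued, by a cutoff, to a smooth majorant of u, obtained from Stone-Weierstrass on a ball
  and from a constant far away; the price is a truncated quadratic whose scale can be chosen. For
  the same reason the doubled functional needs a global maximum, and its penalty constants are large
  compared with the bounds of u and v.

  The strict inequality behind the contradiction comes from an extra term c sin t, whose derivative
  c cos t is at least c/2 on [0,1].

  A sublinear expectation admits no subtraction, so every estimate is a pointwise inequality between
  random variables with an error k W + c, where W is usually a truncated norm. Three spatial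
  derivatives make the generator of f itself Lipschitz, which allows it to be frozen at the starting
  point of the walk.\<close>

definition partial_deriv :: "'v::euclidean_space \<Rightarrow> ('v \<Rightarrow> real) \<Rightarrow> 'v \<Rightarrow> real" where
  "partial_deriv b f x = deriv (\<lambda>h. f (x + h *\<^sub>R b)) 0"

text \<open>A recursion on the order with canonical partial derivatives, instead of an existentially
  quantified family as in \<open>Cb_k\<close>, lets the closure properties be proved by induction.
  The class is used on R^d and on R x R^d, where time is one more coordinate.\<close>

fun cb_class :: "nat \<Rightarrow> ('v::euclidean_space \<Rightarrow> real) \<Rightarrow> bool" where
  "cb_class 0 f \<longleftrightarrow> continuous_on UNIV f \<and> (\<exists>B. \<forall>x. \<bar>f x\<bar> \<le> B)"
| "cb_class (Suc n) f \<longleftrightarrow> continuous_on UNIV f \<and> (\<exists>B. \<forall>x. \<bar>f x\<bar> \<le> B) \<and>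
     (\<forall>b\<in>Basis. (\<forall>x. ((\<lambda>h. f (x + h *\<^sub>R b)) has_real_derivative partial_deriv b f x) (at 0)) \<and>
        cb_class n (partial_deriv b f))"

declare cb_class.simps(2) [simp del]

lemma cb_class_continuous: "cb_class n f \<Longrightarrow> continuous_on S f"
  by (cases n) (auto simp: cb_class.simps(2) intro: continuous_on_subset)

lemma cb_class_bounded:
  assumes "cb_class n f"
  obtains B where "B \<ge> 0" "\<And>x. \<bar>f x\<bar> \<le> B"
proof -
  obtain B where "\<And>x. \<bar>f x\<bar> \<le> B" using assms by (cases n) (auto simp: cb_class.simps(2))
  then show ?thesis using that[of "max B 0"] by (meson max.cobounded1 max.cobounded2 order_trans)
qed

lemma cb_class_partial_deriv:
  assumes "cb_class (Suc n) f" "b \<in> Basis"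
  shows "((\<lambda>h. f (x + h *\<^sub>R b)) has_real_derivative partial_deriv b f x) (at 0)"
    and "cb_class n (partial_deriv b f)"
  using assms unfolding cb_class.simps by blast+

lemma cb_class_Suc_D: "cb_class (Suc n) f \<Longrightarrow> cb_class n f"
proof (induction n arbitrary: f)
  case 0
  then show ?case unfolding cb_class.simps by blast
next
  case (Suc n)
  have "\<forall>b\<in>Basis. cb_class n (partial_deriv b f)"
    using Suc.IH cb_class_partial_deriv(2)[OF Suc.prems] by blast
  then show ?case using Suc.prems unfolding cb_class.simps(2)[of "Suc n"] cb_class.simps(2)[of n f]
    by blast
qed

text \<open>Derivatives are unique, so any explicit family \<open>D\<close> of directional
  derivatives may stand in for \<open>partial_deriv\<close>.\<close>

lemma cb_class_SucI:
  assumes "continuous_on UNIV f" "\<And>x. \<bar>f x\<bar> \<le> B"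
    and D: "\<And>b x. b \<in> Basis \<Longrightarrow> ((\<lambda>h. f (x + h *\<^sub>R b)) has_real_derivative D b x) (at 0)"
    "\<And>b. b \<in> Basis \<Longrightarrow> cb_class n (D b)"
  shows "cb_class (Suc n) f"
proof -
  have "partial_deriv b f = D b" if "b \<in> Basis" for b
    using DERIV_imp_deriv[OF D(1)[OF that]] by (auto simp: partial_deriv_def)
  then show ?thesis using assms unfolding cb_class.simps by auto
qed

lemma cb_class_const: "cb_class n (\<lambda>_. c)"
proof (induction n arbitrary: c)
  case (Suc n)
  show ?case by (rule cb_class_SucI[where D="\<lambda>_ _. 0" and B="\<bar>c\<bar>"]) (auto simp: Suc)
qed auto

lemma cb_class_add: "cb_class n f \<Longrightarrow> cb_class n g \<Longrightarrow> cb_class n (\<lambda>x. f x + g x)"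
proof (induction n arbitrary: f g)
  case 0
  then obtain B B' where "\<And>x. \<bar>f x\<bar> \<le> B" "\<And>x. \<bar>g x\<bar> \<le> B'" by (meson cb_class_bounded)
  then have "\<bar>f x + g x\<bar> \<le> B + B'" for x by (meson abs_triangle_ineq add_mono order_trans)
  then show ?case using 0 by (auto intro!: continuous_intros)
next
  case (Suc n)
  obtain B B' where B: "\<And>x. \<bar>f x\<bar> \<le> B" "\<And>x. \<bar>g x\<bar> \<le> B'" using Suc.prems by (meson cb_class_bounded)
  note D = cb_class_partial_deriv[OF Suc.prems(1)]
  note D' = cb_class_partial_deriv[OF Suc.prems(2)]
  show ?case
  proof (rule cb_class_SucI[where D="\<lambda>b x. partial_deriv b f x + partial_deriv b g x" and B="B + B'"])
    show "continuous_on UNIV (\<lambda>x. f x + g x)"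
      using Suc.prems by (intro continuous_intros cb_class_continuous)
    show "\<bar>f x + g x\<bar> \<le> B + B'" for x using B by (meson abs_triangle_ineq add_mono order_trans)
  qed (use D D' Suc.IH in \<open>auto intro: DERIV_add\<close>)
qed

lemma cb_class_mult: "cb_class n f \<Longrightarrow> cb_class n g \<Longrightarrow> cb_class n (\<lambda>x. f x * g x)"
proof (induction n arbitrary: f g)
  case 0
  then obtain B B' where B: "B \<ge> 0" "\<And>x. \<bar>f x\<bar> \<le> B" "\<And>x. \<bar>g x\<bar> \<le> B'" by (meson cb_class_bounded)
  then have "\<bar>f x * g x\<bar> \<le> B * B'" for x by (simp add: abs_mult mult_mono)
  then show ?case using 0 by (auto intro!: continuous_intros)
next
  case (Suc n)
  obtain B B' where B: "B \<ge> 0" "\<And>x. \<bar>f x\<bar> \<le> B" "\<And>x. \<bar>g x\<bar> \<le> B'" using Suc.prems by (meson cb_class_bounded)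
  note D = cb_class_partial_deriv[OF Suc.prems(1)]
  note D' = cb_class_partial_deriv[OF Suc.prems(2)]
  show ?case
  proof (rule cb_class_SucI[where D="\<lambda>b x. partial_deriv b f x * g x + partial_deriv b g x * f x" and B="B * B'"])
    show "continuous_on UNIV (\<lambda>x. f x * g x)"
      using Suc.prems by (intro continuous_intros cb_class_continuous)
    show "\<bar>f x * g x\<bar> \<le> B * B'" for x using B by (simp add: abs_mult mult_mono)
    show "((\<lambda>h. f (x + h *\<^sub>R b) * g (x + h *\<^sub>R b)) has_real_derivative partial_deriv b f x * g x + partial_deriv b g x * f x) (at 0)"
      if "b \<in> Basis" for b x
      using DERIV_mult[OF D(1)[OF that] D'(1)[OF that], of x x] by simp
    show "cb_class n (\<lambda>x. partial_deriv b f x * g x + partial_deriv b g x * f x)" if "b \<in> Basis" for b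
      using that Suc D D' cb_class_Suc_D by (intro cb_class_add Suc.IH) blast+
  qed
qed

lemma cb_class_scale: "cb_class n f \<Longrightarrow> cb_class n (\<lambda>x. c * f x)"
  by (intro cb_class_mult cb_class_const)

lemma cb_class_minus: "cb_class n f \<Longrightarrow> cb_class n (\<lambda>x. - f x)"
  using cb_class_scale[of n f "-1"] by simp

lemma cb_class_diff: "cb_class n f \<Longrightarrow> cb_class n g \<Longrightarrow> cb_class n (\<lambda>x. f x - g x)"
  using cb_class_add[OF _ cb_class_minus, of n f g] by simp

lemmas cb_class_intros = cb_class_const cb_class_add cb_class_mult cb_class_minus cb_class_diff

lemma cb_class_affine: "cb_class n f \<Longrightarrow> cb_class n (\<lambda>x. f (c *\<^sub>R x + a))"
proof (induction n arbitrary: f)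
  case 0
  then show ?case by (auto intro!: continuous_on_compose2[of UNIV f] continuous_intros)
next
  case (Suc n)
  obtain B where B: "\<And>x. \<bar>f x\<bar> \<le> B" using Suc.prems by (meson cb_class_bounded)
  note D = cb_class_partial_deriv[OF Suc.prems]
  show ?case
  proof (rule cb_class_SucI[where D="\<lambda>b x. c * partial_deriv b f (c *\<^sub>R x + a)" and B=B])
    show "continuous_on UNIV (\<lambda>x. f (c *\<^sub>R x + a))"
      by (rule continuous_on_compose2[OF cb_class_continuous[OF Suc.prems, of UNIV]]) (auto intro!: continuous_intros)
    show "\<bar>f (c *\<^sub>R x + a)\<bar> \<le> B" for x by (rule B)
    show "((\<lambda>h. f (c *\<^sub>R (x + h *\<^sub>R b) + a)) has_real_derivative c * partial_deriv b f (c *\<^sub>R x + a)) (at 0)"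
      if "b \<in> Basis" for b x
    proof -
      have "((\<lambda>h. f ((c *\<^sub>R x + a) + (c * h) *\<^sub>R b)) has_real_derivative partial_deriv b f (c *\<^sub>R x + a) * c) (at 0)"
        using DERIV_chain2[of "\<lambda>h. f ((c *\<^sub>R x + a) + h *\<^sub>R b)" "partial_deriv b f (c *\<^sub>R x + a)" "\<lambda>h. c * h" 0 c UNIV]
          D(1)[OF that, of "c *\<^sub>R x + a"] by (auto intro!: derivative_eq_intros)
      then show ?thesis by (simp add: algebra_simps)
    qed
    show "cb_class n (\<lambda>x. c * partial_deriv b f (c *\<^sub>R x + a))" if "b \<in> Basis" for b
      using that D Suc.IH by (intro cb_class_scale) auto
  qed
qed

lemma cb_class_snd:
  fixes f :: "'v::euclidean_space \<Rightarrow> real"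
  shows "cb_class n f \<Longrightarrow> cb_class n (\<lambda>p::real \<times> 'v. f (snd p))"
proof (induction n arbitrary: f)
  case 0
  then show ?case by (auto intro!: continuous_on_compose2[of UNIV f] continuous_intros)
next
  case (Suc n)
  obtain B where B: "\<And>x. \<bar>f x\<bar> \<le> B" using Suc.prems by (meson cb_class_bounded)
  note D = cb_class_partial_deriv[OF Suc.prems]
  \<comment> \<open>A basis vector of the product is \<open>(1, 0)\<close> or \<open>(0, b)\<close>;
    along the first the function is constant.\<close>
  show ?case
  proof (rule cb_class_SucI[where D="\<lambda>b p. (if snd b = 0 then 0 else partial_deriv (snd b) f (snd p))" and B=B])
    show "continuous_on UNIV (\<lambda>p::real \<times> 'v. f (snd p))"
      by (rule continuous_on_compose2[OF cb_class_continuous[OF Suc.prems, of UNIV]]) (auto intro!: continuous_intros)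
    show "((\<lambda>h. f (snd (p + h *\<^sub>R b))) has_real_derivative (if snd b = 0 then 0 else partial_deriv (snd b) f (snd p))) (at 0)"
      if "b \<in> Basis" for b and p :: "real \<times> 'v"
      using that D by (auto simp: Basis_prod_def)
    show "cb_class n (\<lambda>p::real \<times> 'v. if snd b = 0 then 0 else partial_deriv (snd b) f (snd p))" if "b \<in> Basis" for b :: "real \<times> 'v"
      using that D(2) Suc.IH by (cases "snd b = 0") (auto simp: Basis_prod_def intro!: cb_class_const)
  qed (rule B)
qed

text \<open>Differentiation shifts the phase by pi/2, so the family is closed under it once
  \<open>a\<close> is arbitrary. These cosines separate points for Stone-Weierstrass and, along the
  time axis, serve as penalties.\<close>

lemma cb_class_cos: "cb_class n (\<lambda>x. cos (c * (x \<bullet> e) + a))"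
proof (induction n arbitrary: a)
  case 0
  show ?case by (auto intro!: continuous_intros exI[of _ 1])
next
  case (Suc n)
  show ?case
  proof (rule cb_class_SucI[where D="\<lambda>b x. (c * (b \<bullet> e)) * cos (c * (x \<bullet> e) + (a + pi/2))" and B=1])
    show "((\<lambda>h. cos (c * ((x + h *\<^sub>R b) \<bullet> e) + a)) has_real_derivative
            c * (b \<bullet> e) * cos (c * (x \<bullet> e) + (a + pi / 2))) (at 0)" for b x
    proof -
      have "cos (c * (x \<bullet> e) + (a + pi / 2)) = - sin (c * (x \<bullet> e) + a)"
        by (simp add: cos_add flip: add.assoc)
      then show ?thesis by (auto intro!: derivative_eq_intros simp: inner_left_distrib algebra_simps)
    qed
  qed (auto intro!: continuous_intros cb_class_scale Suc)
qed

section \<open>Rational bumps and powers of the positive part\<close>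

definition rat_bump :: "'v::euclidean_space \<Rightarrow> real" where
  "rat_bump z = 1 / (1 + z \<bullet> z)"

lemma rat_bump_pos: "0 < rat_bump z" and rat_bump_le_1: "rat_bump z \<le> 1"
  and one_minus_rat_bump_le: "1 - rat_bump z \<le> (norm z)\<^sup>2"
proof -
  have "0 \<le> z \<bullet> z" by simp
  then have "0 < 1 + z \<bullet> z" by linarith
  then show "0 < rat_bump z" "rat_bump z \<le> 1" by (auto simp: rat_bump_def)
  show "1 - rat_bump z \<le> (norm z)\<^sup>2"
    using \<open>0 < 1 + z \<bullet> z\<close> by (simp add: rat_bump_def power2_norm_eq_inner field_simps)
qed

lemma rat_bump_0 [simp]: "rat_bump 0 = 1"
  by (simp add: rat_bump_def)

lemma rat_bump_uminus [simp]: "rat_bump (- z) = rat_bump z"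
  by (simp add: rat_bump_def)

lemma rat_bump_le_half: "1 \<le> norm z \<Longrightarrow> rat_bump z \<le> 1/2"
proof -
  assume "1 \<le> norm z"
  then have "1 \<le> (norm z)\<^sup>2" by simp
  then show ?thesis by (simp add: rat_bump_def power2_norm_eq_inner field_simps)
qed

lemma rat_bump_eq_1_iff: "rat_bump z = 1 \<longleftrightarrow> z = 0"
proof -
  have "0 < 1 + z \<bullet> z" using inner_ge_zero[of z] by linarith
  then show ?thesis by (simp add: rat_bump_def field_simps)
qed

lemma continuous_on_rat_bump [continuous_intros]:
  fixes f :: "'a::topological_space \<Rightarrow> 'v::euclidean_space"
  shows "continuous_on S f \<Longrightarrow> continuous_on S (\<lambda>x. rat_bump (f x))"
proof -
  have "1 + z \<bullet> z \<noteq> 0" for z :: 'v using inner_ge_zero[of z] by linarith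
  then show "continuous_on S f \<Longrightarrow> continuous_on S (\<lambda>x. rat_bump (f x))"
    unfolding rat_bump_def by (intro continuous_intros) auto
qed

(* The algebra generated by g = rat_bump and the functions (z . b) g is closed under differentiation. *)
lemma cb_class_rat_bump_aux:
  "cb_class n (rat_bump :: 'v::euclidean_space \<Rightarrow> real) \<and>
   (\<forall>e\<in>Basis. cb_class n (\<lambda>z::'v. (z \<bullet> e) * rat_bump z))"
proof (induction n)
  case 0
  show ?case
  proof (intro conjI ballI)
    show "cb_class 0 (rat_bump :: 'v \<Rightarrow> real)"
      by (auto intro!: continuous_intros exI[of _ 1] simp: abs_of_pos rat_bump_pos rat_bump_le_1)
    fix e :: 'v assume e: "e \<in> Basis"
    have "\<bar>(z \<bullet> e) * rat_bump z\<bar> \<le> 1" for z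
    proof -
      have "\<bar>z \<bullet> e\<bar> \<le> norm z" using e by (rule Basis_le_norm)
      also have "norm z \<le> 1 + z \<bullet> z"
        using sum_squares_bound[of "norm z" 1] zero_le_power2[of "norm z"]
        unfolding power2_norm_eq_inner[symmetric] by (smt (verit) mult_cancel_left1 norm_ge_zero power_one)
      finally have "\<bar>z \<bullet> e\<bar> \<le> 1 + z \<bullet> z" .
      moreover have "0 < 1 + z \<bullet> z" using inner_ge_zero[of z] by linarith
      ultimately show ?thesis by (simp add: rat_bump_def abs_mult)
    qed
    then show "cb_class 0 (\<lambda>z. (z \<bullet> e) * rat_bump z)" by (auto intro!: continuous_intros)
  qed
next
  case (Suc n)
  have nz: "1 + z \<bullet> z \<noteq> 0" for z :: 'v using inner_ge_zero[of z] by linarith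
  have d: "((\<lambda>h. rat_bump (z + h *\<^sub>R b)) has_real_derivative (-2) * ((z \<bullet> b) * rat_bump z) * rat_bump z) (at 0)" for z b :: 'v
  proof -
    have "(\<lambda>h. rat_bump (z + h *\<^sub>R b)) = (\<lambda>h. 1 / (1 + (z \<bullet> z + 2 * h * (z \<bullet> b) + h\<^sup>2 * (b \<bullet> b))))"
      by (simp add: rat_bump_def inner_left_distrib inner_right_distrib inner_commute power2_eq_square algebra_simps)
    then show ?thesis using nz
      by (auto intro!: derivative_eq_intros simp: rat_bump_def power2_eq_square field_simps)
  qed
  have c0: "continuous_on UNIV (rat_bump :: 'v \<Rightarrow> real)"
     "continuous_on UNIV (\<lambda>z::'v. (z \<bullet> e) * rat_bump z)" for e
    by (intro continuous_intros)+
  obtain B where B: "\<And>z::'v. \<bar>rat_bump z\<bar> \<le> B" using Suc by (meson cb_class_bounded)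
  show ?case
  proof (intro conjI ballI)
    have "cb_class n (\<lambda>z::'v. (-2) * ((z \<bullet> b) * rat_bump z) * rat_bump z)" if "b \<in> Basis" for b
      by (rule cb_class_mult[OF cb_class_scale]) (use Suc that in blast)+
    then show "cb_class (Suc n) (rat_bump :: 'v \<Rightarrow> real)" by (rule cb_class_SucI[OF c0(1) B d])
    fix e :: 'v assume e: "e \<in> Basis"
    obtain B' where B': "\<And>z::'v. \<bar>(z \<bullet> e) * rat_bump z\<bar> \<le> B'"
      using cb_class_bounded[of n "\<lambda>z. (z \<bullet> e) * rat_bump z"] Suc e by blast
    have *: "((\<lambda>h. ((z + h *\<^sub>R b) \<bullet> e) * rat_bump (z + h *\<^sub>R b)) has_real_derivative
        (b \<bullet> e) * rat_bump z + (-2) * ((z \<bullet> e) * rat_bump z) * ((z \<bullet> b) * rat_bump z)) (at 0)" for b z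
      using d[of z b] by (auto intro!: derivative_eq_intros d simp: inner_left_distrib algebra_simps)
    have "cb_class n (\<lambda>z. (-2) * ((z \<bullet> e) * rat_bump z) * ((z \<bullet> b) * rat_bump z))" if "b \<in> Basis" for b
      by (rule cb_class_mult[OF cb_class_scale]) (use Suc that e in blast)+
    note ** = this
    have "cb_class n (\<lambda>z. (b \<bullet> e) * rat_bump z + (-2) * ((z \<bullet> e) * rat_bump z) * ((z \<bullet> b) * rat_bump z))"
      if "b \<in> Basis" for b by (rule cb_class_add[OF cb_class_scale[OF conjunct1[OF Suc]] **[OF that]])
    then show "cb_class (Suc n) (\<lambda>z. (z \<bullet> e) * rat_bump z)" by (rule cb_class_SucI[OF c0(2) B' *])
  qed
qed

lemma cb_class_rat_bump: "cb_class n rat_bump"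
  by (rule conjunct1[OF cb_class_rat_bump_aux])

lemma DERIV_max0_power:
  "((\<lambda>s::real. (max 0 s) ^ Suc (Suc n)) has_real_derivative real (n + 2) * (max 0 s) ^ Suc n) (at s)"
proof -
  consider "s > 0" | "s < 0" | "s = 0" by linarith
  then show ?thesis
  proof cases
    case 1
    have "((\<lambda>s::real. s ^ Suc (Suc n)) has_real_derivative real (n + 2) * (max 0 s) ^ Suc n) (at s)"
      using 1 DERIV_pow[of "Suc (Suc n)" s UNIV] by simp
    then show ?thesis
      by (rule has_field_derivative_transform_within_open[where S="{0<..}"]) (use 1 in auto)
  next
    case 2
    have "((\<lambda>s::real. 0) has_real_derivative real (n + 2) * (max 0 s) ^ Suc n) (at s)"
      using 2 by auto
    then show ?thesis
      by (rule has_field_derivative_transform_within_open[where S="{..<0}"]) (use 2 in auto)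
  next
    case 3
    have "(\<lambda>h::real. (max 0 h) ^ Suc (Suc n) / h) \<midarrow>0\<rightarrow> 0"
    proof (rule Lim_null_comparison)
      show "\<forall>\<^sub>F h in at 0. norm ((max 0 h) ^ Suc (Suc n) / h) \<le> \<bar>h\<bar> ^ Suc n"
        by (rule always_eventually) (auto simp: max_def power_abs[symmetric] mult_nonpos_nonneg)
      show "(\<lambda>h::real. \<bar>h\<bar> ^ Suc n) \<midarrow>0\<rightarrow> 0"
        by (rule tendsto_eq_intros | simp)+
    qed
    then show ?thesis using 3 by (simp add: DERIV_def)
  qed
qed

text \<open>Each derivative lowers the exponent by one, so the power \<open>Suc n\<close> still
  leaves a continuous function after n derivatives. With n = 3 this turns \<open>rat_bump\<close>
  into a compactly supported cutoff.\<close>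

lemma cb_class_max0_power:
  "cb_class n f \<Longrightarrow> cb_class n (\<lambda>x. (max 0 (f x)) ^ Suc n)"
proof (induction n arbitrary: f)
  case 0
  then obtain B where "\<And>x. \<bar>f x\<bar> \<le> B" "B \<ge> 0" by (meson cb_class_bounded)
  then have "\<bar>max 0 (f x)\<bar> \<le> B" for x by (simp add: abs_le_iff)
  then show ?case using 0 by (auto intro!: continuous_intros)
next
  case (Suc n)
  obtain B where B: "\<And>x. \<bar>f x\<bar> \<le> B" "B \<ge> 0" using Suc.prems by (meson cb_class_bounded)
  note D = cb_class_partial_deriv[OF Suc.prems]
  show ?case
  proof (rule cb_class_SucI[where D="\<lambda>b x. real (n + 2) * (max 0 (f x)) ^ Suc n * partial_deriv b f x" and B="B ^ Suc (Suc n)"])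
    show "continuous_on UNIV (\<lambda>x. max 0 (f x) ^ Suc (Suc n))"
      using Suc.prems by (intro continuous_intros cb_class_continuous)
    show "\<bar>max 0 (f x) ^ Suc (Suc n)\<bar> \<le> B ^ Suc (Suc n)" for x
      unfolding power_abs by (rule power_mono) (use B in \<open>auto simp: abs_le_iff\<close>)
    show "((\<lambda>h. max 0 (f (x + h *\<^sub>R b)) ^ Suc (Suc n)) has_real_derivative
        real (n + 2) * max 0 (f x) ^ Suc n * partial_deriv b f x) (at 0)" if "b \<in> Basis" for b x
      using DERIV_chain2[OF _ D(1)[OF that, of x], of "\<lambda>s. max 0 s ^ Suc (Suc n)"] DERIV_max0_power[of n "f x"]
      by simp
    show "cb_class n (\<lambda>x. real (n + 2) * max 0 (f x) ^ Suc n * partial_deriv b f x)" if "b \<in> Basis" for b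
      using Suc.IH[OF cb_class_Suc_D[OF Suc.prems]] D(2)[OF that] by (intro cb_class_intros)
  qed
qed

section \<open>Translation between \<open>Cb_k\<close>, \<open>Cb_23\<close> and the recursive
  class\<close>

lemma Cb_k_imp_cb_class:
  assumes "Cb_k k f" shows "cb_class k f"
proof -
  obtain P where P: "P [] = f"
    "\<And>bs b x. length bs < k \<Longrightarrow> set (b # bs) \<subseteq> Basis \<Longrightarrow>
        ((\<lambda>h. P bs (x + h *\<^sub>R b)) has_real_derivative P (b # bs) x) (at 0)"
    "\<And>bs. length bs \<le> k \<Longrightarrow> set bs \<subseteq> Basis \<Longrightarrow> continuous_on UNIV (P bs) \<and> (\<exists>B. \<forall>x. \<bar>P bs x\<bar> \<le> B)"
    using assms unfolding Cb_k_def by blast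
  \<comment> \<open>Here \<open>n\<close> counts the derivatives still available after those already
    taken along \<open>bs\<close>.\<close>
  have "cb_class n (P bs)" if "length bs + n = k" "set bs \<subseteq> Basis" for n bs
    using that
  proof (induction n arbitrary: bs)
    case 0
    then show ?case using P(3)[of bs] by auto
  next
    case (Suc n)
    obtain B where B: "\<And>x. \<bar>P bs x\<bar> \<le> B" using P(3)[of bs] Suc.prems by auto
    show ?case
    proof (rule cb_class_SucI[where D="\<lambda>b. P (b # bs)", OF _ B])
      show "continuous_on UNIV (P bs)" using P(3)[of bs] Suc.prems by auto
      show "\<And>b x. b \<in> Basis \<Longrightarrow> ((\<lambda>h. P bs (x + h *\<^sub>R b)) has_real_derivative P (b # bs) x) (at 0)"
        using Suc.prems by (intro P(2)) auto
      show "\<And>b. b \<in> Basis \<Longrightarrow> cb_class n (P (b # bs))" using Suc.prems by (intro Suc.IH) auto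
    qed
  qed
  from this[of "[]" k] show ?thesis using P by simp
qed

lemma cb_class_imp_Cb_k:
  assumes "cb_class k f" shows "Cb_k k f"
proof -
  have *: "cb_class (k - length bs) (foldr partial_deriv bs f)" if "length bs \<le> k" "set bs \<subseteq> Basis" for bs :: "'a list"
    using that
  proof (induction bs)
    case (Cons b bs)
    then have "cb_class (Suc (k - length (b # bs))) (foldr partial_deriv bs f)"
      by (simp add: Suc_diff_Suc)
    from cb_class_partial_deriv(2)[OF this, of b] show ?case using Cons.prems by simp
  qed (simp add: assms)
  show ?thesis unfolding Cb_k_def
  proof (intro exI[of _ "\<lambda>bs. foldr partial_deriv bs f"] conjI allI impI)
    fix bs :: "'a list" and b x assume a: "length bs < k \<and> set (b # bs) \<subseteq> Basis"
    then have "cb_class (Suc (k - length (b # bs))) (foldr partial_deriv bs f)"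
      using *[of bs] by (simp add: Suc_diff_Suc)
    from cb_class_partial_deriv(1)[OF this, of b x]
    show "((\<lambda>h. foldr partial_deriv bs f (x + h *\<^sub>R b)) has_real_derivative foldr partial_deriv (b # bs) f x) (at 0)"
      using a by simp
  next
    fix bs :: "'a list" assume a: "length bs \<le> k \<and> set bs \<subseteq> Basis"
    then show "continuous_on UNIV (foldr partial_deriv bs f)" using cb_class_continuous[OF *[of bs]] by blast
    show "\<exists>B. \<forall>x. \<bar>foldr partial_deriv bs f x\<bar> \<le> B"
      by (rule cb_class_bounded[OF *[of bs]]) (use a in auto)
  qed simp
qed

lemma Cb_23_cb_class_slice:
  assumes "Cb_23 \<psi>" "t \<in> {0<..1}" shows "cb_class 3 (\<psi> t)"
proof -
  obtain P :: "'a list \<Rightarrow> real \<Rightarrow> 'a \<Rightarrow> real" where P: "P [] = \<psi> \<and>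
    (\<forall>bs b t x. length bs < 3 \<and> set (b # bs) \<subseteq> Basis \<and> t \<in> {0<..1} \<longrightarrow>
        ((\<lambda>h. P bs t (x + h *\<^sub>R b)) has_real_derivative P (b # bs) t x) (at 0)) \<and>
    (\<forall>bs. length bs \<le> 3 \<and> set bs \<subseteq> Basis \<longrightarrow> continuous_on ({0<..1} \<times> UNIV) (\<lambda>(t,x). P bs t x) \<and>
          (\<exists>B. \<forall>t\<in>{0<..1}. \<forall>x. \<bar>P bs t x\<bar> \<le> B))"
    using conjunct2[OF assms(1)[unfolded Cb_23_def]] ..
  have P3: "continuous_on ({0<..1} \<times> UNIV) (\<lambda>(t,x). P bs t x) \<and> (\<exists>B. \<forall>t\<in>{0<..1}. \<forall>x. \<bar>P bs t x\<bar> \<le> B)"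
    if "length bs \<le> 3" "set bs \<subseteq> Basis" for bs using P that by blast
  have P4: "continuous_on UNIV (P bs t)" if "length bs \<le> 3" "set bs \<subseteq> Basis" for bs
  proof -
    have "continuous_on UNIV (\<lambda>x. (\<lambda>(t,x). P bs t x) (t, x))"
      by (rule continuous_on_compose2[OF conjunct1[OF P3[OF that]]]) (use assms(2) in \<open>auto intro!: continuous_intros\<close>)
    then show ?thesis by simp
  qed
  have "Cb_k 3 (\<psi> t)" unfolding Cb_k_def
  proof (intro exI[of _ "\<lambda>bs. P bs t"] conjI allI impI)
    show "P [] t = \<psi> t" using P by simp
    show "((\<lambda>h. P bs t (x + h *\<^sub>R b)) has_real_derivative P (b # bs) t x) (at 0)"
      if "length bs < 3 \<and> set (b # bs) \<subseteq> Basis" for bs b x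
      using conjunct1[OF conjunct2[OF P], rule_format, of bs b t x] that assms(2) by blast
    show "continuous_on UNIV (P bs t)" if "length bs \<le> 3 \<and> set bs \<subseteq> Basis" for bs using P4 that by blast
    show "\<exists>B. \<forall>x. \<bar>P bs t x\<bar> \<le> B" if "length bs \<le> 3 \<and> set bs \<subseteq> Basis" for bs
      using P3[of bs] that assms(2) by blast
  qed
  then show ?thesis by (rule Cb_k_imp_cb_class)
qed

text \<open>Time is the basis direction \<open>(1, 0)\<close>; three derivatives in all variables
  jointly include two in t and three in x.\<close>

lemma Cb_23_of_cb_class:
  assumes "cb_class 3 F" shows "Cb_23 (\<lambda>t x. F (t, x))"
proof -
  obtain Q where Q: "Q [] = F"
    "\<And>bs b x. length bs < 3 \<Longrightarrow> set (b # bs) \<subseteq> Basis \<Longrightarrow>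
        ((\<lambda>h. Q bs (x + h *\<^sub>R b)) has_real_derivative Q (b # bs) x) (at 0)"
    "\<And>bs. length bs \<le> 3 \<Longrightarrow> set bs \<subseteq> Basis \<Longrightarrow> continuous_on UNIV (Q bs) \<and> (\<exists>B. \<forall>x. \<bar>Q bs x\<bar> \<le> B)"
    using cb_class_imp_Cb_k[OF assms] unfolding Cb_k_def by blast
  let ?e = "(1::real, 0::'a)"
  let ?T = "\<lambda>(i::nat) (t::real) (x::'a). Q (replicate i ?e) (t, x)"
  let ?P = "\<lambda>bs t x. Q (map (\<lambda>b. (0::real, b)) bs) (t, x)"
  have e: "set (replicate i ?e) \<subseteq> Basis" for i :: nat by (auto simp: Basis_prod_def)
  have b: "set (map (\<lambda>b. (0::real, b)) bs) \<subseteq> Basis" if "set bs \<subseteq> Basis" for bs :: "'a list"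
    using that by (auto simp: Basis_prod_def)
  show ?thesis unfolding Cb_23_def
  proof (intro conjI exI[of _ ?T] exI[of _ ?P] allI impI)
    fix i :: nat and t x assume "i < 2 \<and> t \<in> {0<..(1::real)}"
    then have "((\<lambda>h. Q (replicate i ?e) ((t,x) + h *\<^sub>R ?e)) has_real_derivative Q (?e # replicate i ?e) (t,x)) (at 0)"
      by (intro Q(2)) (use e[of "Suc i"] in auto)
    then have "((\<lambda>h. ?T i (t + h) x) has_real_derivative ?T (Suc i) t x) (at 0)" by simp
    then have "((\<lambda>s. ?T i s x) has_real_derivative ?T (Suc i) t x) (at t)"
      by (simp add: DERIV_def)
    then show "((\<lambda>s. ?T i s x) has_real_derivative ?T (Suc i) t x) (at t within {0<..1})"
      by (rule has_field_derivative_at_within)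
  next
    fix bs :: "'a list" and b t x assume a: "length bs < 3 \<and> set (b # bs) \<subseteq> Basis \<and> t \<in> {0<..(1::real)}"
    have "((\<lambda>h. Q (map (\<lambda>b. (0::real, b)) bs) ((t,x) + h *\<^sub>R (0, b))) has_real_derivative
        Q (((0, b)) # map (\<lambda>b. (0::real, b)) bs) (t,x)) (at 0)"
      by (intro Q(2)) (use a b[of "b # bs"] in auto)
    then show "((\<lambda>h. ?P bs t (x + h *\<^sub>R b)) has_real_derivative ?P (b # bs) t x) (at 0)" by simp
  next
    fix i :: nat assume "i \<le> 2"
    then show "continuous_on ({0<..1} \<times> UNIV) (\<lambda>(t, x). ?T i t x)"
      using Q(3)[of "replicate i ?e"] e[of i] by (auto intro: continuous_on_subset)
    show "\<exists>B. \<forall>t\<in>{0<..1}. \<forall>x. \<bar>?T i t x\<bar> \<le> B"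
      using Q(3)[of "replicate i ?e"] e[of i] \<open>i \<le> 2\<close> by auto
  next
    fix bs :: "'a list" assume a: "length bs \<le> 3 \<and> set bs \<subseteq> Basis"
    then show "continuous_on ({0<..1} \<times> UNIV) (\<lambda>(t, x). ?P bs t x)"
      using Q(3)[OF _ b, of bs] by (auto intro: continuous_on_subset)
    show "\<exists>B. \<forall>t\<in>{0<..1}. \<forall>x. \<bar>?P bs t x\<bar> \<le> B"
      using Q(3)[OF _ b, of bs] a by auto
  qed (auto simp: Q(1))
qed

section \<open>Frechet derivatives, Lipschitz bounds and Taylor estimates\<close>

lemma has_derivative_of_partials:
  fixes f :: "'v::euclidean_space \<Rightarrow> real"
  assumes d: "\<And>b x. b \<in> Basis \<Longrightarrow> ((\<lambda>h. f (x + h *\<^sub>R b)) has_real_derivative D b x) (at 0)"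
    and c: "\<And>b. b \<in> Basis \<Longrightarrow> continuous_on UNIV (D b)"
  shows "(f has_derivative (\<lambda>h. \<Sum>b\<in>Basis. (h \<bullet> b) * D b x)) (at x)"
proof -
  have lin: "bounded_linear (\<lambda>h. \<Sum>b\<in>Basis. (h \<bullet> b) * D b x)"
    by (intro bounded_linear_sum bounded_linear_mult_const bounded_linear_inner_left)
  have d': "((\<lambda>h. f (x + h *\<^sub>R b)) has_real_derivative D b (x + s *\<^sub>R b)) (at s)" if "b \<in> Basis" for b x s
    using d[OF that, of "x + s *\<^sub>R b"] DERIV_shift[of "\<lambda>h. f (x + h *\<^sub>R b)" "D b (x + s *\<^sub>R b)" 0 s]
    by (simp add: algebra_simps)
  show ?thesis
    unfolding has_derivative_at_alt
  proof (intro conjI allI impI lin)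
    fix e :: real assume "0 < e"
    \<comment> \<open>The increment is split over the coordinate directions, each of which may
      contribute \<open>e' * norm h\<close>.\<close>
    define e' where "e' = e / DIM('v)"
    have e': "e' > 0" using \<open>0 < e\<close> by (simp add: e'_def)
    have "\<exists>r>0. \<forall>y. norm (y - x) < r \<longrightarrow> \<bar>D b y - D b x\<bar> \<le> e'" if "b \<in> Basis" for b
      using c[OF that] e' unfolding continuous_on_iff dist_norm real_norm_def
      by (metis UNIV_I less_imp_le)
    then obtain r where r: "\<And>b. b \<in> Basis \<Longrightarrow> r b > 0"
      "\<And>b y. b \<in> Basis \<Longrightarrow> norm (y - x) < r b \<Longrightarrow> \<bar>D b y - D b x\<bar> \<le> e'" by metis
    define d0 where "d0 = Min (r ` Basis)"
    have d0: "d0 > 0" using r(1) by (simp add: d0_def)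
    have D: "\<bar>D b y - D b x\<bar> \<le> e'" if "b \<in> Basis" "norm (y - x) < d0" for b y
      using r(2)[OF that(1), of y] that by (auto simp: d0_def)
    have "norm (f y - f x - (\<Sum>b\<in>Basis. ((y - x) \<bullet> b) * D b x)) \<le> e * norm (y - x)" if "norm (y - x) < d0" for y
    proof -
      define h where "h = y - x"
      have h: "norm h < d0" using that by (simp add: h_def)
      \<comment> \<open>\<open>pt A\<close> moves x towards y only in the coordinates of A. Passing
        from A to \<open>insert b A\<close> is a one-dimensional step, and all points on the way
        stay within \<open>d0\<close> of x because their displacement is dominated componentwise by
        h.\<close>
      define pt where "pt A = x + (\<Sum>b\<in>A. (h \<bullet> b) *\<^sub>R b)" for A
      have ptn: "norm (pt A + s *\<^sub>R b - x) < d0"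
        if "finite A" "insert b A \<subseteq> Basis" "b \<notin> A" "\<bar>s\<bar> \<le> \<bar>h \<bullet> b\<bar>" for A b s
      proof -
        have "norm (pt A + s *\<^sub>R b - x) \<le> norm h"
        proof (rule norm_le_componentwise)
          fix i :: 'v assume i: "i \<in> Basis"
          have "(pt A + s *\<^sub>R b - x) \<bullet> i = (\<Sum>a\<in>A. (h \<bullet> a) * (a \<bullet> i)) + s * (b \<bullet> i)"
            by (simp add: pt_def inner_diff_left inner_left_distrib inner_sum_left)
          also have "(\<Sum>a\<in>A. (h \<bullet> a) * (a \<bullet> i)) = (\<Sum>a\<in>A. if a = i then h \<bullet> a else 0)"
            using that i by (intro sum.cong) (auto simp: inner_Basis)
          also have "\<dots> = (if i \<in> A then h \<bullet> i else 0)" using that by simp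
          finally show "\<bar>(pt A + s *\<^sub>R b - x) \<bullet> i\<bar> \<le> \<bar>h \<bullet> i\<bar>"
            using that i by (auto simp: inner_Basis)
        qed
        then show ?thesis using h by simp
      qed
      have "\<bar>f (pt A) - f x - (\<Sum>b\<in>A. (h \<bullet> b) * D b x)\<bar> \<le> e' * (\<Sum>b\<in>A. \<bar>h \<bullet> b\<bar>)" if "A \<subseteq> Basis" for A
      proof -
        have "finite A" using that finite_Basis finite_subset by blast
        then show ?thesis using that
        proof (induction A)
          case empty
          then show ?case by (simp add: pt_def)
        next
          case (insert b A)
          define a where "a = h \<bullet> b"
          have b: "b \<in> Basis" using insert by simp
          let ?g = "\<lambda>s. f (pt A + s *\<^sub>R b) - s * D b x"
          have "norm (?g a - ?g 0) \<le> e' * norm (a - 0)"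
          proof (rule field_differentiable_bound[where S="closed_segment 0 a" and f'="\<lambda>s. D b (pt A + s *\<^sub>R b) - D b x"])
            fix s assume s: "s \<in> closed_segment 0 a"
            show "(?g has_field_derivative D b (pt A + s *\<^sub>R b) - D b x) (at s within closed_segment 0 a)"
              by (rule has_field_derivative_at_within) (auto intro!: derivative_eq_intros d'[OF b])
            have "\<bar>s\<bar> \<le> \<bar>h \<bullet> b\<bar>" using s by (auto simp: a_def closed_segment_eq_real_ivl split: if_splits)
            then show "norm (D b (pt A + s *\<^sub>R b) - D b x) \<le> e'"
              using D[OF b ptn] insert by simp
          qed auto
          then have 1: "\<bar>f (pt A + a *\<^sub>R b) - f (pt A) - a * D b x\<bar> \<le> e' * \<bar>a\<bar>" by (simp add: algebra_simps)
          have 2: "pt (insert b A) = pt A + a *\<^sub>R b" using insert by (simp add: pt_def a_def algebra_simps)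
          have 3: "\<bar>f (pt A) - f x - (\<Sum>b\<in>A. (h \<bullet> b) * D b x)\<bar> \<le> e' * (\<Sum>b\<in>A. \<bar>h \<bullet> b\<bar>)"
            using insert by auto
          show ?case using 1 3 insert(1,2) unfolding 2 by (simp add: distrib_left flip: a_def)
        qed
      qed
      from this[of Basis] have "\<bar>f y - f x - (\<Sum>b\<in>Basis. (h \<bullet> b) * D b x)\<bar> \<le> e' * (\<Sum>b\<in>Basis. \<bar>h \<bullet> b\<bar>)"
        by (simp add: pt_def euclidean_representation h_def)
      also have "\<dots> \<le> e' * (\<Sum>b\<in>(Basis::'v set). norm h)"
        using e' by (intro mult_left_mono sum_mono) (auto simp: Basis_le_norm)
      also have "\<dots> = e * norm h" by (simp add: e'_def)
      finally show ?thesis by (simp add: h_def)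
    qed
    then show "\<exists>d>0. \<forall>y. norm (y - x) < d \<longrightarrow>
        norm (f y - f x - (\<Sum>b\<in>Basis. ((y - x) \<bullet> b) * D b x)) \<le> e * norm (y - x)"
      using d0 by blast
  qed
qed

lemma cb_class_has_derivative:
  assumes "cb_class (Suc n) f"
  shows "(f has_derivative (\<lambda>h. \<Sum>b\<in>Basis. (h \<bullet> b) * partial_deriv b f x)) (at x)"
  using cb_class_partial_deriv[OF assms] cb_class_continuous
  by (intro has_derivative_of_partials) blast+

lemma onorm_partials_le:
  fixes D :: "'v::euclidean_space \<Rightarrow> real"
  assumes "\<And>b. b \<in> Basis \<Longrightarrow> \<bar>D b\<bar> \<le> B b"
  shows "onorm (\<lambda>h. \<Sum>b\<in>Basis. (h \<bullet> b) * D b) \<le> (\<Sum>b\<in>(Basis::'v set). B b)"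
proof (rule onorm_le)
  fix h :: 'v
  have "norm (\<Sum>b\<in>Basis. (h \<bullet> b) * D b) \<le> (\<Sum>b\<in>Basis. \<bar>h \<bullet> b\<bar> * \<bar>D b\<bar>)"
    by (rule sum_norm_le) (auto simp: abs_mult)
  also have "\<dots> \<le> (\<Sum>b\<in>Basis. norm h * B b)"
    using assms by (intro sum_mono mult_mono) (auto simp: Basis_le_norm)
  also have "\<dots> = (\<Sum>b\<in>(Basis::'v set). B b) * norm h"
    by (metis sum_distrib_left mult.commute)
  finally show "norm (\<Sum>b\<in>Basis. (h \<bullet> b) * D b) \<le> (\<Sum>b\<in>(Basis::'v set). B b) * norm h" .
qed

lemma cb_class_lipschitz:
  assumes "cb_class (Suc n) (f :: 'v::euclidean_space \<Rightarrow> real)"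
  obtains L where "L \<ge> 0" "\<And>x y. \<bar>f x - f y\<bar> \<le> L * norm (x - y)"
proof -
  have "\<exists>B\<ge>0. \<forall>x. \<bar>partial_deriv b f x\<bar> \<le> B" if "b \<in> Basis" for b
    by (rule cb_class_bounded[OF cb_class_partial_deriv(2)[OF assms that]]) blast
  then obtain B where B: "\<And>b. b \<in> Basis \<Longrightarrow> B b \<ge> 0" "\<And>b x. b \<in> Basis \<Longrightarrow> \<bar>partial_deriv b f x\<bar> \<le> B b"
    by metis
  have "norm (f x - f y) \<le> sum B Basis * norm (x - y)" for x y
    using B by (intro differentiable_bound[where S=UNIV and f'="\<lambda>x h. \<Sum>b\<in>Basis. (h \<bullet> b) * partial_deriv b f x"]
        cb_class_has_derivative[OF assms] onorm_partials_le) auto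
  then show ?thesis using that[of "sum B Basis"] B by (auto simp: sum_nonneg)
qed

lemma cb_class_imp_bdd_lip: "cb_class (Suc n) f \<Longrightarrow> bdd_lip f"
  unfolding bdd_lip_def dist_norm using cb_class_lipschitz cb_class_bounded by metis

text \<open>As a function of x, f(x + m) - f(x) has as partial derivatives the increments of those
  of f, which are of size \<open>norm m\<close>; the mean value inequality adds the factor
  \<open>norm (x - y)\<close>. With \<open>x - m\<close> for y this is a quadratic bound on second
  differences.\<close>

lemma cb_class_mixed_difference:
  assumes f: "cb_class (Suc (Suc n)) (f :: 'v::euclidean_space \<Rightarrow> real)"
  obtains C where "C \<ge> 0" "\<And>x y m. \<bar>(f (x + m) - f x) - (f (y + m) - f y)\<bar> \<le> C * norm m * norm (x - y)"
proof -
  have "\<exists>L\<ge>0. \<forall>x y. \<bar>partial_deriv b f x - partial_deriv b f y\<bar> \<le> L * norm (x - y)" if "b \<in> Basis" for b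
    by (rule cb_class_lipschitz[OF cb_class_partial_deriv(2)[OF f that]]) blast
  then obtain L where L: "\<And>b. b \<in> Basis \<Longrightarrow> L b \<ge> 0"
    "\<And>b x y. b \<in> Basis \<Longrightarrow> \<bar>partial_deriv b f x - partial_deriv b f y\<bar> \<le> L b * norm (x - y)"
    by metis
  have "norm ((f (x + m) - f x) - (f (y + m) - f y)) \<le> (\<Sum>b\<in>Basis. L b * norm m) * norm (x - y)" for x y m
  proof (rule differentiable_bound[where S=UNIV and f="\<lambda>x. f (x + m) - f x" and
        f'="\<lambda>x h. \<Sum>b\<in>Basis. (h \<bullet> b) * (partial_deriv b f (x + m) - partial_deriv b f x)"])
    fix x
    have "((\<lambda>x. f (x + m)) has_derivative (\<lambda>h. \<Sum>b\<in>Basis. (h \<bullet> b) * partial_deriv b f (x + m))) (at x)"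
      by (rule has_derivative_compose[of "\<lambda>x. x + m" "\<lambda>h. h" x UNIV f, OF _ cb_class_has_derivative[OF f]])
        (auto intro!: derivative_eq_intros)
    from has_derivative_diff[OF this cb_class_has_derivative[OF f]]
    show "((\<lambda>x. f (x + m) - f x) has_derivative
      (\<lambda>h. \<Sum>b\<in>Basis. (h \<bullet> b) * (partial_deriv b f (x + m) - partial_deriv b f x))) (at x within UNIV)"
      by (simp add: right_diff_distrib sum_subtractf)
    show "onorm (\<lambda>h. \<Sum>b\<in>Basis. (h \<bullet> b) * (partial_deriv b f (x + m) - partial_deriv b f x))
        \<le> (\<Sum>b\<in>Basis. L b * norm m)"
      using L(2)[of _ "x + m" x] by (intro onorm_partials_le) auto
  qed auto
  then show ?thesis using that[of "sum L Basis"] L(1) by (auto simp: sum_nonneg sum_distrib_right)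
qed

section \<open>Second differences and truncated moduli\<close>

definition second_diff :: "('v::real_vector \<Rightarrow> real) \<Rightarrow> 'v \<Rightarrow> 'v \<Rightarrow> real" where
  "second_diff f x l = f (x + l) + f (x - l) - 2 * f x"

text \<open>The scale a is a parameter because the integral of \<open>quad_cut a\<close> against the
  Levy weight is a multiple of \<open>a powr (-\<alpha>)\<close>: an error cut off at a large scale
  costs little.\<close>

definition quad_cut :: "real \<Rightarrow> real \<Rightarrow> real" where
  "quad_cut a r = min 1 ((r / a)\<^sup>2)"

text \<open>A bounded Lipschitz stand-in for \<open>norm\<close>: it may be inserted into the
  expectations, and (A1) controls it.\<close>

definition trunc_norm :: "'v::real_normed_vector \<Rightarrow> real" where
  "trunc_norm y = min 1 (norm y)"

lemma quad_cut_nonneg [simp]: "0 \<le> quad_cut a r" and quad_cut_le_1 [simp]: "quad_cut a r \<le> 1"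
  by (auto simp: quad_cut_def)

lemma trunc_norm_nonneg [simp]: "0 \<le> trunc_norm y" and trunc_norm_le_1: "trunc_norm y \<le> 1"
  and trunc_norm_le: "trunc_norm y \<le> norm y"
  by (auto simp: trunc_norm_def)

lemma trunc_norm_minus_commute: "trunc_norm (x - y) = trunc_norm (y - x)"
  by (simp add: trunc_norm_def norm_minus_commute)

lemma bound_by_quad_cut:
  assumes "0 \<le> A" "0 \<le> B" "x \<le> A" "x \<le> B * r\<^sup>2"
  shows "x \<le> (A + B) * quad_cut 1 r"
proof (cases "r\<^sup>2 \<le> 1")
  case True
  then have "x \<le> B * r\<^sup>2" "0 \<le> A * r\<^sup>2" using assms by auto
  then show ?thesis using True by (simp add: quad_cut_def min_def algebra_simps)
next
  case False
  then show ?thesis using assms by (simp add: quad_cut_def min_def)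
qed

lemma bound_by_trunc_norm:
  assumes "0 \<le> A" "0 \<le> B" "x \<le> A" "x \<le> B * norm y"
  shows "x \<le> (A + B) * trunc_norm y"
proof (cases "norm y \<le> 1")
  case True
  then have "x \<le> B * norm y" "0 \<le> A * norm y" using assms by auto
  then show ?thesis using True by (simp add: trunc_norm_def min_def algebra_simps)
next
  case False
  then show ?thesis using assms by (simp add: trunc_norm_def min_def)
qed

lemma cb_class_second_diff_square:
  assumes f: "cb_class (Suc (Suc n)) (f :: 'v::euclidean_space \<Rightarrow> real)"
  obtains C where "C \<ge> 0" "\<And>x l. \<bar>second_diff f x l\<bar> \<le> C * (norm l)\<^sup>2"
proof -
  obtain C where C: "C \<ge> 0" "\<And>x y m. \<bar>(f (x + m) - f x) - (f (y + m) - f y)\<bar> \<le> C * norm m * norm (x - y)"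
    using cb_class_mixed_difference[OF f] by blast
  have "\<bar>second_diff f x l\<bar> \<le> C * (norm l)\<^sup>2" for x l
    using C(2)[of x l "x - l"] by (simp add: second_diff_def power2_eq_square algebra_simps)
  then show ?thesis using that C(1) by blast
qed

lemma cb_class_second_diff_bound:
  assumes f: "cb_class (Suc (Suc n)) (f :: 'v::euclidean_space \<Rightarrow> real)"
  obtains C where "C \<ge> 0" "\<And>x l. \<bar>second_diff f x l\<bar> \<le> C * quad_cut 1 (norm l)"
proof -
  obtain C where C: "C \<ge> 0" "\<And>x l. \<bar>second_diff f x l\<bar> \<le> C * (norm l)\<^sup>2"
    using cb_class_second_diff_square[OF f] by blast
  obtain B where B: "B \<ge> 0" "\<And>x. \<bar>f x\<bar> \<le> B" using cb_class_bounded[OF f] by blast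
  have "\<bar>second_diff f x l\<bar> \<le> 4 * B" for x l
    using B(2)[of "x + l"] B(2)[of "x - l"] B(2)[of x] by (auto simp: second_diff_def)
  then have "\<bar>second_diff f x l\<bar> \<le> (4 * B + C) * quad_cut 1 (norm l)" for x l
    using B C by (intro bound_by_quad_cut) auto
  then show ?thesis using that[of "4 * B + C"] B C by auto
qed

text \<open>The third derivatives enter here. Second differences commute with partial
  differentiation, so the gradient in x consists of second differences of the partial derivatives of
  f, which are of class C^2. For distant x and y the bound on the second differences themselves
  takes over.\<close>

lemma cb_class_second_diff_increment:
  assumes f: "cb_class (Suc (Suc (Suc n))) (f :: 'v::euclidean_space \<Rightarrow> real)"
  obtains C where "C \<ge> 0"
    "\<And>x y l. \<bar>second_diff f x l - second_diff f y l\<bar> \<le> C * trunc_norm (x - y) * quad_cut 1 (norm l)"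
proof -
  have "\<exists>C\<ge>0. \<forall>x l. \<bar>second_diff (partial_deriv b f) x l\<bar> \<le> C * quad_cut 1 (norm l)" if "b \<in> Basis" for b
    by (rule cb_class_second_diff_bound[OF cb_class_partial_deriv(2)[OF f that]]) blast
  then obtain C where C: "\<And>b. b \<in> Basis \<Longrightarrow> C b \<ge> 0"
    "\<And>b x l. b \<in> Basis \<Longrightarrow> \<bar>second_diff (partial_deriv b f) x l\<bar> \<le> C b * quad_cut 1 (norm l)"
    by metis
  obtain A where A: "A \<ge> 0" "\<And>x l. \<bar>second_diff f x l\<bar> \<le> A * quad_cut 1 (norm l)"
    using cb_class_second_diff_bound[OF f] by blast
  have lip: "norm (second_diff f x l - second_diff f y l) \<le> (\<Sum>b\<in>Basis. C b * quad_cut 1 (norm l)) * norm (x - y)" for x y l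
  proof (rule differentiable_bound[where S=UNIV and
        f'="\<lambda>x h. \<Sum>b\<in>Basis. (h \<bullet> b) * second_diff (partial_deriv b f) x l"])
    fix x
    have sh: "((\<lambda>x. f (x + m)) has_derivative (\<lambda>h. \<Sum>b\<in>Basis. (h \<bullet> b) * partial_deriv b f (x + m))) (at x)" for m
      by (rule has_derivative_compose[of "\<lambda>x. x + m" "\<lambda>h. h" x UNIV f, OF _ cb_class_has_derivative[OF f]])
        (auto intro!: derivative_eq_intros)
    have "((\<lambda>x. f (x + l) + f (x + - l) - 2 * f x) has_derivative
        (\<lambda>h. (\<Sum>b\<in>Basis. (h \<bullet> b) * partial_deriv b f (x + l)) + (\<Sum>b\<in>Basis. (h \<bullet> b) * partial_deriv b f (x + - l))
           - 2 * (\<Sum>b\<in>Basis. (h \<bullet> b) * partial_deriv b f x))) (at x)"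
      by (intro has_derivative_diff has_derivative_add sh has_derivative_mult_right cb_class_has_derivative[OF f])
    then show "((\<lambda>x. second_diff f x l) has_derivative
      (\<lambda>h. \<Sum>b\<in>Basis. (h \<bullet> b) * second_diff (partial_deriv b f) x l)) (at x within UNIV)"
      by (simp add: second_diff_def algebra_simps sum_subtractf sum.distrib sum_distrib_left)
    show "onorm (\<lambda>h. \<Sum>b\<in>Basis. (h \<bullet> b) * second_diff (partial_deriv b f) x l)
        \<le> (\<Sum>b\<in>Basis. C b * quad_cut 1 (norm l))"
      using C(2) by (intro onorm_partials_le) auto
  qed auto
  have "\<bar>second_diff f x l - second_diff f y l\<bar> \<le> (2 * (A * quad_cut 1 (norm l)) + sum C Basis * quad_cut 1 (norm l)) * trunc_norm (x - y)" for x y l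
    using A(2)[of x l] A(2)[of y l] lip[of x l y] A(1) C(1)
    by (intro bound_by_trunc_norm) (auto simp: sum_nonneg sum_distrib_right)
  then have "\<bar>second_diff f x l - second_diff f y l\<bar> \<le> (2 * A + sum C Basis) * trunc_norm (x - y) * quad_cut 1 (norm l)" for x y l
    by (simp add: algebra_simps)
  then show ?thesis using that[of "2 * A + sum C Basis"] A C(1) by (auto simp: sum_nonneg)
qed

lemma cb_class_taylor:
  assumes f: "cb_class (Suc (Suc n)) (f :: 'v::euclidean_space \<Rightarrow> real)"
  obtains C where "C \<ge> 0"
    "\<And>x l. \<bar>f (x + l) - f x - (\<Sum>b\<in>Basis. (l \<bullet> b) * partial_deriv b f x)\<bar> \<le> C * (norm l)\<^sup>2"
proof -
  have "\<exists>L\<ge>0. \<forall>x y. \<bar>partial_deriv b f x - partial_deriv b f y\<bar> \<le> L * norm (x - y)" if "b \<in> Basis" for b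
    by (rule cb_class_lipschitz[OF cb_class_partial_deriv(2)[OF f that]]) blast
  then obtain L where L: "\<And>b. b \<in> Basis \<Longrightarrow> L b \<ge> 0"
    "\<And>b x y. b \<in> Basis \<Longrightarrow> \<bar>partial_deriv b f x - partial_deriv b f y\<bar> \<le> L b * norm (x - y)"
    by metis
  have "norm (f (x + l) - f x - (\<Sum>b\<in>Basis. ((x + l - x) \<bullet> b) * partial_deriv b f x))
      \<le> norm (x + l - x) * (\<Sum>b\<in>Basis. L b * norm l)" for x l
  proof (rule differentiable_bound_linearization[where S="cball x (norm l)" and ?x0.0=x and
        f'="\<lambda>x h. \<Sum>b\<in>Basis. (h \<bullet> b) * partial_deriv b f x"])
    fix y assume "y \<in> cball x (norm l)"
    then have "L b * norm (y - x) \<le> L b * norm l" if "b \<in> Basis" for b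
      using L(1)[OF that] by (intro mult_left_mono) (auto simp: dist_norm norm_minus_commute)
    then have le: "\<bar>partial_deriv b f y - partial_deriv b f x\<bar> \<le> L b * norm l" if "b \<in> Basis" for b
      using L(2)[OF that, of y x] that by force
    have eq: "(\<lambda>h. \<Sum>b\<in>Basis. (h \<bullet> b) * partial_deriv b f y) - (\<lambda>h. \<Sum>b\<in>Basis. (h \<bullet> b) * partial_deriv b f x)
      = (\<lambda>h. \<Sum>b\<in>Basis. (h \<bullet> b) * (partial_deriv b f y - partial_deriv b f x))"
      by (auto simp: fun_diff_def right_diff_distrib sum_subtractf)
    show "onorm ((\<lambda>h. \<Sum>b\<in>Basis. (h \<bullet> b) * partial_deriv b f y) - (\<lambda>h. \<Sum>b\<in>Basis. (h \<bullet> b) * partial_deriv b f x))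
        \<le> (\<Sum>b\<in>Basis. L b * norm l)"
      unfolding eq by (rule onorm_partials_le) (rule le)
  qed (auto intro: has_derivative_at_withinI[OF cb_class_has_derivative[OF f]] simp: dist_norm mult_left_le_one_le)
  then have "\<bar>f (x + l) - f x - (\<Sum>b\<in>Basis. (l \<bullet> b) * partial_deriv b f x)\<bar> \<le> sum L Basis * (norm l)\<^sup>2" for x l
    by (simp add: power2_eq_square sum_distrib_right mult.commute mult.left_commute sum_distrib_left)
  then show ?thesis using that[of "sum L Basis"] L(1) by (auto simp: sum_nonneg)
qed

lemma cb_class_deriv_along_line:
  assumes "cb_class (Suc n) f"
  shows "deriv (\<lambda>h. f (x + h *\<^sub>R l)) 0 = (\<Sum>b\<in>Basis. (l \<bullet> b) * partial_deriv b f x)"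
proof (rule DERIV_imp_deriv)
  let ?D = "\<lambda>h. \<Sum>b\<in>Basis. (h \<bullet> b) * partial_deriv b f x"
  have "((\<lambda>h. f (x + h *\<^sub>R l)) has_derivative (\<lambda>h. ?D (h *\<^sub>R l))) (at 0)"
    by (rule has_derivative_compose[of "\<lambda>h. x + h *\<^sub>R l" "\<lambda>h. h *\<^sub>R l" 0 UNIV f ?D])
      (use cb_class_has_derivative[OF assms, of x] in \<open>auto intro!: derivative_eq_intros\<close>)
  then show "((\<lambda>h. f (x + h *\<^sub>R l)) has_real_derivative ?D l) (at 0)"
    unfolding has_field_derivative_def
    by (rule has_derivative_eq_rhs) (auto simp: sum_distrib_left sum_distrib_right algebra_simps)
qed

section \<open>The generator in terms of second differences\<close>

text \<open>Near 0 the integrand is \<open>r powr (p - 1 - \<alpha>)\<close>, integrable because p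
  exceeds \<alpha>; beyond 1 it is \<open>r powr (-1 - \<alpha>)\<close>, integrable because
  \<alpha> is positive.\<close>

lemma set_integrable_levy_weight:
  fixes \<alpha> p :: real
  assumes "0 < \<alpha>" "\<alpha> < p"
  shows "set_integrable lborel {0<..} (\<lambda>r. min 1 (r powr p) * r powr (-1 - \<alpha>))"
proof -
  have "(\<lambda>r. r powr (p - 1 - \<alpha>)) absolutely_integrable_on {0<..1::real}"
    using assms by (intro nonnegative_absolutely_integrable_1 integrable_on_powr_from_0') auto
  then have "set_integrable lborel {0<..1::real} (\<lambda>r. r powr (p - 1 - \<alpha>))"
    unfolding set_integrable_def by (subst (asm) integrable_completion) auto
  also have "?this \<longleftrightarrow> set_integrable lborel {0<..1::real} (\<lambda>r. min 1 (r powr p) * r powr (-1 - \<alpha>))"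
  proof (rule set_integrable_cong)
    fix r :: real assume r: "r \<in> {0<..1}"
    then have "r powr p \<le> 1" using assms powr_le1 by auto
    then show "r powr (p - 1 - \<alpha>) = min 1 (r powr p) * r powr (-1 - \<alpha>)"
      by (simp add: min_def powr_add[symmetric] algebra_simps)
  qed simp_all
  finally have 1: "set_integrable lborel {0<..1::real} (\<lambda>r. min 1 (r powr p) * r powr (-1 - \<alpha>))" .
  have "(\<lambda>r. r powr (-1 - \<alpha>)) absolutely_integrable_on {1::real..}"
    using assms has_integral_powr_to_inf[of "-1 - \<alpha>" 1]
    by (intro nonnegative_absolutely_integrable_1) (auto simp: integrable_on_def)
  then have "set_integrable lborel {1::real..} (\<lambda>r. r powr (-1 - \<alpha>))"
    unfolding set_integrable_def by (subst (asm) integrable_completion) auto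
  also have "?this \<longleftrightarrow> set_integrable lborel {1::real..} (\<lambda>r. min 1 (r powr p) * r powr (-1 - \<alpha>))"
  proof (rule set_integrable_cong)
    fix r :: real assume r: "r \<in> {1..}"
    then have "1 \<le> r powr p" using assms by (intro ge_one_powr_ge_zero) auto
    then show "r powr (-1 - \<alpha>) = min 1 (r powr p) * r powr (-1 - \<alpha>)" by simp
  qed simp_all
  finally have 2: "set_integrable lborel {1::real..} (\<lambda>r. min 1 (r powr p) * r powr (-1 - \<alpha>))" .
  have "{0<..} = {0<..1} \<union> {1::real..}" by auto
  then show ?thesis using set_integrable_Un[OF 1 2] by simp
qed

definition levy_mass :: "real \<Rightarrow> real" where
  "levy_mass \<alpha> = (LINT r:{0<..}|lborel. quad_cut 1 r * r powr (-1 - \<alpha>))"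

text \<open>Scaling: replacing r by a r produces the factor \<open>a powr (-1-\<alpha>)\<close>, and
  the Jacobian a raises its exponent to -\<alpha>.\<close>

lemma quad_cut_levy_weight:
  assumes "0 < \<alpha>" "\<alpha> \<le> 1" "0 < a"
  shows set_integrable_quad_cut: "set_integrable lborel {0<..} (\<lambda>r. quad_cut a r * r powr (-1 - \<alpha>))"
    and set_integral_quad_cut: "(LINT r:{0<..}|lborel. quad_cut a r * r powr (-1 - \<alpha>)) = levy_mass \<alpha> * a powr (-\<alpha>)"
proof -
  have "set_integrable lborel {0<..} (\<lambda>r. min 1 (r powr 2) * r powr (-1 - \<alpha>))"
    using assms by (intro set_integrable_levy_weight) auto
  also have "?this \<longleftrightarrow> set_integrable lborel {0<..} (\<lambda>r. quad_cut 1 r * r powr (-1 - \<alpha>))"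
    by (rule set_integrable_cong) (auto simp: quad_cut_def)
  finally have i1: "integrable lborel (\<lambda>r. indicator {0<..} r *\<^sub>R (quad_cut 1 r * r powr (-1 - \<alpha>)))"
    by (simp add: set_integrable_def)
  let ?h = "\<lambda>r::real. indicator {0<..} r *\<^sub>R (quad_cut a r * r powr (-1 - \<alpha>))"
  have eq: "?h (0 + a * r) = a powr (-1-\<alpha>) * (indicator {0<..} r *\<^sub>R (quad_cut 1 r * r powr (-1 - \<alpha>)))" for r
    using assms by (auto simp: indicator_def quad_cut_def powr_mult zero_less_mult_iff)
  have "integrable lborel (\<lambda>r. ?h (0 + a * r))"
    unfolding eq using i1 by (rule integrable_mult_right)
  then show "set_integrable lborel {0<..} (\<lambda>r. quad_cut a r * r powr (-1 - \<alpha>))"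
    using assms lborel_integrable_real_affine_iff[of a ?h 0] by (simp add: set_integrable_def)
  have "(\<integral>r. ?h r \<partial>lborel) = \<bar>a\<bar> *\<^sub>R (\<integral>r. ?h (0 + a * r) \<partial>lborel)"
    using assms by (intro lborel_integral_real_affine) auto
  also have "\<dots> = a * (a powr (-1-\<alpha>) * levy_mass \<alpha>)"
    unfolding eq levy_mass_def set_lebesgue_integral_def using assms by simp
  also have "a * (a powr (-1-\<alpha>) * levy_mass \<alpha>) = levy_mass \<alpha> * a powr (-\<alpha>)"
    using assms powr_mult_base[of a "-1-\<alpha>"] by simp
  finally show "(LINT r:{0<..}|lborel. quad_cut a r * r powr (-1 - \<alpha>)) = levy_mass \<alpha> * a powr (-\<alpha>)"
    by (simp add: set_lebesgue_integral_def)
qed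

lemma levy_mass_nonneg: "0 \<le> levy_mass \<alpha>"
  unfolding levy_mass_def set_lebesgue_integral_def by (intro Bochner_Integration.integral_nonneg) auto

section \<open>Symmetrisation of the Levy integral\<close>

lemma delta_op_eq:
  assumes "cb_class (Suc n) f"
  shows "delta_op \<alpha> f x l = f (x + l) - f x -
    (if \<alpha> = 1 \<and> norm l \<le> 1 then \<Sum>b\<in>Basis. (l \<bullet> b) * partial_deriv b f x else 0)"
  by (simp add: delta_op_def cb_class_deriv_along_line[OF assms])

lemma delta_op_add_reflected:
  assumes "cb_class (Suc n) f"
  shows "delta_op \<alpha> f x l + delta_op \<alpha> f x (- l) = second_diff f x l"
  by (simp add: delta_op_eq[OF assms] second_diff_def sum_negf)

lemma borel_measurable_delta_op:
  assumes "cb_class (Suc n) f"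
  shows "delta_op \<alpha> f x \<in> borel_measurable borel"
proof -
  have [measurable]: "(\<lambda>l. f (x + l)) \<in> borel_measurable borel"
    by (intro borel_measurable_continuous_onI continuous_on_compose2[OF cb_class_continuous[OF assms, of UNIV]] continuous_intros) auto
  show ?thesis unfolding delta_op_eq[OF assms, abs_def] by measurable
qed

text \<open>Integrability at 0 asks for an exponent p above \<alpha>. At \<alpha> = 1 the
  compensator removes the linear part and Taylor gives p = 2; for \<alpha> < 1 there is no
  compensator and the Lipschitz bound gives p = 1.\<close>

lemma delta_op_bound:
  assumes f: "cb_class (Suc (Suc n)) f" and "\<alpha> \<le> 1"
  obtains C p where "C \<ge> 0" "\<alpha> < p" "\<And>l. \<bar>delta_op \<alpha> f x l\<bar> \<le> C * min 1 (norm l powr p)"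
proof -
  obtain B where B: "B \<ge> 0" "\<And>x. \<bar>f x\<bar> \<le> B" using cb_class_bounded[OF f] by blast
  have B2: "\<bar>f (x + l) - f x\<bar> \<le> 2 * B" for l using B(2)[of "x + l"] B(2)[of x] by linarith
  show ?thesis
  proof (cases "\<alpha> = 1")
    case True
    obtain C where C: "C \<ge> 0"
      "\<And>x l. \<bar>f (x + l) - f x - (\<Sum>b\<in>Basis. (l \<bullet> b) * partial_deriv b f x)\<bar> \<le> C * (norm l)\<^sup>2"
      using cb_class_taylor[OF f] by blast
    have "\<bar>delta_op \<alpha> f x l\<bar> \<le> (2 * B + C) * min 1 (norm l powr 2)" for l
    proof (cases "norm l \<le> 1")
      case l: True
      then have "(norm l)\<^sup>2 \<le> 1" by (simp add: power_le_one)
      moreover have "\<bar>delta_op \<alpha> f x l\<bar> \<le> C * (norm l)\<^sup>2"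
        using C(2)[of x l] l True by (simp add: delta_op_eq[OF f])
      moreover have "C * (norm l)\<^sup>2 \<le> (2 * B + C) * (norm l)\<^sup>2"
        using B C by (intro mult_right_mono) auto
      ultimately show ?thesis by simp
    next
      case l: False
      then have "1 \<le> (norm l)\<^sup>2" by simp
      then show ?thesis using l B2[of l] C(1) by (simp add: delta_op_eq[OF f])
    qed
    then show ?thesis using that[of "2 * B + C" 2] B C True by auto
  next
    case False
    obtain L where L: "L \<ge> 0" "\<And>x y. \<bar>f x - f y\<bar> \<le> L * norm (x - y)" using cb_class_lipschitz[OF f] by blast
    have "\<bar>delta_op \<alpha> f x l\<bar> \<le> (2 * B + L) * trunc_norm l" for l
      using B2[of l] B L(1) L(2)[of "x + l" x] False
      by (intro bound_by_trunc_norm) (auto simp: delta_op_eq[OF f])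
    then show ?thesis using that[of "2 * B + L" 1] B L False assms(2) by (auto simp: trunc_norm_def)
  qed
qed

context
  fixes \<alpha> :: real and f :: "'v::euclidean_space \<Rightarrow> real" and x :: 'v and n :: nat
  assumes alpha: "0 < \<alpha>" "\<alpha> \<le> 1" and f: "cb_class (Suc (Suc n)) f"
begin

lemma set_integrable_delta_op:
  assumes "norm z = 1"
  shows "set_integrable lborel {0<..} (\<lambda>r. delta_op \<alpha> f x (r *\<^sub>R z) * r powr (-1 - \<alpha>))"
proof -
  obtain C p where C: "C \<ge> 0" "\<alpha> < p" "\<And>l. \<bar>delta_op \<alpha> f x l\<bar> \<le> C * min 1 (norm l powr p)"
    using delta_op_bound[OF f alpha(2), of x] by blast
  have [measurable]: "delta_op \<alpha> f x \<in> borel_measurable borel" by (rule borel_measurable_delta_op[OF f])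
  show ?thesis
  proof (rule set_integrable_bound)
    show "set_integrable lborel {0<..} (\<lambda>r. C * (min 1 (r powr p) * r powr (-1 - \<alpha>)))"
      using set_integrable_levy_weight[OF alpha(1) C(2)] by simp
    show "set_borel_measurable lborel {0<..} (\<lambda>r. delta_op \<alpha> f x (r *\<^sub>R z) * r powr (-1 - \<alpha>))"
      unfolding set_borel_measurable_def by measurable
    show "AE r in lborel. r \<in> {0<..} \<longrightarrow> norm (delta_op \<alpha> f x (r *\<^sub>R z) * r powr (-1 - \<alpha>))
        \<le> norm (C * (min 1 (r powr p) * r powr (-1 - \<alpha>)))"
    proof (intro AE_I2 impI)
      fix r :: real assume "r \<in> {0<..}"
      then have "\<bar>delta_op \<alpha> f x (r *\<^sub>R z)\<bar> * r powr (-1 - \<alpha>) \<le> (C * min 1 (r powr p)) * r powr (-1 - \<alpha>)"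
        using C(3)[of "r *\<^sub>R z"] assms by (intro mult_right_mono) auto
      then show "norm (delta_op \<alpha> f x (r *\<^sub>R z) * r powr (-1 - \<alpha>))
        \<le> norm (C * (min 1 (r powr p) * r powr (-1 - \<alpha>)))"
        using C(1) by (simp add: abs_mult mult.assoc)
    qed
  qed
qed

private abbreviation "radial z \<equiv> (LINT r:{0<..}|lborel. delta_op \<alpha> f x (r *\<^sub>R z) * r powr (-1 - \<alpha>))"

lemma radial_integral_symmetrized:
  assumes "norm z = 1"
  shows "set_integrable lborel {0<..} (\<lambda>r. second_diff f x (r *\<^sub>R z) * r powr (-1 - \<alpha>))"
    and "radial z + radial (- z) = (LINT r:{0<..}|lborel. second_diff f x (r *\<^sub>R z) * r powr (-1 - \<alpha>))"
proof -
  have eq: "second_diff f x (r *\<^sub>R z) * r powr (-1 - \<alpha>) =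
      delta_op \<alpha> f x (r *\<^sub>R z) * r powr (-1 - \<alpha>) + delta_op \<alpha> f x (r *\<^sub>R (- z)) * r powr (-1 - \<alpha>)" for r
    using delta_op_add_reflected[OF f, of \<alpha> x "r *\<^sub>R z"] by (simp flip: distrib_right)
  have i: "set_integrable lborel {0<..} (\<lambda>r. delta_op \<alpha> f x (r *\<^sub>R z) * r powr (-1 - \<alpha>))"
     "set_integrable lborel {0<..} (\<lambda>r. delta_op \<alpha> f x (r *\<^sub>R (- z)) * r powr (-1 - \<alpha>))"
    using set_integrable_delta_op[of z] set_integrable_delta_op[of "- z"] assms by simp_all
  show "set_integrable lborel {0<..} (\<lambda>r. second_diff f x (r *\<^sub>R z) * r powr (-1 - \<alpha>))"
    unfolding eq using i by (rule set_integral_add)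
  show "radial z + radial (- z) = (LINT r:{0<..}|lborel. second_diff f x (r *\<^sub>R z) * r powr (-1 - \<alpha>))"
    unfolding eq using i by (rule set_integral_add(2)[symmetric])
qed

text \<open>Invariance of \<mu> under negation allows \<open>radial z\<close> to be replaced by the
  mean of \<open>radial z\<close> and \<open>radial (- z)\<close>, in which the gradient
  compensators cancel. Integrability of the one-sided parts comes first, since otherwise the Bochner
  integrals could not be split.\<close>

lemma levy_int_symmetrized:
  assumes mu: "\<mu> \<in> sphere_measures"
  shows "integrable \<mu> (\<lambda>z. LINT r:{0<..}|lborel. second_diff f x (r *\<^sub>R z) * r powr (-1 - \<alpha>))"
    and "levy_int \<alpha> \<mu> f x = (\<integral>z. (LINT r:{0<..}|lborel. second_diff f x (r *\<^sub>R z) * r powr (-1 - \<alpha>)) \<partial>\<mu>) / 2"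
proof -
  have sp: "space \<mu> = sphere 0 1" and se: "sets \<mu> = sets (restrict_space borel (sphere 0 1))"
    and fin: "finite_measure \<mu>" and sym: "\<And>A. A \<in> sets \<mu> \<Longrightarrow> emeasure \<mu> (uminus ` A) = emeasure \<mu> A"
    using mu by (auto simp: sphere_measures_def)
  interpret finite_measure \<mu> by (rule fin)
  have [measurable]: "delta_op \<alpha> f x \<in> borel_measurable borel" by (rule borel_measurable_delta_op[OF f])
  have "radial \<in> borel_measurable borel"
    unfolding set_lebesgue_integral_def
    by (rule lborel.borel_measurable_lebesgue_integral) measurable
  then have meas: "radial \<in> borel_measurable \<mu>"
    using measurable_restrict_space1[of radial borel borel "sphere 0 1"] measurable_cong_sets[OF se refl] by blast
  obtain C p where C: "C \<ge> 0" "\<alpha> < p" "\<And>l. \<bar>delta_op \<alpha> f x l\<bar> \<le> C * min 1 (norm l powr p)"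
    using delta_op_bound[OF f alpha(2), of x] by blast
  define K where "K = (LINT r:{0<..}|lborel. C * (min 1 (r powr p) * r powr (-1 - \<alpha>)))"
  \<comment> \<open>A bound independent of the direction suffices for integrability, as \<mu> is
    finite.\<close>
  have bd: "\<bar>radial z\<bar> \<le> K" if "norm z = 1" for z
  proof -
    have "\<bar>radial z\<bar> \<le> (LINT r:{0<..}|lborel. \<bar>delta_op \<alpha> f x (r *\<^sub>R z) * r powr (-1 - \<alpha>)\<bar>)"
      using set_integral_norm_bound[OF set_integrable_delta_op[OF that]] by simp
    also have "\<dots> \<le> K" unfolding K_def
    proof (rule set_integral_mono)
      show "set_integrable lborel {0<..} (\<lambda>r. \<bar>delta_op \<alpha> f x (r *\<^sub>R z) * r powr (-1 - \<alpha>)\<bar>)"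
        using set_integrable_abs[OF set_integrable_delta_op[OF that]] .
      show "set_integrable lborel {0<..} (\<lambda>r. C * (min 1 (r powr p) * r powr (-1 - \<alpha>)))"
        using set_integrable_levy_weight[OF alpha(1) C(2)] by simp
      fix r :: real assume "r \<in> {0<..}"
      then have "\<bar>delta_op \<alpha> f x (r *\<^sub>R z)\<bar> * r powr (-1 - \<alpha>) \<le> (C * min 1 (r powr p)) * r powr (-1 - \<alpha>)"
        using C(3)[of "r *\<^sub>R z"] that by (intro mult_right_mono) auto
      then show "\<bar>delta_op \<alpha> f x (r *\<^sub>R z) * r powr (-1 - \<alpha>)\<bar> \<le> C * (min 1 (r powr p) * r powr (-1 - \<alpha>))"
        by (simp add: abs_mult mult.assoc)
    qed
    finally show ?thesis .
  qed
  have int: "integrable \<mu> radial"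
    by (rule integrable_const_bound[where B=K]) (auto simp: meas sp bd)
  have um: "uminus \<in> measurable \<mu> \<mu>"
  proof -
    have "uminus \<in> measurable (restrict_space borel (sphere 0 1)) (restrict_space borel (sphere (0::'v) 1))"
      by (rule measurable_restrict_space3) auto
    then show ?thesis using measurable_cong_sets[OF se se] by blast
  qed
  \<comment> \<open>The symmetry is given for sets; as an identity of image measures it becomes a
    change of variables.\<close>
  have distr: "distr \<mu> \<mu> uminus = \<mu>"
  proof (rule measure_eqI)
    fix A assume "A \<in> sets (distr \<mu> \<mu> uminus)"
    then have A: "A \<in> sets \<mu>" by simp
    have "A \<subseteq> sphere 0 1" using sets.sets_into_space[OF A] sp by simp
    then have "uminus -` A \<inter> space \<mu> = uminus ` A" unfolding sp
      by (auto simp: image_iff) (metis add.inverse_inverse)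
    then show "emeasure (distr \<mu> \<mu> uminus) A = emeasure \<mu> A"
      using emeasure_distr[OF um A] sym[OF A] by simp
  qed simp
  have int2: "integrable \<mu> (\<lambda>z. radial (- z))"
    using integrable_distr[OF um, of radial] int unfolding distr by simp
  have eq2: "(\<integral>z. radial (- z) \<partial>\<mu>) = (\<integral>z. radial z \<partial>\<mu>)"
    using integral_distr[OF um meas] unfolding distr by simp
  have cong: "radial z + radial (- z) = (LINT r:{0<..}|lborel. second_diff f x (r *\<^sub>R z) * r powr (-1 - \<alpha>))"
    if "z \<in> space \<mu>" for z using radial_integral_symmetrized(2)[of z] that sp by simp
  have "integrable \<mu> (\<lambda>z. radial z + radial (- z))" using int int2 by (rule Bochner_Integration.integrable_add)
  then show "integrable \<mu> (\<lambda>z. LINT r:{0<..}|lborel. second_diff f x (r *\<^sub>R z) * r powr (-1 - \<alpha>))"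
    by (subst (asm) Bochner_Integration.integrable_cong[OF refl cong])
  have "(\<integral>z. (LINT r:{0<..}|lborel. second_diff f x (r *\<^sub>R z) * r powr (-1 - \<alpha>)) \<partial>\<mu>) = (\<integral>z. radial z + radial (- z) \<partial>\<mu>)"
    by (rule Bochner_Integration.integral_cong[OF refl cong[symmetric]])
  also have "\<dots> = 2 * levy_int \<alpha> \<mu> f x"
    unfolding levy_int_def using int int2 eq2 by simp
  finally show "levy_int \<alpha> \<mu> f x = (\<integral>z. (LINT r:{0<..}|lborel. second_diff f x (r *\<^sub>R z) * r powr (-1 - \<alpha>)) \<partial>\<mu>) / 2"
    by simp
qed

end

text \<open>The three error slots have separate scales because the comparison principle meets three
  errors: that of the localising penalty, that near the contact point, and that of the smooth
  majorant far away. The factor \<open>Lup / 2\<close> joins the mass bound to the one half from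
  symmetrisation.\<close>

lemma levy_int_le:
  fixes f g :: "'v::euclidean_space \<Rightarrow> real"
  assumes alpha: "0 < \<alpha>" "\<alpha> \<le> 1" and f: "cb_class (Suc (Suc n)) f" and g: "cb_class (Suc (Suc n)) g"
    and mu: "\<mu> \<in> levy_family Llo Lup"
    and a: "0 < a1" "0 < a2" "0 < a3" and c: "0 \<le> c1" "0 \<le> c2" "0 \<le> c3"
    and le: "\<And>l. second_diff f x l \<le> second_diff g y l +
        (c1 * quad_cut a1 (norm l) + c2 * quad_cut a2 (norm l) + c3 * quad_cut a3 (norm l))"
  shows "levy_int \<alpha> \<mu> f x \<le> levy_int \<alpha> \<mu> g y +
    Lup / 2 * levy_mass \<alpha> * (c1 * a1 powr (-\<alpha>) + c2 * a2 powr (-\<alpha>) + c3 * a3 powr (-\<alpha>))"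
proof -
  have mu': "\<mu> \<in> sphere_measures" and mass: "measure \<mu> (space \<mu>) \<le> Lup" using mu by (auto simp: levy_family_def)
  have sp: "space \<mu> = sphere 0 1" and fin: "finite_measure \<mu>" using mu' by (auto simp: sphere_measures_def)
  interpret finite_measure \<mu> by (rule fin)
  define K where "K = levy_mass \<alpha> * (c1 * a1 powr (-\<alpha>) + c2 * a2 powr (-\<alpha>) + c3 * a3 powr (-\<alpha>))"
  have K: "0 \<le> K" unfolding K_def using c levy_mass_nonneg by auto
  note If = levy_int_symmetrized[OF alpha f mu', of x] and Ig = levy_int_symmetrized[OF alpha g mu', of y]
  let ?F = "\<lambda>z. LINT r:{0<..}|lborel. second_diff f x (r *\<^sub>R z) * r powr (-1 - \<alpha>)"
  let ?G = "\<lambda>z. LINT r:{0<..}|lborel. second_diff g y (r *\<^sub>R z) * r powr (-1 - \<alpha>)"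
  have FG: "?F z \<le> ?G z + K" if "z \<in> space \<mu>" for z
  proof -
    have z: "norm z = 1" using that sp by simp
    let ?Q = "\<lambda>r. c1 * (quad_cut a1 r * r powr (-1 - \<alpha>)) + c2 * (quad_cut a2 r * r powr (-1 - \<alpha>))
       + c3 * (quad_cut a3 r * r powr (-1 - \<alpha>))"
    note iq = set_integrable_quad_cut[OF alpha a(1)] set_integrable_quad_cut[OF alpha a(2)] set_integrable_quad_cut[OF alpha a(3)]
    have iQ: "set_integrable lborel {0<..} ?Q"
      using iq by (intro set_integral_add set_integrable_mult_right) auto
    have Q: "(LINT r:{0<..}|lborel. ?Q r) = K"
      using iq by (simp add: set_integral_add set_integral_quad_cut[OF alpha] a K_def algebra_simps)
    note ig = radial_integral_symmetrized(1)[OF alpha g z, of y]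
    have "?F z \<le> (LINT r:{0<..}|lborel. second_diff g y (r *\<^sub>R z) * r powr (-1 - \<alpha>) + ?Q r)"
    proof (rule set_integral_mono[OF radial_integral_symmetrized(1)[OF alpha f z] set_integral_add(1)[OF ig iQ]])
      fix r :: real assume r: "r \<in> {0<..}"
      then have "second_diff f x (r *\<^sub>R z) * r powr (-1 - \<alpha>) \<le> (second_diff g y (r *\<^sub>R z) +
        (c1 * quad_cut a1 r + c2 * quad_cut a2 r + c3 * quad_cut a3 r)) * r powr (-1 - \<alpha>)"
        using le[of "r *\<^sub>R z"] z by (intro mult_right_mono) auto
      then show "second_diff f x (r *\<^sub>R z) * r powr (-1 - \<alpha>) \<le> second_diff g y (r *\<^sub>R z) * r powr (-1 - \<alpha>) + ?Q r"
        by (simp add: algebra_simps)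
    qed
    also have "\<dots> = ?G z + K" using set_integral_add(2)[OF ig iQ] Q by simp
    finally show ?thesis .
  qed
  have "(\<integral>z. ?F z \<partial>\<mu>) \<le> (\<integral>z. ?G z + K \<partial>\<mu>)"
    using If(1) Ig(1) FG by (intro integral_mono) auto
  also have "\<dots> = (\<integral>z. ?G z \<partial>\<mu>) + measure \<mu> (space \<mu>) * K" using Ig(1) by simp
  also have "\<dots> \<le> (\<integral>z. ?G z \<partial>\<mu>) + Lup * K" using mass K by (intro add_left_mono mult_right_mono)
  finally show ?thesis unfolding If(2) Ig(2) by (simp add: K_def)
qed

lemma second_diff_const [simp]: "second_diff (\<lambda>_. c) x l = 0"
  by (simp add: second_diff_def)

lemma levy_int_const [simp]: "levy_int \<alpha> \<mu> (\<lambda>_. c) x = 0"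
  by (simp add: levy_int_def delta_op_def DERIV_imp_deriv[OF DERIV_const] cong: if_cong)

(* If the family is empty, levy_gen is the junk value Sup {} on both sides, which is why e >= 0 is needed. *)
lemma levy_gen_le:
  fixes f g :: "'v::euclidean_space \<Rightarrow> real"
  assumes alpha: "0 < \<alpha>" "\<alpha> \<le> 1" and f: "cb_class (Suc (Suc n)) f" and g: "cb_class (Suc (Suc n)) g"
    and Lup: "0 \<le> Lup"
    and a: "0 < a1" "0 < a2" "0 < a3" and c: "0 \<le> c1" "0 \<le> c2" "0 \<le> c3"
    and le: "\<And>l. second_diff f x l \<le> second_diff g y l +
        (c1 * quad_cut a1 (norm l) + c2 * quad_cut a2 (norm l) + c3 * quad_cut a3 (norm l))"
  shows "levy_gen \<alpha> Llo Lup f x \<le> levy_gen \<alpha> Llo Lup g y +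
    Lup / 2 * levy_mass \<alpha> * (c1 * a1 powr (-\<alpha>) + c2 * a2 powr (-\<alpha>) + c3 * a3 powr (-\<alpha>))"
    (is "_ \<le> _ + ?e")
proof (cases "levy_family Llo Lup = ({} :: 'v measure set)")
  case True
  have "0 \<le> ?e" using Lup c levy_mass_nonneg by auto
  then show ?thesis using True by (simp add: levy_gen_def)
next
  case False
  obtain C where C: "C \<ge> 0" "\<And>x l. \<bar>second_diff g x l\<bar> \<le> C * quad_cut 1 (norm l)"
    using cb_class_second_diff_bound[OF g] by blast
  \<comment> \<open>Comparison with a constant function, whose Levy integral is 0, bounds the family
    above, so that the supremum is a genuine one.\<close>
  have "bdd_above ((\<lambda>\<mu>. levy_int \<alpha> \<mu> g y) ` levy_family Llo Lup)"
  proof (rule bdd_aboveI2)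
    fix \<mu> :: "'v measure" assume "\<mu> \<in> levy_family Llo Lup"
    from levy_int_le[OF alpha g cb_class_const this, of 1 1 1 C 0 0 y 0 y] C
    show "levy_int \<alpha> \<mu> g y \<le> Lup / 2 * levy_mass \<alpha> * C" by (simp add: abs_le_iff)
  qed
  then have "levy_int \<alpha> \<mu> f x \<le> levy_gen \<alpha> Llo Lup g y + ?e" if "\<mu> \<in> levy_family Llo Lup" for \<mu>
    using levy_int_le[OF alpha f g that a c le] cSUP_upper[OF that, of "\<lambda>\<mu>. levy_int \<alpha> \<mu> g y"]
    unfolding levy_gen_def by fastforce
  then show ?thesis unfolding levy_gen_def using False by (intro cSUP_least) auto
qed

text \<open>(A2) produces the generator at the moving position of the walk; this bound turns the
  passage back to the starting point into a truncated moment.\<close>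

lemma levy_gen_increment:
  fixes f :: "'v::euclidean_space \<Rightarrow> real"
  assumes alpha: "0 < \<alpha>" "\<alpha> \<le> 1" and f: "cb_class 3 f" and Lup: "0 \<le> Lup"
  obtains C where "C \<ge> 0"
    "\<And>x y. \<bar>levy_gen \<alpha> Llo Lup f x - levy_gen \<alpha> Llo Lup f y\<bar> \<le> C * trunc_norm (x - y)"
proof -
  have f3: "cb_class (Suc (Suc (Suc 0))) f" using f by (simp add: numeral_3_eq_3)
  obtain A where A: "A \<ge> 0"
    "\<And>x y l. \<bar>second_diff f x l - second_diff f y l\<bar> \<le> A * trunc_norm (x - y) * quad_cut 1 (norm l)"
    using cb_class_second_diff_increment[OF f3] by blast
  define C where "C = Lup / 2 * levy_mass \<alpha> * A"
  have C: "C \<ge> 0" using Lup A levy_mass_nonneg by (simp add: C_def)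
  have le: "levy_gen \<alpha> Llo Lup f x \<le> levy_gen \<alpha> Llo Lup f y + C * trunc_norm (x - y)" for x y
  proof -
    have "second_diff f x l \<le> second_diff f y l + A * trunc_norm (x - y) * quad_cut 1 (norm l)" for l
      using A(2)[of x l y] by linarith
    then show ?thesis
      using levy_gen_le[OF alpha f3 f3 Lup, of 1 1 1 "A * trunc_norm (x - y)" 0 0 x y] A(1)
      by (simp add: C_def algebra_simps)
  qed
  show ?thesis
    using that[OF C] le by (smt (verit) trunc_norm_minus_commute)
qed

section \<open>Sublinear expectations and partial sums\<close>

lemma bdd_lipI:
  assumes "\<And>x. \<bar>f x\<bar> \<le> B" "\<And>x y. \<bar>f x - f y\<bar> \<le> L * dist x y"
  shows "bdd_lip f"
  using assms by (auto simp: bdd_lip_def)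

lemma bdd_lipE:
  assumes "bdd_lip f"
  obtains B L where "B \<ge> 0" "L \<ge> 0" "\<And>x. \<bar>f x\<bar> \<le> B" "\<And>x y. \<bar>f x - f y\<bar> \<le> L * dist x y"
proof -
  obtain B L where BL: "\<And>x. \<bar>f x\<bar> \<le> B" "\<And>x y. \<bar>f x - f y\<bar> \<le> L * dist x y"
    using assms by (auto simp: bdd_lip_def)
  have "\<bar>f x - f y\<bar> \<le> max L 0 * dist x y" for x y
    using BL(2)[of x y] mult_right_mono[of L "max L 0" "dist x y"] by simp
  moreover have "\<bar>f x\<bar> \<le> max B 0" for x using BL(1)[of x] by simp
  ultimately show ?thesis using that[of "max B 0" "max L 0"] by simp
qed

lemma bdd_lip_trunc_increment:
  assumes "bdd_lip (f :: 'v::real_normed_vector \<Rightarrow> real)"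
  obtains M where "M \<ge> 0" "\<And>x y. \<bar>f x - f y\<bar> \<le> M * trunc_norm (x - y)"
proof -
  obtain B L where BL: "B \<ge> 0" "L \<ge> 0" "\<And>x. \<bar>f x\<bar> \<le> B" "\<And>x y. \<bar>f x - f y\<bar> \<le> L * dist x y"
    using bdd_lipE[OF assms] by blast
  have "\<bar>f x - f y\<bar> \<le> (2 * B + L) * trunc_norm (x - y)" for x y
  proof (rule bound_by_trunc_norm)
    show "\<bar>f x - f y\<bar> \<le> 2 * B" using BL(3)[of x] BL(3)[of y] by linarith
    show "\<bar>f x - f y\<bar> \<le> L * norm (x - y)" using BL(4)[of x y] by (simp add: dist_norm)
  qed (use BL in auto)
  then show ?thesis using that[of "2 * B + L"] BL by auto
qed

lemma bdd_lip_affine: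
  assumes "bdd_lip (f :: 'v::real_normed_vector \<Rightarrow> real)"
  shows "bdd_lip (\<lambda>y. f (x + c *\<^sub>R y))"
proof -
  obtain B L where BL: "B \<ge> 0" "L \<ge> 0" "\<And>x. \<bar>f x\<bar> \<le> B" "\<And>x y. \<bar>f x - f y\<bar> \<le> L * dist x y"
    using bdd_lipE[OF assms] by blast
  show ?thesis
  proof (rule bdd_lipI[OF BL(3)])
    fix y z
    show "\<bar>f (x + c *\<^sub>R y) - f (x + c *\<^sub>R z)\<bar> \<le> (L * \<bar>c\<bar>) * dist y z"
      using BL(4)[of "x + c *\<^sub>R y" "x + c *\<^sub>R z"] by (simp add: dist_norm flip: scaleR_diff_right)
  qed
qed

lemma bdd_lip_shift:
  "bdd_lip (f :: 'v::real_normed_vector \<Rightarrow> real) \<Longrightarrow> bdd_lip (\<lambda>y. f (x + y))"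
  using bdd_lip_affine[of f x 1] by simp

lemma bdd_lip_cmult:
  assumes "bdd_lip f" shows "bdd_lip (\<lambda>y. c * f y)"
proof -
  obtain B L where BL: "B \<ge> 0" "L \<ge> 0" "\<And>x. \<bar>f x\<bar> \<le> B" "\<And>x y. \<bar>f x - f y\<bar> \<le> L * dist x y"
    using bdd_lipE[OF assms] by blast
  have "\<bar>c * f x - c * f y\<bar> \<le> (\<bar>c\<bar> * L) * dist x y" for x y
    using mult_left_mono[OF BL(4)[of x y], of "\<bar>c\<bar>"] by (simp add: abs_mult mult.assoc flip: right_diff_distrib)
  moreover have "\<bar>c * f x\<bar> \<le> \<bar>c\<bar> * B" for x
    using BL(3)[of x] by (simp add: abs_mult mult_left_mono)
  ultimately show ?thesis by (rule bdd_lipI[rotated])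
qed

lemma bdd_lip_trunc_norm: "bdd_lip (trunc_norm :: 'v::real_normed_vector \<Rightarrow> real)"
proof (rule bdd_lipI[where B=1 and L=1])
  fix x y :: 'v
  show "\<bar>trunc_norm x - trunc_norm y\<bar> \<le> 1 * dist x y"
    using norm_triangle_ineq3[of x y] by (auto simp: trunc_norm_def dist_norm min_def abs_if split: if_splits)
qed (simp add: trunc_norm_le_1)

text \<open>For t \<ge> 0 and 0 < \<delta> \<le> 1 one has
  \<open>min 1 t \<le> t powr \<delta>\<close>: this is the way from the moment of order \<delta> to
  bounded Lipschitz functions.\<close>

lemma trunc_norm_scaleR_le:
  assumes "0 \<le> a" "0 < \<delta>" "\<delta> \<le> 1"
  shows "trunc_norm (a *\<^sub>R y) \<le> a powr \<delta> * norm y powr \<delta>"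
proof -
  define t where "t = a * norm y"
  have "min 1 t \<le> t powr \<delta>" if "t \<ge> 0"
  proof (cases "t \<le> 1")
    case True
    show ?thesis
    proof (cases "t = 0")
      case False
      then show ?thesis using True that assms powr_mono_both'[of \<delta> 1 t t] powr_mono'[of \<delta> 1 t] by auto
    qed auto
  next
    case False
    then show ?thesis using assms ge_one_powr_ge_zero[of t \<delta>] by simp
  qed
  then show ?thesis using assms by (simp add: trunc_norm_def t_def powr_mult)
qed

section \<open>Calculus of a sublinear expectation\<close>

context
  fixes H :: "('w \<Rightarrow> real) set" and E :: "('w \<Rightarrow> real) \<Rightarrow> real"
  assumes sle: "sublinear_expectation H E"
begin

lemma sublinear_const [simp]: "E (\<lambda>_. c) = c" "(\<lambda>_. c) \<in> H"
  using sle by (auto simp: sublinear_expectation_def)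

text \<open>Expectations of differences can only be dominated: a pointwise inequality with error
  \<open>k * W w + c\<close> survives by monotonicity, sub-additivity and, for nonnegative k,
  homogeneity. Used in both directions it yields the two-sided estimates.\<close>

lemma sublinear_le_add:
  assumes "X \<in> H" "Y \<in> H" "W \<in> H" "0 \<le> k" and le: "\<And>w. X w \<le> Y w + k * W w + c"
  shows "E X \<le> E Y + k * E W + c"
proof -
  have S: "\<And>X Y. X \<in> H \<Longrightarrow> Y \<in> H \<Longrightarrow> (\<lambda>w. X w + Y w) \<in> H"
    "\<And>X c. X \<in> H \<Longrightarrow> (\<lambda>w. c * X w) \<in> H"
    "\<And>X Y. X \<in> H \<Longrightarrow> Y \<in> H \<Longrightarrow> (\<And>w. X w \<le> Y w) \<Longrightarrow> E X \<le> E Y"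
    "\<And>X Y. X \<in> H \<Longrightarrow> Y \<in> H \<Longrightarrow> E (\<lambda>w. X w + Y w) \<le> E X + E Y"
    "\<And>X c. X \<in> H \<Longrightarrow> 0 \<le> c \<Longrightarrow> E (\<lambda>w. c * X w) = c * E X"
    using sle unfolding sublinear_expectation_def by blast+
  have kW: "(\<lambda>w. k * W w) \<in> H" using S(2) assms by blast
  have YW: "(\<lambda>w. Y w + k * W w) \<in> H" using S(1)[OF assms(2) kW] .
  have YWc: "(\<lambda>w. (Y w + k * W w) + c) \<in> H" using S(1)[OF YW sublinear_const(2)] .
  have "E X \<le> E (\<lambda>w. (Y w + k * W w) + c)" using S(3)[OF assms(1) YWc] le by simp
  also have "\<dots> \<le> E (\<lambda>w. Y w + k * W w) + c" using S(4)[OF YW sublinear_const(2)[of c]] by simp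
  also have "\<dots> \<le> E Y + k * E W + c" using S(4)[OF assms(2) kW] S(5)[OF assms(3,4)] by simp
  finally show ?thesis .
qed

lemma sublinear_le_add_const:
  assumes "X \<in> H" "Y \<in> H" "\<And>w. X w \<le> Y w + c"
  shows "E X \<le> E Y + c"
  using sublinear_le_add[OF assms(1,2) sublinear_const(2)[of 0], of 0 c] assms(3) by simp

lemma sublinear_add_const:
  assumes "X \<in> H"
  shows "E (\<lambda>w. X w + c) = E X + c"
proof -
  have "\<forall>X\<in>H. \<forall>Y\<in>H. (\<lambda>w. X w + Y w) \<in> H"
    using sle unfolding sublinear_expectation_def by blast
  from bspec[OF bspec[OF this assms] sublinear_const(2)[of c]] have "(\<lambda>w. X w + c) \<in> H" .
  then show ?thesis
    using sublinear_le_add_const[of "\<lambda>w. X w + c" X c] sublinear_le_add_const[of X "\<lambda>w. X w + c" "- c"] assms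
    by force
qed

lemma sublinear_diff_le:
  assumes "X \<in> H" "Y \<in> H" "W \<in> H" "0 \<le> k" and le: "\<And>w. \<bar>X w - Y w - a\<bar> \<le> k * W w + c"
  shows "\<bar>E X - E Y - a\<bar> \<le> k * E W + c"
proof -
  have "E X \<le> E Y + k * E W + (a + c)"
    by (rule sublinear_le_add[OF assms(1-4)]) (use le in \<open>smt (verit)\<close>)
  moreover have "E Y \<le> E X + k * E W + (c - a)"
    by (rule sublinear_le_add[OF assms(2,1,3,4)]) (use le in \<open>smt (verit)\<close>)
  ultimately show ?thesis by linarith
qed

lemma sublinear_increment_le:
  assumes "bdd_lip g" "random_var H X"
    and "M \<ge> 0" "\<And>x y. \<bar>g x - g y\<bar> \<le> M * trunc_norm (x - y)"
  shows "\<bar>E (\<lambda>w. g (x + X w)) - g x\<bar> \<le> M * E (\<lambda>w. trunc_norm (X w))"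
proof -
  have "(\<lambda>w. g (x + X w)) \<in> H" "(\<lambda>w. trunc_norm (X w)) \<in> H"
    using assms(2) bdd_lip_shift[OF assms(1)] bdd_lip_trunc_norm by (auto simp: random_var_def)
  moreover have "\<bar>g (x + X w) - g x - 0\<bar> \<le> M * trunc_norm (X w) + 0" for w
    using assms(4)[of "x + X w" x] by simp
  ultimately have "\<bar>E (\<lambda>w. g (x + X w)) - E (\<lambda>_. g x) - 0\<bar> \<le> M * E (\<lambda>w. trunc_norm (X w)) + 0"
    using assms(3) by (intro sublinear_diff_le) auto
  then show ?thesis by simp
qed

lemma bdd_lip_sublinear_shift:
  fixes f :: "'v::real_normed_vector \<Rightarrow> real"
  assumes f: "bdd_lip f" and X: "random_var H X"
  shows "bdd_lip (\<lambda>y. E (\<lambda>w. f (y + c *\<^sub>R X w)))"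
proof -
  obtain B L where BL: "B \<ge> 0" "L \<ge> 0" "\<And>x. \<bar>f x\<bar> \<le> B" "\<And>x y. \<bar>f x - f y\<bar> \<le> L * dist x y"
    using bdd_lipE[OF f] by blast
  have m: "(\<lambda>w. f (y + c *\<^sub>R X w)) \<in> H" for y
    using X bdd_lip_affine[OF f, of y c] by (auto simp: random_var_def)
  show ?thesis
  proof (rule bdd_lipI[where B=B and L=L])
    fix y z
    have "\<bar>f (y + c *\<^sub>R X w) - f (z + c *\<^sub>R X w) - 0\<bar> \<le> 0 * 0 + L * dist y z" for w
      using BL(4)[of "y + c *\<^sub>R X w" "z + c *\<^sub>R X w"] by simp
    from sublinear_diff_le[OF m m sublinear_const(2) _ this]
    show "\<bar>E (\<lambda>w. f (y + c *\<^sub>R X w)) - E (\<lambda>w. f (z + c *\<^sub>R X w))\<bar> \<le> L * dist y z" by simp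
    have "\<bar>f (y + c *\<^sub>R X w) - 0 - 0\<bar> \<le> 0 * 0 + B" for w using BL(3) by simp
    from sublinear_diff_le[OF m sublinear_const(2) sublinear_const(2) _ this]
    show "\<bar>E (\<lambda>w. f (y + c *\<^sub>R X w))\<bar> \<le> B" by simp
  qed
qed

section \<open>Partial sums of an i.i.d. sequence\<close>

context
  fixes Z :: "nat \<Rightarrow> 'w \<Rightarrow> 'v::euclidean_space"
  assumes iid: "iid_seq H E Z"
begin

lemma bdd_lip_n_partial_sum:
  assumes f: "bdd_lip (f :: 'v \<Rightarrow> real)"
  shows "bdd_lip_n n (\<lambda>X y. f (x + c *\<^sub>R (\<Sum>i<n. X i) + c *\<^sub>R y))"
proof -
  obtain B L where BL: "B \<ge> 0" "L \<ge> 0" "\<And>x. \<bar>f x\<bar> \<le> B" "\<And>x y. \<bar>f x - f y\<bar> \<le> L * dist x y"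
    using bdd_lipE[OF f] by blast
  have "\<bar>f (x + c *\<^sub>R (\<Sum>i<n. X i) + c *\<^sub>R y) - f (x + c *\<^sub>R (\<Sum>i<n. X' i) + c *\<^sub>R y')\<bar>
      \<le> (L * \<bar>c\<bar>) * ((\<Sum>i<n. norm (X i - X' i)) + norm (y - y'))" for X X' y y'
  proof -
    have "x + c *\<^sub>R (\<Sum>i<n. X i) + c *\<^sub>R y - (x + c *\<^sub>R (\<Sum>i<n. X' i) + c *\<^sub>R y') =
        c *\<^sub>R ((\<Sum>i<n. X i - X' i) + (y - y'))" by (simp add: sum_subtractf algebra_simps)
    moreover have "norm ((\<Sum>i<n. X i - X' i) + (y - y')) \<le> (\<Sum>i<n. norm (X i - X' i)) + norm (y - y')"
      by (rule norm_triangle_le) (simp add: norm_sum)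
    ultimately have "dist (x + c *\<^sub>R (\<Sum>i<n. X i) + c *\<^sub>R y) (x + c *\<^sub>R (\<Sum>i<n. X' i) + c *\<^sub>R y')
        \<le> \<bar>c\<bar> * ((\<Sum>i<n. norm (X i - X' i)) + norm (y - y'))"
      unfolding dist_norm by (simp add: mult_left_mono)
    then show ?thesis
      using BL(4)[of "x + c *\<^sub>R (\<Sum>i<n. X i) + c *\<^sub>R y" "x + c *\<^sub>R (\<Sum>i<n. X' i) + c *\<^sub>R y'"] BL(2)
      by (smt (verit) mult.assoc mult_left_mono)
  qed
  then show ?thesis using BL(3) unfolding bdd_lip_n_def by blast
qed

text \<open>\<open>random_var\<close> speaks of a single variable; membership for a function of a
  sum is read off the independence of the last summand from the earlier ones.\<close>

lemma partial_sum_mem: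
  assumes f: "bdd_lip f"
  shows "(\<lambda>w. f (x + c *\<^sub>R (\<Sum>i<n. Z i w))) \<in> H"
proof (cases n)
  case (Suc m)
  have "(\<lambda>w. f (x + c *\<^sub>R (\<Sum>i<m. Z i w) + c *\<^sub>R Z m w)) \<in> H"
    using iid bdd_lip_n_partial_sum[OF f, of m x c] by (auto simp: iid_seq_def indep_from_def)
  then show ?thesis by (simp add: Suc scaleR_add_right add.assoc)
qed simp

lemma partial_sum_step:
  assumes f: "bdd_lip f"
  shows "E (\<lambda>w. f (x + c *\<^sub>R (\<Sum>i<Suc n. Z i w))) =
    E (\<lambda>w. E (\<lambda>w'. f (x + c *\<^sub>R (\<Sum>i<n. Z i w) + c *\<^sub>R Z 0 w')))"
proof -
  have "E (\<lambda>w. f (x + c *\<^sub>R (\<Sum>i<n. Z i w) + c *\<^sub>R Z n w)) =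
    E (\<lambda>w. E (\<lambda>w'. f (x + c *\<^sub>R (\<Sum>i<n. Z i w) + c *\<^sub>R Z n w')))"
    using iid bdd_lip_n_partial_sum[OF f, of n x c] by (auto simp: iid_seq_def indep_from_def)
  moreover have "E (\<lambda>w'. f (a + c *\<^sub>R Z n w')) = E (\<lambda>w'. f (a + c *\<^sub>R Z 0 w'))" for a
    using iid bdd_lip_affine[OF f, of a c] by (auto simp: iid_seq_def ident_distr_def)
  ultimately show ?thesis by (simp add: scaleR_add_right flip: add.assoc)
qed

context
  fixes \<alpha> \<delta> C :: real
  assumes exps: "0 < \<delta>" "\<delta> < \<alpha>" "\<alpha> \<le> 1"
    and moment: "\<And>n. n \<ge> 1 \<Longrightarrow>
      upper_exp_le E (\<lambda>w. real n powr (-1/\<alpha>) *\<^sub>R (\<Sum>i<n. Z i w)) (\<lambda>y. norm y powr \<delta>) C"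
begin

text \<open>With a = (n \<tau>)^(1/\<alpha>), the function a^(-\<delta>) min(1, |a y|) is bounded
  Lipschitz and lies below |y|^\<delta>, hence is admissible in (A1). For n = 0 both sides
  vanish.\<close>

lemma trunc_moment:
  assumes "0 < \<tau>"
  shows "E (\<lambda>w. trunc_norm (\<tau> powr (1/\<alpha>) *\<^sub>R (\<Sum>i<n. Z i w))) \<le> C * (real n * \<tau>) powr (\<delta>/\<alpha>)"
proof (cases "n = 0")
  case True
  then show ?thesis by (simp add: trunc_norm_def)
next
  case False
  define a where "a = (real n * \<tau>) powr (1/\<alpha>)"
  have a: "a > 0" using False assms by (simp add: a_def)
  define g where "g y = a powr (-\<delta>) * trunc_norm (a *\<^sub>R y)" for y :: 'v
  have "bdd_lip g" unfolding g_def
    using bdd_lip_cmult[OF bdd_lip_affine[OF bdd_lip_trunc_norm, of 0 a]] by simp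
  moreover have "g y \<le> norm y powr \<delta>" for y
  proof -
    have "g y \<le> a powr (-\<delta>) * (a powr \<delta> * norm y powr \<delta>)" unfolding g_def
      using trunc_norm_scaleR_le[of a \<delta> y] a exps by (intro mult_left_mono) auto
    also have "\<dots> = norm y powr \<delta>" using a by (simp add: powr_minus)
    finally show ?thesis .
  qed
  ultimately have le: "E (\<lambda>w. g (real n powr (-1/\<alpha>) *\<^sub>R (\<Sum>i<n. Z i w))) \<le> C"
    using moment[of n] False by (auto simp: upper_exp_le_def)
  have eq: "a * real n powr (-1/\<alpha>) = \<tau> powr (1/\<alpha>)"
    using False assms by (simp add: a_def powr_mult powr_minus divide_simps)
  let ?X = "\<lambda>w. trunc_norm (\<tau> powr (1/\<alpha>) *\<^sub>R (\<Sum>i<n. Z i w))"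
  have X: "?X \<in> H" using partial_sum_mem[OF bdd_lip_trunc_norm, of 0] by simp
  have "E (\<lambda>w. a powr (-\<delta>) * ?X w) = a powr (-\<delta>) * E ?X"
    using sle X unfolding sublinear_expectation_def by auto
  with le have "a powr (-\<delta>) * E ?X \<le> C" by (simp only: g_def scaleR_scaleR eq)
  then have "E ?X \<le> C * a powr \<delta>" using a by (simp add: powr_minus field_simps)
  also have "a powr \<delta> = (real n * \<tau>) powr (\<delta>/\<alpha>)" by (simp add: a_def powr_powr)
  finally show ?thesis .
qed

lemma scheme_consistency:
  fixes G :: "'v \<Rightarrow> real"
  assumes f: "bdd_lip f" and "0 < \<tau>" "0 \<le> \<Lambda>" "0 \<le> C"
    and G: "\<And>x y. \<bar>G x - G y\<bar> \<le> \<Lambda> * trunc_norm (x - y)"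
    and step: "\<And>y. \<bar>E (\<lambda>w. f (y + \<tau> powr (1/\<alpha>) *\<^sub>R Z 0 w)) - f y - \<tau> * G y\<bar> \<le> \<tau> * e"
  shows "\<bar>E (\<lambda>w. f (x + \<tau> powr (1/\<alpha>) *\<^sub>R (\<Sum>i<n. Z i w))) - f x - (real n * \<tau>) * G x\<bar>
    \<le> real n * \<tau> * (\<Lambda> * C * (real n * \<tau>) powr (\<delta>/\<alpha>) + e)"
proof -
  define c where "c = \<tau> powr (1/\<alpha>)"
  define A where "A m = E (\<lambda>w. f (x + c *\<^sub>R (\<Sum>i<m. Z i w)))" for m
  have Z0: "random_var H (Z 0)" using iid by (auto simp: iid_seq_def)
  \<comment> \<open>Conditioning on the first m summands leaves the one-step estimate at a random
    point, and moving G back to x costs a truncated moment. That moment is bounded at the final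
    index n rather than at m, so all increments obey the same bound and summation is
    immediate.\<close>
  have inc: "\<bar>A (Suc m) - A m - \<tau> * G x\<bar> \<le> \<tau> * (\<Lambda> * C * (real n * \<tau>) powr (\<delta>/\<alpha>) + e)" if "m \<le> n" for m
  proof -
    define g where "g y = E (\<lambda>w. f (y + c *\<^sub>R Z 0 w))" for y
    have g: "bdd_lip g" unfolding g_def by (rule bdd_lip_sublinear_shift[OF f Z0])
    have le: "\<bar>g (x + c *\<^sub>R s) - f (x + c *\<^sub>R s) - \<tau> * G x\<bar> \<le> (\<tau> * \<Lambda>) * trunc_norm (c *\<^sub>R s) + \<tau> * e" for s
    proof -
      have "\<tau> * \<bar>G (x + c *\<^sub>R s) - G x\<bar> \<le> \<tau> * (\<Lambda> * trunc_norm (c *\<^sub>R s))"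
        using G[of "x + c *\<^sub>R s" x] assms(2) by (intro mult_left_mono) auto
      then have "\<bar>\<tau> * G (x + c *\<^sub>R s) - \<tau> * G x\<bar> \<le> (\<tau> * \<Lambda>) * trunc_norm (c *\<^sub>R s)"
        using assms(2) by (simp add: abs_mult mult.assoc flip: right_diff_distrib)
      then show ?thesis using step[of "x + c *\<^sub>R s"] unfolding g_def c_def[symmetric] by linarith
    qed
    have "A (Suc m) = E (\<lambda>w. g (x + c *\<^sub>R (\<Sum>i<m. Z i w)))"
      unfolding A_def g_def by (rule partial_sum_step[OF f])
    moreover have "\<bar>E (\<lambda>w. g (x + c *\<^sub>R (\<Sum>i<m. Z i w))) - A m - \<tau> * G x\<bar>
      \<le> (\<tau> * \<Lambda>) * E (\<lambda>w. trunc_norm (c *\<^sub>R (\<Sum>i<m. Z i w))) + \<tau> * e"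
      unfolding A_def
    proof (rule sublinear_diff_le[OF partial_sum_mem[OF g] partial_sum_mem[OF f] _ _ le])
      show "(\<lambda>w. trunc_norm (c *\<^sub>R (\<Sum>i<m. Z i w))) \<in> H"
        using partial_sum_mem[OF bdd_lip_trunc_norm, of 0] by simp
    qed (use assms in simp)
    moreover have "(\<tau> * \<Lambda>) * E (\<lambda>w. trunc_norm (c *\<^sub>R (\<Sum>i<m. Z i w))) \<le> (\<tau> * \<Lambda>) * (C * (real n * \<tau>) powr (\<delta>/\<alpha>))"
    proof (rule mult_left_mono)
      have "E (\<lambda>w. trunc_norm (c *\<^sub>R (\<Sum>i<m. Z i w))) \<le> C * (real m * \<tau>) powr (\<delta>/\<alpha>)"
        unfolding c_def by (rule trunc_moment[OF assms(2)])
      also have "\<dots> \<le> C * (real n * \<tau>) powr (\<delta>/\<alpha>)"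
        using that assms exps by (intro mult_left_mono powr_mono2) auto
      finally show "E (\<lambda>w. trunc_norm (c *\<^sub>R (\<Sum>i<m. Z i w))) \<le> C * (real n * \<tau>) powr (\<delta>/\<alpha>)" .
    qed (use assms in simp)
    ultimately show ?thesis by (simp add: algebra_simps)
  qed
  have "\<bar>A m - f x - (real m * \<tau>) * G x\<bar> \<le> real m * (\<tau> * (\<Lambda> * C * (real n * \<tau>) powr (\<delta>/\<alpha>) + e))" if "m \<le> n" for m
    using that
  proof (induction m)
    case 0
    then show ?case by (simp add: A_def)
  next
    case (Suc m)
    then show ?case using inc[of m] by (simp add: algebra_simps)
  qed
  from this[of n] show ?thesis by (simp add: A_def c_def mult.assoc)
qed

end

end

end

section \<open>The value function is a viscosity solution\<close>

text \<open>Two successive limits: for fixed k the error \<open>r k\<close> vanishes along m, and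
  only then does k carry the bound to its limit.\<close>

lemma marginal_limit_le:
  fixes sk :: "nat \<Rightarrow> real" and A :: "nat \<Rightarrow> nat \<Rightarrow> real" and r :: "nat \<Rightarrow> nat \<Rightarrow> real"
  assumes "\<And>k. A k \<longlonglongrightarrow> a k" "a \<longlonglongrightarrow> L"
    and "\<And>k. \<forall>\<^sub>F m in sequentially. A k m \<le> b k + r k m" "\<And>k. r k \<longlonglongrightarrow> 0" "b \<longlonglongrightarrow> b'"
  shows "L \<le> b'"
proof -
  have "a k \<le> b k" for k
  proof (rule tendsto_le[OF sequentially_bot _ assms(1) assms(3)])
    show "(\<lambda>m. b k + r k m) \<longlonglongrightarrow> b k"
      using tendsto_add[OF tendsto_const assms(4)[of k], of "b k"] by simp
  qed
  then show ?thesis by (intro LIMSEQ_le[OF assms(2,5)]) blast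
qed

text \<open>\<open>vector_derivative\<close> within a set is determined only at its limit points.
  Every t in (0,1] is one, including t = 1, where the derivative is one-sided.\<close>

lemma time_deriv_eq:
  assumes "((\<lambda>s. \<psi> s x) has_real_derivative d) (at t within {0<..1})" "t \<in> {0<..1}"
  shows "time_deriv \<psi> t x = d"
proof -
  have "t islimpt {0<..1}"
    using assms(2) by (intro islimpt_subset[OF islimpt_greaterThanLessThan2[of 0 t]]) auto
  then have "at t within {0<..1} \<noteq> bot" by (simp add: trivial_limit_within)
  then show ?thesis unfolding time_deriv_def using assms(1)
    by (intro vector_derivative_within) (auto simp: has_real_derivative_iff_has_vector_derivative)
qed

text \<open>The expansion runs backwards because dynamic programming relates time t to time t - h.
  The bounded second time derivative makes the error O(h^2) uniformly in y, while the first-order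
  coefficient still depends on y.\<close>

lemma time_expansion:
  fixes \<psi> :: "real \<Rightarrow> 'v::euclidean_space \<Rightarrow> real"
  assumes \<psi>: "Cb_23 \<psi>" and t: "t \<in> {0<..1}"
  obtains D B M where "\<forall>x. time_deriv \<psi> t x = D x" "continuous_on UNIV D" "\<forall>y. \<bar>D y\<bar> \<le> M" "B \<ge> 0"
    "\<forall>h y. 0 < h \<longrightarrow> h < t \<longrightarrow> \<bar>\<psi> (t - h) y - \<psi> t y + h * D y\<bar> \<le> B * h\<^sup>2"
proof -
  obtain T :: "nat \<Rightarrow> real \<Rightarrow> 'v \<Rightarrow> real" where T0: "T 0 = \<psi> \<and>
       (\<forall>i t x. i < 2 \<and> t \<in> {0<..1} \<longrightarrow>
          ((\<lambda>s. T i s x) has_real_derivative T (Suc i) t x) (at t within {0<..1})) \<and>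
       (\<forall>i\<le>2. continuous_on ({0<..1} \<times> UNIV) (\<lambda>(t,x). T i t x) \<and>
          (\<exists>B. \<forall>t\<in>{0<..1}. \<forall>x. \<bar>T i t x\<bar> \<le> B))"
    using conjunct1[OF \<psi>[unfolded Cb_23_def]] ..
  have T: "T 0 = \<psi>" "\<And>i t x. i < 2 \<Longrightarrow> t \<in> {0<..1} \<Longrightarrow>
          ((\<lambda>s. T i s x) has_real_derivative T (Suc i) t x) (at t within {0<..1})"
    "\<And>i. i \<le> 2 \<Longrightarrow> continuous_on ({0<..1} \<times> UNIV) (\<lambda>(t,x). T i t x)"
    "\<And>i. i \<le> 2 \<Longrightarrow> \<exists>B. \<forall>t\<in>{0<..1}. \<forall>x. \<bar>T i t x\<bar> \<le> B" using T0 by blast+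
  obtain M where M: "\<And>t x. t \<in> {0<..1} \<Longrightarrow> \<bar>T 1 t x\<bar> \<le> M"
    using T(4)[OF one_le_numeral] by blast
  obtain B where B: "\<And>t x. t \<in> {0<..1} \<Longrightarrow> \<bar>T 2 t x\<bar> \<le> B"
    using T(4)[OF order_refl] by blast
  have B0: "0 \<le> B" using B[OF t, of 0] by linarith
  show ?thesis
  proof (rule that[of "T 1 t" M B]; (intro allI impI)?)
    show "time_deriv \<psi> t x = T 1 t x" for x
      using T(2)[of 0 t x] t T(1) by (intro time_deriv_eq) auto
    have "continuous_on UNIV (\<lambda>x. (\<lambda>(t,x). T 1 t x) (t, x))"
      by (rule continuous_on_compose2[OF T(3)]) (use t in \<open>auto intro!: continuous_intros\<close>)
    then show "continuous_on UNIV (T 1 t)" by simp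
    show "\<bar>T 1 t y\<bar> \<le> M" for y using M[OF t] .
    show "0 \<le> B" by (rule B0)
    fix h y assume h: "0 < h" "h < t"
    have sub: "{t - h..t} \<subseteq> {0<..1}" using h t by auto
    have T1: "\<bar>T 1 s y - T 1 t y\<bar> \<le> B * h" if "s \<in> {t - h..t}" for s
    proof -
      have "norm (T 1 s y - T 1 t y) \<le> B * norm (s - t)"
      proof (rule field_differentiable_bound[where S="{t - h..t}" and f'="\<lambda>s. T 2 s y"])
        fix z assume z: "z \<in> {t - h..t}"
        have "((\<lambda>s. T 1 s y) has_real_derivative T (Suc 1) z y) (at z within {0<..1})"
          using z sub by (intro T(2)) auto
        then show "((\<lambda>s. T 1 s y) has_field_derivative T 2 z y) (at z within {t - h..t})"
          using DERIV_subset[OF _ sub] by (simp add: numeral_2_eq_2)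
        show "norm (T 2 z y) \<le> B" using B[of z y] z sub by auto
      qed (use that h in auto)
      also have "\<dots> \<le> B * h" using that h B0 by (intro mult_left_mono) auto
      finally show ?thesis by simp
    qed
    let ?g = "\<lambda>s. \<psi> s y - s * T 1 t y"
    have "norm (?g (t - h) - ?g t) \<le> (B * h) * norm ((t - h) - t)"
    proof (rule field_differentiable_bound[where S="{t - h..t}" and f'="\<lambda>s. T 1 s y - T 1 t y"])
      fix z assume z: "z \<in> {t - h..t}"
      have "((\<lambda>s. T 0 s y) has_real_derivative T (Suc 0) z y) (at z within {0<..1})"
        using z sub by (intro T(2)) auto
      then have "((\<lambda>s. \<psi> s y) has_field_derivative T 1 z y) (at z within {t - h..t})"
        using DERIV_subset[OF _ sub] by (simp add: T(1))
      then show "(?g has_field_derivative T 1 z y - T 1 t y) (at z within {t - h..t})"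
        by (auto intro!: derivative_eq_intros)
      show "norm (T 1 z y - T 1 t y) \<le> B * h" using T1[OF z] by simp
    qed (use h in auto)
    then show "\<bar>\<psi> (t - h) y - \<psi> t y + h * T 1 t y\<bar> \<le> B * h\<^sup>2"
      using h by (simp add: power2_eq_square algebra_simps)
  qed
qed

text \<open>\<open>Cb_23\<close> provides no mixed derivatives, so the time derivative is merely
  continuous and bounded in x. Near x it varies by less than e; elsewhere the bound 2 M is absorbed
  into a multiple of \<open>trunc_norm\<close>, whose expectation becomes small with the time
  step.\<close>

lemma continuous_increment_trunc_norm:
  fixes D :: "'v::euclidean_space \<Rightarrow> real"
  assumes "continuous_on UNIV D" "\<And>y. \<bar>D y\<bar> \<le> M" "0 < e"
  obtains K where "K \<ge> 0" "\<And>y. \<bar>D (x + y) - D x\<bar> \<le> e + K * trunc_norm y"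
proof -
  obtain d where d: "d > 0" "\<And>y. norm (y - x) < d \<Longrightarrow> \<bar>D y - D x\<bar> < e"
    using assms(1,3) unfolding continuous_on_iff dist_norm real_norm_def by (metis UNIV_I)
  define d' where "d' = min d 1"
  have d': "d' > 0" "d' \<le> 1" "d' \<le> d" using d by (auto simp: d'_def)
  have M: "0 \<le> M" using assms(2)[of 0] by linarith
  have "\<bar>D (x + y) - D x\<bar> \<le> e + (2 * M / d') * trunc_norm y" for y
  proof (cases "norm y < d'")
    case True
    then show ?thesis using d(2)[of "x + y"] d' M by (smt (verit) add_diff_cancel_left' divide_nonneg_pos mult_nonneg_nonneg trunc_norm_nonneg)
  next
    case False
    then have "d' \<le> trunc_norm y" using d' by (simp add: trunc_norm_def)
    then have "2 * M \<le> (2 * M / d') * trunc_norm y"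
      using d' M mult_left_mono[of d' "trunc_norm y" "2 * M / d'"] by simp
    then show ?thesis using assms(2)[of "x + y"] assms(2)[of x] assms(3) by linarith
  qed
  then show ?thesis using that[of "2 * M / d'"] M d' by auto
qed

section \<open>Dynamic programming for the value function\<close>

context
  fixes H :: "('w \<Rightarrow> real) set" and E :: "('w \<Rightarrow> real) \<Rightarrow> real"
    and \<zeta> :: "real \<Rightarrow> 'w \<Rightarrow> 'v::euclidean_space" and \<phi> :: "'v \<Rightarrow> real" and u :: "real \<Rightarrow> 'v \<Rightarrow> real"
  assumes levy: "nonlinear_levy H E \<zeta>" and phi: "bdd_lip \<phi>"
  defines "u \<equiv> (\<lambda>t x. E (\<lambda>w. \<phi> (x + \<zeta> t w)))"
begin

lemma levy_sublinear: "sublinear_expectation H E"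
  and levy_random_var: "t \<in> {0..1} \<Longrightarrow> random_var H (\<zeta> t)"
  using levy by (auto simp: nonlinear_levy_def)

lemma levy_shift_mem: "bdd_lip f \<Longrightarrow> t \<in> {0..1} \<Longrightarrow> (\<lambda>w. f (x + \<zeta> t w)) \<in> H"
  using levy_random_var[of t] bdd_lip_shift[of f x] by (auto simp: random_var_def)

lemma levy_trunc_mem: "t \<in> {0..1} \<Longrightarrow> (\<lambda>w. trunc_norm (\<zeta> t w)) \<in> H"
  using levy_shift_mem[OF bdd_lip_trunc_norm, of t 0] by simp

lemma value_0: "u 0 x = \<phi> x"
  using levy sublinear_const(1)[OF levy_sublinear] by (simp add: u_def nonlinear_levy_def)

lemma bdd_lip_value: "t \<in> {0..1} \<Longrightarrow> bdd_lip (u t)"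
  unfolding u_def using bdd_lip_sublinear_shift[OF levy_sublinear phi levy_random_var, of t 1] by simp

lemma value_bounds:
  obtains B M where "B \<ge> 0" "M \<ge> 0" "\<And>t x. t \<in> {0..1} \<Longrightarrow> \<bar>u t x\<bar> \<le> B"
    "\<And>t x y. t \<in> {0..1} \<Longrightarrow> \<bar>u t x - u t y\<bar> \<le> M * trunc_norm (x - y)"
proof -
  obtain B L where BL: "B \<ge> 0" "L \<ge> 0" "\<And>x. \<bar>\<phi> x\<bar> \<le> B" "\<And>x y. \<bar>\<phi> x - \<phi> y\<bar> \<le> L * dist x y"
    using bdd_lipE[OF phi] by blast
  obtain M where M: "M \<ge> 0" "\<And>x y. \<bar>\<phi> x - \<phi> y\<bar> \<le> M * trunc_norm (x - y)"
    using bdd_lip_trunc_increment[OF phi] by blast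
  note c = sublinear_const(2)[OF levy_sublinear]
  have 1: "\<bar>u t x\<bar> \<le> B" if "t \<in> {0..1}" for t x
  proof -
    have "\<bar>\<phi> (x + \<zeta> t w) - 0 - 0\<bar> \<le> 0 * 0 + B" for w using BL(3) by simp
    from sublinear_diff_le[OF levy_sublinear levy_shift_mem[OF phi that] c c _ this]
    show ?thesis using sublinear_const(1)[OF levy_sublinear, of 0] by (simp add: u_def)
  qed
  have 2: "\<bar>u t x - u t y\<bar> \<le> M * trunc_norm (x - y)" if "t \<in> {0..1}" for t x y
  proof -
    have "\<bar>\<phi> (x + \<zeta> t w) - \<phi> (y + \<zeta> t w) - 0\<bar> \<le> 0 * 0 + M * trunc_norm (x - y)" for w
      using M(2)[of "x + \<zeta> t w" "y + \<zeta> t w"] by simp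
    from sublinear_diff_le[OF levy_sublinear levy_shift_mem[OF phi that] levy_shift_mem[OF phi that] c _ this]
    show ?thesis using sublinear_const(1)[OF levy_sublinear, of 0] by (simp add: u_def)
  qed
  show ?thesis using that[OF BL(1) M(1) 1 2] .
qed

lemma dynamic_programming:
  assumes "0 \<le> s" "0 \<le> t" "t + s \<le> 1"
  shows "u (t + s) x = E (\<lambda>w. u s (x + \<zeta> t w))"
proof -
  obtain B L where BL: "B \<ge> 0" "L \<ge> 0" "\<And>x. \<bar>\<phi> x\<bar> \<le> B" "\<And>x y. \<bar>\<phi> x - \<phi> y\<bar> \<le> L * dist x y"
    using bdd_lipE[OF phi] by blast
  let ?f = "\<lambda>(X :: nat \<Rightarrow> 'v) y. \<phi> (x + X 0 + y)"
  have "bdd_lip_n 1 ?f" unfolding bdd_lip_n_def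
  proof (intro conjI exI allI)
    fix X X' :: "nat \<Rightarrow> 'v" and y y' :: 'v
    show "\<bar>?f X y\<bar> \<le> B" by (rule BL)
    have "norm (x + X 0 + y - (x + X' 0 + y')) \<le> norm (X 0 - X' 0) + norm (y - y')"
      using norm_triangle_ineq[of "X 0 - X' 0" "y - y'"] by (simp add: algebra_simps)
    then have "L * dist (x + X 0 + y) (x + X' 0 + y') \<le> L * (norm (X 0 - X' 0) + norm (y - y'))"
      using BL(2) by (simp add: dist_norm mult_left_mono)
    then show "\<bar>?f X y - ?f X' y'\<bar> \<le> L * ((\<Sum>i<1. norm (X i - X' i)) + norm (y - y'))"
      using BL(4)[of "x + X 0 + y" "x + X' 0 + y'"] by simp
  qed
  \<comment> \<open>The history is reduced to the single time t, so only the coordinate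
    \<open>X 0\<close> occurs.\<close>
  moreover have "indep_from H E 1 (\<lambda>i. \<zeta> ((\<lambda>_. t) i)) (\<lambda>w. \<zeta> (t + s) w - \<zeta> t w)"
    and id: "ident_distr E (\<lambda>w. \<zeta> (t + s) w - \<zeta> t w) E (\<zeta> s)"
    using levy assms unfolding nonlinear_levy_def by auto
  ultimately have "E (\<lambda>w. \<phi> (x + \<zeta> t w + (\<zeta> (t + s) w - \<zeta> t w))) =
      E (\<lambda>w. E (\<lambda>w'. \<phi> (x + \<zeta> t w + (\<zeta> (t + s) w' - \<zeta> t w'))))"
    unfolding indep_from_def by blast
  moreover have "E (\<lambda>w'. \<phi> (a + (\<zeta> (t + s) w' - \<zeta> t w'))) = u s a" for a
    unfolding u_def using id[unfolded ident_distr_def, rule_format, OF bdd_lip_shift[OF phi, of a]] .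
  ultimately show ?thesis by (simp add: u_def)
qed

section \<open>The viscosity inequalities from a small-time expansion\<close>

context
  fixes C \<kappa> \<alpha> Llo Lup :: real
  assumes kappa: "0 < \<kappa>" and C: "0 \<le> C"
    and moment: "\<And>s. s \<in> {0..1} \<Longrightarrow> E (\<lambda>w. trunc_norm (\<zeta> s w)) \<le> C * s powr \<kappa>"
    and generator: "\<And>f. cb_class 3 f \<Longrightarrow> \<exists>K\<ge>0. \<forall>s\<in>{0..1}. \<forall>x.
      \<bar>E (\<lambda>w. f (x + \<zeta> s w)) - f x - s * levy_gen \<alpha> Llo Lup f x\<bar> \<le> s * (K * s powr \<kappa>)"
begin

text \<open>In x the Lipschitz bound of \<phi> passes to u. In time, dynamic programming and the
  truncated moment give the modulus \<open>h powr \<kappa>\<close>, uniformly in x, so the two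
  combine to joint continuity.\<close>

lemma continuous_on_value: "continuous_on ({0..1} \<times> UNIV) (\<lambda>(t,x). u t x)"
proof -
  obtain B M where BM: "B \<ge> 0" "M \<ge> 0" "\<And>t x. t \<in> {0..1} \<Longrightarrow> \<bar>u t x\<bar> \<le> B"
    "\<And>t x y. t \<in> {0..1} \<Longrightarrow> \<bar>u t x - u t y\<bar> \<le> M * trunc_norm (x - y)" using value_bounds by blast
  have inc: "\<bar>u (s + h) x - u s x\<bar> \<le> M * (C * h powr \<kappa>)" if "0 \<le> s" "0 \<le> h" "h + s \<le> 1" for s h x
  proof -
    have "\<bar>E (\<lambda>w. u s (x + \<zeta> h w)) - u s x\<bar> \<le> M * E (\<lambda>w. trunc_norm (\<zeta> h w))"
      using that BM by (intro sublinear_increment_le[OF levy_sublinear bdd_lip_value levy_random_var]) auto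
    also have "\<dots> \<le> M * (C * h powr \<kappa>)" using moment[of h] that BM by (intro mult_left_mono) auto
    finally show ?thesis using dynamic_programming[of s h x] that by (simp add: add.commute)
  qed
  have tinc: "\<bar>u t x - u s x\<bar> \<le> M * (C * \<bar>t - s\<bar> powr \<kappa>)" if "t \<in> {0..1}" "s \<in> {0..1}" for s t x
  proof (cases "s \<le> t")
    case True
    then show ?thesis using inc[of s "t - s" x] that by simp
  next
    case False
    then show ?thesis using inc[of t "s - t" x] that by (simp add: abs_minus_commute)
  qed
  show ?thesis unfolding continuous_on_def
  proof (rule ballI)
    fix p assume p: "p \<in> {0..1::real} \<times> (UNIV :: 'v set)"
    let ?F = "at p within {0..1} \<times> UNIV"
    have lf: "((\<lambda>q. fst q) \<longlongrightarrow> fst p) ?F" "((\<lambda>q. snd q) \<longlongrightarrow> snd p) ?F"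
      by (auto intro!: tendsto_eq_intros)
    have "((\<lambda>q. (case q of (t,x) \<Rightarrow> u t x) - (case p of (t,x) \<Rightarrow> u t x)) \<longlongrightarrow> 0) ?F"
    proof (rule Lim_null_comparison)
      show "\<forall>\<^sub>F q in ?F. norm ((case q of (t,x) \<Rightarrow> u t x) - (case p of (t,x) \<Rightarrow> u t x))
          \<le> M * norm (snd q - snd p) + M * (C * \<bar>fst q - fst p\<bar> powr \<kappa>)"
        unfolding eventually_at_filter
      proof (intro always_eventually allI impI)
        fix q assume "q \<in> {0..1::real} \<times> (UNIV :: 'v set)"
        then have q: "fst q \<in> {0..1}" "fst p \<in> {0..1}" using p by (simp_all only: mem_Times_iff)
        have "\<bar>u (fst q) (snd q) - u (fst q) (snd p)\<bar> \<le> M * norm (snd q - snd p)"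
          using BM(4)[OF q(1), of "snd q" "snd p"] mult_left_mono[OF trunc_norm_le[of "snd q - snd p"] BM(2)]
          by linarith
        moreover have "\<bar>u (fst q) (snd p) - u (fst p) (snd p)\<bar> \<le> M * (C * \<bar>fst q - fst p\<bar> powr \<kappa>)"
          by (rule tinc[OF q])
        ultimately show "norm ((case q of (t,x) \<Rightarrow> u t x) - (case p of (t,x) \<Rightarrow> u t x))
          \<le> M * norm (snd q - snd p) + M * (C * \<bar>fst q - fst p\<bar> powr \<kappa>)"
          unfolding case_prod_beta real_norm_def by linarith
      qed
      have 1: "((\<lambda>q. \<bar>fst q - fst p\<bar> powr \<kappa>) \<longlongrightarrow> 0) ?F"
      proof (rule tendsto_zero_powrI)
        show "((\<lambda>q. \<bar>fst q - fst p\<bar>) \<longlongrightarrow> 0) ?F"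
          using tendsto_rabs[OF tendsto_diff[OF lf(1) tendsto_const[of "fst p"]]] by simp
      qed (use kappa in auto)
      have 2: "((\<lambda>q. norm (snd q - snd p)) \<longlongrightarrow> 0) ?F"
        using tendsto_norm[OF tendsto_diff[OF lf(2) tendsto_const[of "snd p"]]] by simp
      show "((\<lambda>q. M * norm (snd q - snd p) + M * (C * \<bar>fst q - fst p\<bar> powr \<kappa>)) \<longlongrightarrow> 0) ?F"
        using tendsto_add[OF tendsto_mult_left[OF 2, of M] tendsto_mult_left[OF tendsto_mult_left[OF 1, of C], of M]]
        by simp
    qed
    then show "((\<lambda>(t,x). u t x) \<longlongrightarrow> (case p of (t,x) \<Rightarrow> u t x)) ?F"
      by (rule Lim_null[THEN iffD2])
  qed
qed

text \<open>Touching compares u and \<psi> only pointwise, hence the formulation with an arbitrary V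
  in \<open>H\<close> below or above \<psi>; one h serves both halves. The condition h < t keeps t -
  h in (0,1], where touching is assumed.\<close>

lemma test_function_expansion:
  fixes \<psi> :: "real \<Rightarrow> 'v \<Rightarrow> real" and t e :: real and x :: 'v
  assumes \<psi>: "Cb_23 \<psi>" and t: "t \<in> {0<..1}" and e: "0 < e"
  obtains h where "0 < h" "h < t"
    "\<forall>V\<in>H. (\<forall>w. V w \<le> \<psi> (t - h) (x + \<zeta> h w)) \<longrightarrow>
       E V \<le> \<psi> t x + h * (levy_gen \<alpha> Llo Lup (\<psi> t) x - time_deriv \<psi> t x + e)"
    "\<forall>V\<in>H. (\<forall>w. \<psi> (t - h) (x + \<zeta> h w) \<le> V w) \<longrightarrow>
       E V \<ge> \<psi> t x + h * (levy_gen \<alpha> Llo Lup (\<psi> t) x - time_deriv \<psi> t x - e)"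
proof -
  obtain D B M where D': "\<forall>x. time_deriv \<psi> t x = D x" "continuous_on UNIV D" "\<forall>y. \<bar>D y\<bar> \<le> M" "B \<ge> 0"
    "\<forall>h y. 0 < h \<longrightarrow> h < t \<longrightarrow> \<bar>\<psi> (t - h) y - \<psi> t y + h * D y\<bar> \<le> B * h\<^sup>2"
    by (rule time_expansion[OF \<psi> t])
  note D = D'[rule_format]
  obtain N where N: "N \<ge> 0" "\<And>y. \<bar>D (x + y) - D x\<bar> \<le> e/2 + N * trunc_norm y"
    using continuous_increment_trunc_norm[OF D(2,3), of "e/2" x] e by auto
  have \<psi>t: "cb_class 3 (\<psi> t)" by (rule Cb_23_cb_class_slice[OF \<psi> t])
  then have lip: "bdd_lip (\<psi> t)" using cb_class_imp_bdd_lip[of 2 "\<psi> t"] by (simp add: numeral_3_eq_3 numeral_2_eq_2)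
  let ?G = "levy_gen \<alpha> Llo Lup (\<psi> t)"
  obtain K where K: "K \<ge> 0" "\<And>s x. s \<in> {0..1} \<Longrightarrow> \<bar>E (\<lambda>w. \<psi> t (x + \<zeta> s w)) - \<psi> t x - s * ?G x\<bar> \<le> s * (K * s powr \<kappa>)"
    using generator[OF \<psi>t] by meson
  have hk: "((\<lambda>h. h powr \<kappa>) \<longlongrightarrow> 0) (at_right 0)"
    by (rule tendsto_zero_powrI[OF tendsto_ident_at tendsto_const _ kappa])
      (auto simp: eventually_at_filter)
  \<comment> \<open>After division by h the errors come from the generator expansion, the
    x-dependence of the time derivative and the second-order time term. Together they may use e/2;
    the local oscillation of \<open>D\<close> uses the other half.\<close>
  have "((\<lambda>h. K * h powr \<kappa> + N * (C * h powr \<kappa>) + B * h) \<longlongrightarrow> 0) (at_right 0)"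
    using tendsto_add[OF tendsto_add[OF tendsto_mult_left[OF hk, of K] tendsto_mult_left[OF tendsto_mult_left[OF hk, of C], of N]]
        tendsto_mult_left[OF tendsto_ident_at, of B 0 "{0<..}"]] by simp
  then have ev: "\<forall>\<^sub>F h in at_right 0. K * h powr \<kappa> + N * (C * h powr \<kappa>) + B * h < e/2"
    using e by (intro order_tendstoD(2)) auto
  have "\<forall>\<^sub>F h in at_right 0. h \<in> {0<..<t}" using t by (intro eventually_at_right_real) auto
  from eventually_happens'[OF trivial_limit_at_right_real eventually_conj[OF ev this]] obtain h where h: "K * h powr \<kappa> + N * (C * h powr \<kappa>) + B * h < e/2" "0 < h" "h < t"
    by auto
  have h1: "h \<in> {0..1}" using h t by auto
  have sm: "h * (K * h powr \<kappa>) + h * N * (C * h powr \<kappa>) + B * h\<^sup>2 \<le> h * (e/2)"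
    using mult_left_mono[OF less_imp_le[OF h(1)], of h] h(2) by (simp add: algebra_simps power2_eq_square)
  have W: "h * N * E (\<lambda>w. trunc_norm (\<zeta> h w)) \<le> h * N * (C * h powr \<kappa>)"
    using moment[OF h1] h(2) N(1) by (intro mult_left_mono) auto
  have ptw: "\<bar>\<psi> (t - h) (x + y) - \<psi> t (x + y) + h * D x\<bar> \<le> (h * N) * trunc_norm y + (h * (e/2) + B * h\<^sup>2)" for y
  proof -
    have "h * \<bar>D (x + y) - D x\<bar> \<le> h * (e/2 + N * trunc_norm y)" using N(2)[of y] h(2) by (intro mult_left_mono) auto
    moreover have "\<bar>h * D (x + y) - h * D x\<bar> = h * \<bar>D (x + y) - D x\<bar>"
      using h(2) by (simp add: abs_mult flip: right_diff_distrib)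
    ultimately have "\<bar>h * D (x + y) - h * D x\<bar> \<le> h * (e/2) + (h * N) * trunc_norm y"
      by (simp add: distrib_left mult.assoc)
    then show ?thesis using D(5)[OF h(2,3), of "x + y"] by linarith
  qed
  note mem = levy_shift_mem[OF lip h1, of x] levy_trunc_mem[OF h1]
  show ?thesis
  proof (rule that[OF h(2,3)]; intro ballI impI)
    fix V assume V: "V \<in> H" and le: "\<forall>w. V w \<le> \<psi> (t - h) (x + \<zeta> h w)"
    have "E V \<le> E (\<lambda>w. \<psi> t (x + \<zeta> h w)) + (h * N) * E (\<lambda>w. trunc_norm (\<zeta> h w)) + (h * (e/2) + B * h\<^sup>2 - h * D x)"
    proof (rule sublinear_le_add[OF levy_sublinear V mem])
      show "V w \<le> \<psi> t (x + \<zeta> h w) + h * N * trunc_norm (\<zeta> h w) + (h * (e/2) + B * h\<^sup>2 - h * D x)" for w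
        using spec[OF le, of w] ptw[of "\<zeta> h w"] by linarith
    qed (use h N in auto)
    then have "E V \<le> \<psi> t x + h * ?G x - h * D x + h * (e/2) + h * (e/2)"
      using W sm K(2)[OF h1, of x] by linarith
    then show "E V \<le> \<psi> t x + h * (?G x - time_deriv \<psi> t x + e)"
      by (simp add: D(1) algebra_simps)
  next
    fix V assume V: "V \<in> H" and le: "\<forall>w. \<psi> (t - h) (x + \<zeta> h w) \<le> V w"
    have "E (\<lambda>w. \<psi> t (x + \<zeta> h w)) \<le> E V + (h * N) * E (\<lambda>w. trunc_norm (\<zeta> h w)) + (h * (e/2) + B * h\<^sup>2 + h * D x)"
    proof (rule sublinear_le_add[OF levy_sublinear mem(1) V mem(2)])
      show "\<psi> t (x + \<zeta> h w) \<le> V w + h * N * trunc_norm (\<zeta> h w) + (h * (e/2) + B * h\<^sup>2 + h * D x)" for w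
        using spec[OF le, of w] ptw[of "\<zeta> h w"] by linarith
    qed (use h N in auto)
    then have "E V \<ge> \<psi> t x + h * ?G x - h * D x - h * (e/2) - h * (e/2)"
      using W sm K(2)[OF h1, of x] by linarith
    then show "E V \<ge> \<psi> t x + h * (?G x - time_deriv \<psi> t x - e)"
      by (simp add: D(1) algebra_simps)
  qed
qed

lemma visc_sol_value: "visc_sol \<alpha> Llo Lup \<phi> u"
proof -
  have bd: "bounded_fun u" unfolding bounded_fun_def by (rule value_bounds) blast
  have tend: "((\<lambda>(t,x). u t x) \<longlongrightarrow> (case p of (t,x) \<Rightarrow> u t x)) (at p within {0..1} \<times> UNIV)"
    if "p \<in> {0..1} \<times> UNIV" for p
    using continuous_on_value that unfolding continuous_on_def by blast
  have usc: "usc_on ({0..1} \<times> UNIV) (\<lambda>(t,x). u t x)" unfolding usc_on_def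
    by (intro ballI allI impI order_tendstoD(2)[OF tend]) auto
  have lsc: "lsc_on ({0..1} \<times> UNIV) (\<lambda>(t,x). u t x)" unfolding lsc_on_def
    by (intro ballI allI impI order_tendstoD(1)[OF tend]) auto
  have dpp: "u t x = E (\<lambda>w. u (t - h) (x + \<zeta> h w))" and mem: "(\<lambda>w. u (t - h) (x + \<zeta> h w)) \<in> H"
    if "0 < h" "h < t" "t \<le> 1" for t h x
    using that dynamic_programming[of "t - h" h x] levy_shift_mem[OF bdd_lip_value] by auto
  have sub: "time_deriv \<psi> t x - levy_gen \<alpha> Llo Lup (\<psi> t) x \<le> 0"
    if t: "t \<in> {0<..1}" and \<psi>: "Cb_23 \<psi>" "\<And>s y. s \<in> {0<..1} \<Longrightarrow> u s y \<le> \<psi> s y" "\<psi> t x = u t x" for t x \<psi>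
  proof (rule field_le_epsilon)
    fix e :: real assume e: "0 < e"
    have t1: "t \<le> 1" using t by simp
    obtain h where h: "0 < h" "h < t"
      "\<forall>V\<in>H. (\<forall>w. V w \<le> \<psi> (t - h) (x + \<zeta> h w)) \<longrightarrow>
       E V \<le> \<psi> t x + h * (levy_gen \<alpha> Llo Lup (\<psi> t) x - time_deriv \<psi> t x + e)"
      "\<forall>V\<in>H. (\<forall>w. \<psi> (t - h) (x + \<zeta> h w) \<le> V w) \<longrightarrow>
       E V \<ge> \<psi> t x + h * (levy_gen \<alpha> Llo Lup (\<psi> t) x - time_deriv \<psi> t x - e)"
      by (rule test_function_expansion[OF \<psi>(1) t e, of x])
    \<comment> \<open>The values of u and \<psi> at the contact point cancel, leaving h times the
      desired inequality.\<close>
    have "u t x \<le> \<psi> t x + h * (levy_gen \<alpha> Llo Lup (\<psi> t) x - time_deriv \<psi> t x + e)"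
      unfolding dpp[OF h(1,2) t1] by (rule bspec[OF h(3) mem[OF h(1,2) t1], rule_format]) (use \<psi>(2)[of "t - h"] h(1,2) t in auto)
    then show "time_deriv \<psi> t x - levy_gen \<alpha> Llo Lup (\<psi> t) x \<le> 0 + e"
      using \<psi>(3) h(1) by (simp add: zero_le_mult_iff)
  qed
  have super: "time_deriv \<psi> t x - levy_gen \<alpha> Llo Lup (\<psi> t) x \<ge> 0"
    if t: "t \<in> {0<..1}" and \<psi>: "Cb_23 \<psi>" "\<And>s y. s \<in> {0<..1} \<Longrightarrow> \<psi> s y \<le> u s y" "\<psi> t x = u t x" for t x \<psi>
  proof (rule field_le_epsilon)
    fix e :: real assume e: "0 < e"
    have t1: "t \<le> 1" using t by simp
    obtain h where h: "0 < h" "h < t"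
      "\<forall>V\<in>H. (\<forall>w. V w \<le> \<psi> (t - h) (x + \<zeta> h w)) \<longrightarrow>
       E V \<le> \<psi> t x + h * (levy_gen \<alpha> Llo Lup (\<psi> t) x - time_deriv \<psi> t x + e)"
      "\<forall>V\<in>H. (\<forall>w. \<psi> (t - h) (x + \<zeta> h w) \<le> V w) \<longrightarrow>
       E V \<ge> \<psi> t x + h * (levy_gen \<alpha> Llo Lup (\<psi> t) x - time_deriv \<psi> t x - e)"
      by (rule test_function_expansion[OF \<psi>(1) t e, of x])
    have "u t x \<ge> \<psi> t x + h * (levy_gen \<alpha> Llo Lup (\<psi> t) x - time_deriv \<psi> t x - e)"
      unfolding dpp[OF h(1,2) t1] by (rule bspec[OF h(4) mem[OF h(1,2) t1], rule_format]) (use \<psi>(2)[of "t - h"] h(1,2) t in auto)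
    then show "0 \<le> time_deriv \<psi> t x - levy_gen \<alpha> Llo Lup (\<psi> t) x + e"
      using \<psi>(3) h(1) by (simp add: mult_le_0_iff)
  qed
  have "visc_sub \<alpha> Llo Lup \<phi> u" unfolding visc_sub_def
    using bd usc sub by (simp add: value_0)
  moreover have "visc_super \<alpha> Llo Lup \<phi> u" unfolding visc_super_def
    using bd lsc super by (simp add: value_0)
  ultimately show ?thesis
    unfolding visc_sol_def using continuous_on_value by blast
qed

end

end

section \<open>Comparison principle\<close>

text \<open>The fourth power makes the positive part C^3. At distance 3 R the inner term is 2 *
  (1/2) - 1 = 0, so the support is bounded. The factor 3 is chosen for
  \<open>one_minus_bump_le\<close>: with s = 1 - \<open>rat_bump\<close>, Bernoulli bounds 1 -
  \<open>bump\<close> by 8 s, while 9 s is at most (|q|/R)^2.\<close>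

definition bump :: "real \<Rightarrow> 'v::euclidean_space \<Rightarrow> real" where
  "bump R q = (max 0 (2 * rat_bump ((1 / (3 * R)) *\<^sub>R q) - 1)) ^ 4"

lemma bump_nonneg: "0 \<le> bump R q" and bump_le_1: "bump R q \<le> 1"
proof -
  show "0 \<le> bump R q" by (simp add: bump_def)
  have "max 0 (2 * rat_bump ((1 / (3 * R)) *\<^sub>R q) - 1) \<le> 1"
    using rat_bump_le_1[of "(1 / (3 * R)) *\<^sub>R q"] by simp
  then show "bump R q \<le> 1" unfolding bump_def by (intro power_le_one) auto
qed

lemma bump_0 [simp]: "bump R 0 = 1"
  by (simp add: bump_def)

lemma bump_support:
  assumes "0 < R" "bump R q \<noteq> 0" shows "norm q \<le> 3 * R"
proof (rule ccontr)
  assume "\<not> norm q \<le> 3 * R"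
  then have "1 \<le> norm ((1 / (3 * R)) *\<^sub>R q)" using assms by (simp add: field_simps)
  then have "rat_bump ((1 / (3 * R)) *\<^sub>R q) \<le> 1/2" by (rule rat_bump_le_half)
  then show False using assms by (simp add: bump_def)
qed

lemma one_minus_bump_le:
  assumes "0 < R" shows "1 - bump R q \<le> quad_cut R (norm q)"
proof -
  define s where "s = 1 - rat_bump ((1 / (3 * R)) *\<^sub>R q)"
  have "s \<le> (norm ((1 / (3 * R)) *\<^sub>R q))\<^sup>2" unfolding s_def by (rule one_minus_rat_bump_le)
  also have "\<dots> = (norm q / R)\<^sup>2 / 9" using assms by (simp add: power_divide power_mult_distrib)
  finally have s: "9 * s \<le> (norm q / R)\<^sup>2" by simp
  have b: "bump R q = (max 0 (1 - 2 * s)) ^ 4" by (simp add: bump_def s_def)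
  have "1 - bump R q \<le> (norm q / R)\<^sup>2"
  proof (cases "1 - 2 * s \<ge> 0")
    case True
    then have "1 + real 4 * (- 2 * s) \<le> (1 + (- 2 * s)) ^ 4" by (intro Bernoulli_inequality) auto
    then have "1 - bump R q \<le> 8 * s" using True by (simp add: b)
    moreover have "0 \<le> s" using rat_bump_le_1 by (simp add: s_def)
    ultimately show ?thesis using s by linarith
  next
    case False
    then show ?thesis using s by (simp add: b)
  qed
  moreover have "1 - bump R q \<le> 1" using bump_nonneg[of R q] by simp
  ultimately show ?thesis by (simp add: quad_cut_def)
qed

text \<open>On the support of the cutoff \<open>norm l \<le> 3 * \<rho>\<close>, so a quadratic
  bound at scale 1 becomes \<rho>^2 times one at scale \<rho>. Together with the factor
  \<rho>^(-\<alpha>) from integrating \<open>quad_cut \<rho>\<close> this is the source of the power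
  2 - \<alpha>.\<close>

lemma bump_quad_cut:
  assumes "0 < \<rho>" shows "bump \<rho> l * quad_cut 1 (norm l) \<le> 9 * \<rho>\<^sup>2 * quad_cut \<rho> (norm l)"
proof (cases "bump \<rho> l = 0")
  case True
  then show ?thesis by simp
next
  case False
  have 1: "(norm l)\<^sup>2 \<le> 9 * \<rho>\<^sup>2"
    using power_mono[OF bump_support[OF assms False], of 2] by (simp add: power_mult_distrib)
  have 2: "bump \<rho> l * quad_cut 1 (norm l) \<le> 1 * (norm l)\<^sup>2"
    using bump_le_1[of \<rho> l] by (intro mult_mono) (auto simp: quad_cut_def)
  have "9 * \<rho>\<^sup>2 * quad_cut \<rho> (norm l) = min (9 * \<rho>\<^sup>2) (9 * (norm l)\<^sup>2)"
    using assms by (simp add: quad_cut_def min_mult_distrib_left power_divide)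
  moreover have "bump \<rho> l * quad_cut 1 (norm l) \<le> min (9 * \<rho>\<^sup>2) (9 * (norm l)\<^sup>2)"
    using 1 2 zero_le_power2[of "norm l"] by (intro min.boundedI) linarith+
  ultimately show ?thesis by simp
qed

lemma cb_class_bump: "cb_class 3 (\<lambda>q. bump R (q - p))"
proof -
  have "cb_class 3 (\<lambda>q. rat_bump ((1 / (3 * R)) *\<^sub>R q + (- (1 / (3 * R)) *\<^sub>R p)))"
    by (rule cb_class_affine[OF cb_class_rat_bump])
  then have "cb_class 3 (\<lambda>q. rat_bump ((1 / (3 * R)) *\<^sub>R (q - p)))" by (simp add: scaleR_diff_right)
  then have "cb_class 3 (\<lambda>q. 2 * rat_bump ((1 / (3 * R)) *\<^sub>R (q - p)) - 1)"
    by (rule cb_class_diff[OF cb_class_scale cb_class_const])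
  moreover have "Suc 3 = (4::nat)" by simp
  ultimately show ?thesis unfolding bump_def using cb_class_max0_power by metis
qed

text \<open>On a ball a Stone-Weierstrass approximation, raised by e/2, lies above F by at most e;
  where the cutoff falls off, the constant B takes over. The resulting excess is at most 2 B times a
  quadratic cut at scale R, hence cheap for large R.\<close>

lemma smooth_majorant:
  fixes F :: "'a::euclidean_space \<Rightarrow> real"
  assumes A: "closed A" "continuous_on A F" "\<And>q. q \<in> A \<Longrightarrow> \<bar>F q\<bar> \<le> B" and e: "0 < e" and R: "0 < R"
  obtains W where "cb_class 3 W" "\<forall>q\<in>A. F q \<le> W q \<and> W q \<le> F q + (e + 2 * B * quad_cut R (norm (q - p)))"
proof -
  define S where "S = A \<inter> cball p (3 * R)"
  have S: "compact S" unfolding S_def using A(1) by (rule closed_Int_compact) simp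
  have "\<exists>g. cb_class 3 g \<and> (\<forall>x\<in>S. \<bar>F x - g x\<bar> < e/2)"
  proof (rule Stone_Weierstrass_HOL[OF S])
    show "continuous_on S F" using A(2) by (rule continuous_on_subset) (auto simp: S_def)
    fix x y assume xy: "x \<in> S \<and> y \<in> S \<and> x \<noteq> y"
    then obtain b where b: "b \<in> Basis" "x \<bullet> b \<noteq> y \<bullet> b" using euclidean_eqI by blast
    \<comment> \<open>The frequency makes the cosine equal to -1 at x and to 1 at y.\<close>
    define c where "c = pi / (x \<bullet> b - y \<bullet> b)"
    have "c * (x \<bullet> b) + - (c * (y \<bullet> b)) = c * (x \<bullet> b - y \<bullet> b)" by (simp add: algebra_simps)
    also have "\<dots> = pi" using b by (simp add: c_def)
    finally have "cos (c * (x \<bullet> b) + - (c * (y \<bullet> b))) = -1" by simp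
    then show "\<exists>f. cb_class 3 f \<and> f x \<noteq> f y"
      by (intro exI[of _ "\<lambda>z. cos (c * (z \<bullet> b) + - (c * (y \<bullet> b)))"] conjI cb_class_cos) simp
  qed (use e in \<open>auto intro: cb_class_const cb_class_add cb_class_mult cb_class_continuous\<close>)
  then obtain g where g: "cb_class 3 g" "\<And>x. x \<in> S \<Longrightarrow> \<bar>F x - g x\<bar> < e/2" by blast
  define W where "W q = bump R (q - p) * (g q + e/2) + (1 - bump R (q - p)) * B" for q
  have "cb_class 3 W" unfolding W_def
    by (intro cb_class_add[OF cb_class_mult[OF cb_class_bump] cb_class_mult[OF cb_class_diff[OF _ cb_class_bump]]]
        cb_class_add[OF g(1)] cb_class_const)
  moreover have "F q \<le> W q \<and> W q \<le> F q + (e + 2 * B * quad_cut R (norm (q - p)))" if q: "q \<in> A" for q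
  proof -
    let ?b = "bump R (q - p)"
    have Fq: "\<bar>F q\<bar> \<le> B" using A(3) q by blast
    have eq: "W q - F q = ?b * (g q + e/2 - F q) + (1 - ?b) * (B - F q)" by (simp add: W_def algebra_simps)
    have b01: "0 \<le> ?b" "0 \<le> 1 - ?b" "1 - ?b \<le> quad_cut R (norm (q - p))"
      using bump_nonneg bump_le_1 one_minus_bump_le[OF R] by (auto simp: le_diff_eq)
    have 1: "0 \<le> ?b * (g q + e/2 - F q) \<and> ?b * (g q + e/2 - F q) \<le> e"
    proof (cases "?b = 0")
      case False
      then have "q \<in> S" using bump_support[OF R, of "q - p"] q by (auto simp: S_def dist_norm norm_minus_commute)
      then have "0 \<le> g q + e/2 - F q" "g q + e/2 - F q \<le> e" using g(2)[of q] by linarith+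
      then show ?thesis using b01 mult_mono[of ?b 1 "g q + e/2 - F q" e] bump_le_1[of R "q - p"] by auto
    qed (use e in auto)
    have 2: "0 \<le> (1 - ?b) * (B - F q)" using b01 Fq by auto
    have "(1 - ?b) * (B - F q) \<le> quad_cut R (norm (q - p)) * (2 * B)"
      using b01 Fq by (intro mult_mono) auto
    then show ?thesis using eq 1 2 by (simp add: algebra_simps)
  qed
  ultimately show ?thesis using that by blast
qed

text \<open>Near p the explicit function Q is kept, away from p the smooth majorant takes over. The
  cutoff differs from 1 only quadratically at p, so \<psi> and Q have the same first derivatives
  there; the bound with C records this, and time derivatives can be computed from Q.\<close>

lemma test_function_above:
  fixes F :: "'a::euclidean_space \<Rightarrow> real"
  assumes A: "closed A" "continuous_on A F" "\<And>q. q \<in> A \<Longrightarrow> \<bar>F q\<bar> \<le> B"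
    and Q: "cb_class 3 Q" "\<And>q. q \<in> A \<Longrightarrow> F q \<le> Q q" "F p = Q p"
    and pos: "0 < e" "0 < R" "0 < \<rho>"
  obtains \<psi> C where "cb_class 3 \<psi>" "\<forall>q\<in>A. F q \<le> \<psi> q" "\<psi> p = F p"
    "\<forall>q. \<bar>\<psi> q - Q q\<bar> \<le> C * (norm (q - p))\<^sup>2"
    "\<forall>q\<in>A. \<psi> q \<le> bump \<rho> (q - p) * Q q + (1 - bump \<rho> (q - p)) * (F q + (e + 2 * B * quad_cut R (norm (q - p))))"
proof -
  obtain W where W: "cb_class 3 W"
    "\<forall>q\<in>A. F q \<le> W q \<and> W q \<le> F q + (e + 2 * B * quad_cut R (norm (q - p)))"
    by (rule smooth_majorant[OF A pos(1,2)])
  define \<psi> where "\<psi> q = bump \<rho> (q - p) * Q q + (1 - bump \<rho> (q - p)) * W q" for q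
  have b01: "0 \<le> bump \<rho> q" "0 \<le> 1 - bump \<rho> q" for q :: 'a
    using bump_nonneg bump_le_1 by (auto simp: le_diff_eq)
  obtain B1 where B1: "B1 \<ge> 0" "\<And>x. \<bar>Q x\<bar> \<le> B1" using cb_class_bounded[OF Q(1)] by blast
  obtain B2 where B2: "B2 \<ge> 0" "\<And>x. \<bar>W x\<bar> \<le> B2" using cb_class_bounded[OF W(1)] by blast
  show ?thesis
  proof (rule that[of \<psi> "(B1 + B2) / \<rho>\<^sup>2"])
    show "cb_class 3 \<psi>" unfolding \<psi>_def
      by (intro cb_class_add[OF cb_class_mult[OF cb_class_bump Q(1)] cb_class_mult[OF cb_class_diff[OF cb_class_const cb_class_bump] W(1)]])
    show "\<forall>q\<in>A. F q \<le> \<psi> q"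
    proof
      fix q assume q: "q \<in> A"
      have "bump \<rho> (q - p) * F q + (1 - bump \<rho> (q - p)) * F q \<le> \<psi> q" unfolding \<psi>_def
        using b01 Q(2)[OF q] W(2) q by (intro add_mono mult_left_mono) auto
      then show "F q \<le> \<psi> q" by (simp add: algebra_simps)
    qed
    show "\<psi> p = F p" using Q(3) by (simp add: \<psi>_def)
    show "\<forall>q. \<bar>\<psi> q - Q q\<bar> \<le> (B1 + B2) / \<rho>\<^sup>2 * (norm (q - p))\<^sup>2"
    proof
      fix q
      have "\<psi> q - Q q = (1 - bump \<rho> (q - p)) * (W q - Q q)" by (simp add: \<psi>_def algebra_simps)
      then have "\<bar>\<psi> q - Q q\<bar> = (1 - bump \<rho> (q - p)) * \<bar>W q - Q q\<bar>" using b01(2) by (simp add: abs_mult)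
      also have "\<dots> \<le> (norm (q - p) / \<rho>)\<^sup>2 * (B1 + B2)"
      proof (rule mult_mono)
        show "1 - bump \<rho> (q - p) \<le> (norm (q - p) / \<rho>)\<^sup>2"
          using one_minus_bump_le[OF pos(3), of "q - p"] by (simp add: quad_cut_def)
        show "\<bar>W q - Q q\<bar> \<le> B1 + B2" using B1(2)[of q] B2(2)[of q] by linarith
      qed auto
      finally show "\<bar>\<psi> q - Q q\<bar> \<le> (B1 + B2) / \<rho>\<^sup>2 * (norm (q - p))\<^sup>2"
        by (simp add: power_divide mult.commute)
    qed
    show "\<forall>q\<in>A. \<psi> q \<le> bump \<rho> (q - p) * Q q + (1 - bump \<rho> (q - p)) * (F q + (e + 2 * B * quad_cut R (norm (q - p))))"
      unfolding \<psi>_def using b01(2) W(2) by (intro ballI add_left_mono mult_left_mono) auto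
  qed
qed

lemma DERIV_quadratic_perturbation:
  fixes f g :: "real \<Rightarrow> real"
  assumes "(f has_real_derivative d) (at t)" "\<And>s. \<bar>g s - f s\<bar> \<le> C * (s - t)\<^sup>2"
  shows "(g has_real_derivative d) (at t)"
proof -
  have "((\<lambda>s. g s - f s) has_real_derivative 0) (at t)"
  proof -
    have gt: "g t - f t = 0" using assms(2)[of t] by simp
    have "(\<lambda>h. ((g (t + h) - f (t + h)) - (g t - f t)) / h) \<midarrow>0\<rightarrow> 0"
    proof (rule Lim_null_comparison)
      show "\<forall>\<^sub>F h in at 0. norm (((g (t + h) - f (t + h)) - (g t - f t)) / h) \<le> C * \<bar>h\<bar>"
        unfolding eventually_at_filter
      proof (intro always_eventually allI impI)
        fix h :: real assume "h \<noteq> 0"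
        then show "norm (((g (t + h) - f (t + h)) - (g t - f t)) / h) \<le> C * \<bar>h\<bar>"
          using assms(2)[of "t + h"] gt by (simp add: abs_divide divide_le_eq power2_eq_square abs_mult_self_eq mult.assoc)
      qed
      show "(\<lambda>h. C * \<bar>h\<bar>) \<midarrow>0\<rightarrow> 0"
        using tendsto_mult_left[OF tendsto_rabs[OF tendsto_ident_at], of C 0 UNIV] by simp
    qed
    then show ?thesis by (simp add: DERIV_def)
  qed
  from DERIV_add[OF assms(1) this] show ?thesis by simp
qed

text \<open>One statement covers the small radii (positive exponent) and the large ones (negative
  exponent).\<close>

lemma small_powr:
  fixes A e a :: real
  assumes "0 < e" "a \<noteq> 0"
  obtains r where "0 < r" "A * r powr a < e"
proof -
  define r where "r = (e / (\<bar>A\<bar> + 1)) powr (1 / a)"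
  have "r powr a = e / (\<bar>A\<bar> + 1)" using assms by (simp add: r_def powr_powr)
  moreover have "A * (e / (\<bar>A\<bar> + 1)) < e" using assms
    by (simp add: pos_divide_less_eq mult.commute)
  moreover have "0 < r" using assms by (simp add: r_def)
  ultimately show ?thesis using that by metis
qed

text \<open>On [0,1] the functions 1 - cos (t - s) and sin t act like (t - s)^2 / 2 and t, while
  remaining smooth and bounded on the whole line.\<close>

lemma cb_class_fst_cos: "cb_class n (\<lambda>p::real \<times> 'v::euclidean_space. cos (fst p - a))"
  using cb_class_cos[of n 1 "(1, 0) :: real \<times> 'v" "- a"] by (simp add: inner_prod_def)

lemma cb_class_fst_sin: "cb_class n (\<lambda>p::real \<times> 'v::euclidean_space. sin (fst p))"
proof -
  have "cos (fst p - pi/2) = sin (fst p)" for p :: "real \<times> 'v" by (simp add: cos_diff)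
  then show ?thesis using cb_class_fst_cos[of n "pi/2", where 'v='v] by simp
qed

lemma cb_class_snd_rat_bump:
  "cb_class n (\<lambda>p::real \<times> 'v::euclidean_space. rat_bump (c *\<^sub>R (snd p - a)))"
  using cb_class_snd[OF cb_class_affine[OF cb_class_rat_bump, of n c "- (c *\<^sub>R a)"]]
  by (simp add: scaleR_diff_right)

lemma rat_bump_minus_commute: "rat_bump (x - y) = rat_bump (y - x)"
  using rat_bump_uminus[of "x - y"] by simp

lemma cos_ge_half: "0 \<le> (t::real) \<Longrightarrow> t \<le> 1 \<Longrightarrow> 1/2 \<le> cos t"
  using cos_monotone_0_pi_le[of t "pi/3"] pi_gt3 by (simp add: cos_60)

(* At a maximum of the doubled functional, u and -v are touched from above by the penalty terms;
   shifting both arguments by the same l leaves the coupling term unchanged, so only the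
   localising penalty survives in the difference of the nonlocal terms. *)
lemma no_doubled_maximum:
  fixes u v :: "real \<Rightarrow> 'v::euclidean_space \<Rightarrow> real"
  assumes alpha: "0 < \<alpha>" "\<alpha> \<le> 1" and Lup: "0 < Lup" and pos: "0 < c" "0 < R" "0 \<le> K" "0 \<le> N"
    and sub: "visc_sub \<alpha> Llo Lup \<phi> u" and super: "visc_super \<alpha> Llo Lup \<phi> v"
    and cont: "continuous_on ({0..1} \<times> UNIV) (\<lambda>(t,x). u t x)" "continuous_on ({0..1} \<times> UNIV) (\<lambda>(t,x). v t x)"
    and bd: "\<And>t x. t \<in> {0..1} \<Longrightarrow> \<bar>u t x\<bar> \<le> B" "\<And>t x. t \<in> {0..1} \<Longrightarrow> \<bar>v t x\<bar> \<le> B"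
    and C0: "0 \<le> C0" "\<And>(z::'v) l. \<bar>second_diff rat_bump z l\<bar> \<le> C0 * quad_cut 1 (norm l)"
    and R: "Lup / 2 * levy_mass \<alpha> * (K * C0) * R powr (-\<alpha>) < c / 8"
    and ts: "t \<in> {0<..1}" "s \<in> {0<..1}"
    and max: "\<And>t' x' s' y'. t' \<in> {0..1} \<Longrightarrow> s' \<in> {0..1} \<Longrightarrow>
      u t' x' - v s' y' - c * sin t' - N * (1 - cos (t' - s')) - N * (1 - rat_bump (x' - y'))
        - K * (1 - rat_bump ((1/R) *\<^sub>R (x' - x0)))
      \<le> u t x - v s y - c * sin t - N * (1 - cos (t - s)) - N * (1 - rat_bump (x - y))
        - K * (1 - rat_bump ((1/R) *\<^sub>R (x - x0)))"
  shows False
proof -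
  let ?A = "{0..1::real} \<times> (UNIV :: 'v set)"
  let ?J = "Lup / 2 * levy_mass \<alpha>"
  define kx where "kx x' = rat_bump ((1/R) *\<^sub>R (x' - x0))" for x'
  have clA: "closed ?A" by (intro closed_Times) auto
  have tsA: "t \<in> {0..1}" "s \<in> {0..1}" using ts by auto
  have B0: "0 \<le> B" using bd(1)[OF tsA(1), of x] by linarith
  \<comment> \<open>Four errors, the one of \<open>R\<close> included, are each held below c/8. The
    choice of \<rho> precedes that of e, because e is multiplied by the large factor
    \<rho>^(-\<alpha>).\<close>
  obtain \<rho> where \<rho>: "0 < \<rho>" "?J * (18 * N * C0) * \<rho> powr (2 - \<alpha>) < c/8"
    by (rule small_powr[of "c/8" "2 - \<alpha>" "?J * (18 * N * C0)"]) (use pos alpha in auto)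
  obtain R2 where R2: "0 < R2" "?J * (8 * B) * R2 powr (- \<alpha>) < c/8"
    by (rule small_powr[of "c/8" "-\<alpha>" "?J * (8 * B)"]) (use pos alpha in auto)
  obtain e where e: "0 < e" "?J * 4 * \<rho> powr (-\<alpha>) * e powr 1 < c/8"
    by (rule small_powr[of "c/8" 1 "?J * 4 * \<rho> powr (-\<alpha>)"]) (use pos in auto)
  \<comment> \<open>\<open>Q1\<close> and \<open>Q2\<close> are what the maximality inequality says
    about u and -v when the other point is frozen at its maximising position, normalised to agree
    with u and -v at the contact points. The term c sin t and the localising penalty belong to
    \<open>Q1\<close> alone.\<close>
  define Q1 where "Q1 q = (u t x + c * (sin (fst q) - sin t) + N * (cos (t - s) - cos (fst q - s))
     + N * (rat_bump (x - y) - rat_bump (1 *\<^sub>R (snd q - y)))) + K * (kx x - rat_bump ((1/R) *\<^sub>R (snd q - x0)))" for q :: "real \<times> 'v"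
  define Q2 where "Q2 q = - v s y + N * (cos (t - s) - cos (fst q - t))
     + N * (rat_bump (x - y) - rat_bump (1 *\<^sub>R (snd q - x)))" for q :: "real \<times> 'v"
  have Q1: "cb_class 3 Q1" unfolding Q1_def
    by (intro cb_class_add[OF cb_class_add[OF cb_class_add[OF cb_class_add]]] cb_class_scale cb_class_diff cb_class_const
      cb_class_fst_cos cb_class_fst_sin cb_class_snd_rat_bump)
  have Q2: "cb_class 3 Q2" unfolding Q2_def
    by (intro cb_class_add[OF cb_class_add] cb_class_scale cb_class_diff cb_class_const
      cb_class_fst_cos cb_class_snd_rat_bump)
  have Q1le: "(case q of (t,x) \<Rightarrow> u t x) \<le> Q1 q" if "q \<in> ?A" for q
    using max[of "fst q" s "snd q" y] that tsA by (auto simp: Q1_def kx_def algebra_simps)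
  have Q2le: "- (case q of (t,x) \<Rightarrow> v t x) \<le> Q2 q" if "q \<in> ?A" for q
    using max[of t "fst q" x "snd q"] that tsA cos_minus[of "t - fst q"]
    by (auto simp: Q2_def rat_bump_minus_commute[of _ x] algebra_simps)
  obtain \<psi>1 C1 where \<psi>1: "cb_class 3 \<psi>1" "\<forall>q\<in>?A. (case q of (t,x) \<Rightarrow> u t x) \<le> \<psi>1 q" "\<psi>1 (t, x) = (case (t, x) of (t,x) \<Rightarrow> u t x)"
    "\<forall>q. \<bar>\<psi>1 q - Q1 q\<bar> \<le> C1 * (norm (q - (t, x)))\<^sup>2"
    "\<forall>q\<in>?A. \<psi>1 q \<le> bump \<rho> (q - (t, x)) * Q1 q + (1 - bump \<rho> (q - (t, x))) * ((case q of (t,x) \<Rightarrow> u t x) + (e + 2 * B * quad_cut R2 (norm (q - (t, x)))))"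
    by (rule test_function_above[OF clA cont(1) _ Q1 Q1le, where p="(t, x)" and B=B, OF _ _ _ e(1) R2(1) \<rho>(1)])
      (auto simp: bd(1) Q1_def kx_def)
  have cont2: "continuous_on ?A (\<lambda>q. - (case q of (t,x) \<Rightarrow> v t x))" by (intro continuous_on_minus cont(2))
  obtain \<psi>2 C2 where \<psi>2: "cb_class 3 \<psi>2" "\<forall>q\<in>?A. - (case q of (t,x) \<Rightarrow> v t x) \<le> \<psi>2 q" "\<psi>2 (s, y) = - (case (s, y) of (t,x) \<Rightarrow> v t x)"
    "\<forall>q. \<bar>\<psi>2 q - Q2 q\<bar> \<le> C2 * (norm (q - (s, y)))\<^sup>2"
    "\<forall>q\<in>?A. \<psi>2 q \<le> bump \<rho> (q - (s, y)) * Q2 q + (1 - bump \<rho> (q - (s, y))) * (- (case q of (t,x) \<Rightarrow> v t x) + (e + 2 * B * quad_cut R2 (norm (q - (s, y)))))"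
    by (rule test_function_above[OF clA cont2 _ Q2 Q2le, where p="(s, y)" and B=B, OF _ _ _ e(1) R2(1) \<rho>(1)])
      (auto simp: bd(2) Q2_def rat_bump_minus_commute[of x y] cos_diff)
  \<comment> \<open>The time derivative is that of \<open>Q1\<close>, with which \<psi>1 agrees up
    to second order. The coupling part N sin (t - s) reappears in \<open>td2\<close> and cancels, so
    that c cos t remains.\<close>
  have td1: "time_deriv (\<lambda>t x. \<psi>1 (t, x)) t x = c * cos t + N * sin (t - s)"
  proof (rule time_deriv_eq[OF has_field_derivative_at_within ts(1)])
    have "((\<lambda>r. Q1 (r, x)) has_real_derivative c * cos t + N * sin (t - s)) (at t)"
      unfolding Q1_def by (auto intro!: derivative_eq_intros)
    then show "((\<lambda>r. \<psi>1 (r, x)) has_real_derivative c * cos t + N * sin (t - s)) (at t)"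
    proof (rule DERIV_quadratic_perturbation[where C=C1])
      show "\<bar>\<psi>1 (r, x) - Q1 (r, x)\<bar> \<le> C1 * (r - t)\<^sup>2" for r
        using spec[OF \<psi>1(4), of "(r, x)"] by (simp add: norm_Pair)
    qed
  qed
  have td2: "time_deriv (\<lambda>t x. - \<psi>2 (t, x)) s y = N * sin (t - s)"
  proof (rule time_deriv_eq[OF has_field_derivative_at_within ts(2)])
    have "((\<lambda>r. Q2 (r, y)) has_real_derivative N * sin (s - t)) (at s)"
      unfolding Q2_def by (auto intro!: derivative_eq_intros)
    then have "((\<lambda>r. \<psi>2 (r, y)) has_real_derivative N * sin (s - t)) (at s)"
    proof (rule DERIV_quadratic_perturbation[where C=C2])
      show "\<bar>\<psi>2 (r, y) - Q2 (r, y)\<bar> \<le> C2 * (r - s)\<^sup>2" for r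
        using spec[OF \<psi>2(4), of "(r, y)"] by (simp add: norm_Pair)
    qed
    from DERIV_minus[OF this] show "((\<lambda>r. - \<psi>2 (r, y)) has_real_derivative N * sin (t - s)) (at s)"
      using sin_minus[of "s - t"] by simp
  qed
  let ?f1 = "\<lambda>z. \<psi>1 (t, z)" and ?f2 = "\<lambda>z. - \<psi>2 (s, z)"
  have c1: "Cb_23 (\<lambda>t x. \<psi>1 (t, x))" and c2: "Cb_23 (\<lambda>t x. - \<psi>2 (t, x))"
    using Cb_23_of_cb_class[OF \<psi>1(1)] Cb_23_of_cb_class[OF cb_class_minus[OF \<psi>2(1)]] by simp_all
  have "c * cos t + N * sin (t - s) - levy_gen \<alpha> Llo Lup ?f1 x \<le> 0"
  proof -
    have "u s' y' \<le> \<psi>1 (s', y')" if "s' \<in> {0<..1}" for s' y'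
      using bspec[OF \<psi>1(2), of "(s', y')"] that by auto
    moreover have "\<psi>1 (t, x) = u t x" using \<psi>1(3) by simp
    ultimately show ?thesis
      using sub ts(1) c1 unfolding visc_sub_def td1[symmetric] by blast
  qed
  moreover have "N * sin (t - s) - levy_gen \<alpha> Llo Lup ?f2 y \<ge> 0"
  proof -
    have "- \<psi>2 (s', y') \<le> v s' y'" if "s' \<in> {0<..1}" for s' y'
      using bspec[OF \<psi>2(2), of "(s', y')"] that by auto
    moreover have "- \<psi>2 (s, y) = v s y" using \<psi>2(3) by simp
    ultimately show ?thesis
      using super ts(2) c2 unfolding visc_super_def td2[symmetric] by blast
  qed
  moreover have "levy_gen \<alpha> Llo Lup ?f1 x \<le> levy_gen \<alpha> Llo Lup ?f2 y +
      ?J * ((K * C0) * R powr (-\<alpha>) + (18 * N * C0 * \<rho>\<^sup>2 + 4 * e) * \<rho> powr (-\<alpha>) + (8 * B) * R2 powr (-\<alpha>))"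
  proof (rule levy_gen_le[OF alpha, where n=1])
    show "cb_class (Suc (Suc 1)) ?f1" "cb_class (Suc (Suc 1)) ?f2"
      using Cb_23_cb_class_slice[OF c1 ts(1)] Cb_23_cb_class_slice[OF c2 ts(2)] by (simp_all add: numeral_3_eq_3)
    fix l :: 'v
    define M0 where "M0 = u t x - v s y"
    \<comment> \<open>The error for one shift; adding the shifts l and -l doubles it, whence the
      constants 18, 4 and 8.\<close>
    define E where "E = (9 * N * C0 * \<rho>\<^sup>2 + 2 * e) * quad_cut \<rho> (norm l) + 4 * B * quad_cut R2 (norm l)"
    have D: "\<psi>1 (t, x + m) + \<psi>2 (s, y + m) - M0 \<le> K * (kx x - kx (x + m)) + E" if m: "norm m = norm l" for m
    proof -
      let ?b = "bump \<rho> ((0::real), m)" and ?q = "quad_cut R2 (norm l)"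
      have b01: "0 \<le> ?b" "0 \<le> 1 - ?b" "1 - ?b \<le> quad_cut \<rho> (norm l)"
        using bump_nonneg bump_le_1 one_minus_bump_le[OF \<rho>(1), of "((0::real), m)"] m
        by (auto simp: le_diff_eq norm_Pair)
      have 1: "\<psi>1 (t, x + m) \<le> ?b * Q1 (t, x + m) + (1 - ?b) * (u t (x + m) + (e + 2 * B * ?q))"
        using bspec[OF \<psi>1(5), of "(t, x + m)"] tsA m by (simp add: norm_Pair)
      have 2: "\<psi>2 (s, y + m) \<le> ?b * Q2 (s, y + m) + (1 - ?b) * (- v s (y + m) + (e + 2 * B * ?q))"
        using bspec[OF \<psi>2(5), of "(s, y + m)"] tsA m by (simp add: norm_Pair)
      \<comment> \<open>\<open>Q1\<close> moves only x and \<open>Q2\<close> only y, each with the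
        other point frozen. As \<open>rat_bump\<close> is even, their coupling terms form a second
        difference at x - y; the time penalties contribute nothing because the times are not
        moved.\<close>
      have sumQ: "Q1 (t, x + m) + Q2 (s, y + m) = M0 + K * (kx x - kx (x + m)) - N * second_diff rat_bump (x - y) m"
      proof -
        have "rat_bump (y + m - x) = rat_bump (x - y - m)"
          using rat_bump_minus_commute[of "y + m" x] by (simp add: algebra_simps)
        then show ?thesis using cos_minus[of "t - s"]
          by (simp add: Q1_def Q2_def M0_def kx_def second_diff_def algebra_simps)
      qed
      have uv: "u t (x + m) - v s (y + m) \<le> M0 + K * (kx x - kx (x + m))"
        using max[OF tsA, of "x + m" "y + m"] by (simp add: M0_def kx_def algebra_simps)
      have "\<psi>1 (t, x + m) + \<psi>2 (s, y + m) \<le> ?b * (Q1 (t, x + m) + Q2 (s, y + m))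
          + (1 - ?b) * ((u t (x + m) - v s (y + m)) + (2 * e + 4 * B * ?q))"
        using 1 2 by (simp add: algebra_simps)
      also have "\<dots> \<le> ?b * (M0 + K * (kx x - kx (x + m)) - N * second_diff rat_bump (x - y) m)
          + (1 - ?b) * ((M0 + K * (kx x - kx (x + m))) + (2 * e + 4 * B * ?q))"
        unfolding sumQ using b01 uv by (intro add_left_mono mult_left_mono) auto
      also have "\<dots> = M0 + K * (kx x - kx (x + m)) + N * (?b * - second_diff rat_bump (x - y) m)
          + (1 - ?b) * (2 * e) + (1 - ?b) * (4 * B * ?q)" by (simp add: algebra_simps)
      finally have 3: "\<psi>1 (t, x + m) + \<psi>2 (s, y + m) - M0 \<le> K * (kx x - kx (x + m))
          + N * (?b * - second_diff rat_bump (x - y) m) + (1 - ?b) * (2 * e) + (1 - ?b) * (4 * B * ?q)" by simp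
      have "?b * - second_diff rat_bump (x - y) m \<le> ?b * (C0 * quad_cut 1 (norm m))"
        using C0(2)[of "x - y" m] b01 by (intro mult_left_mono) auto
      also have "\<dots> = C0 * (?b * quad_cut 1 (norm ((0::real), m)))" by (simp add: norm_Pair)
      also have "\<dots> \<le> C0 * (9 * \<rho>\<^sup>2 * quad_cut \<rho> (norm ((0::real), m)))"
        by (rule mult_left_mono[OF bump_quad_cut[OF \<rho>(1)] C0(1)])
      also have "\<dots> = C0 * (9 * \<rho>\<^sup>2 * quad_cut \<rho> (norm l))" using m by (simp add: norm_Pair)
      finally have 4: "N * (?b * - second_diff rat_bump (x - y) m) \<le> N * (C0 * (9 * \<rho>\<^sup>2 * quad_cut \<rho> (norm l)))"
        using pos(4) by (rule mult_left_mono)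
      have 5: "(1 - ?b) * (2 * e) \<le> quad_cut \<rho> (norm l) * (2 * e)" using b01 e(1) by (intro mult_right_mono) auto
      have "(1 - ?b) * (4 * B * ?q) \<le> 1 * (4 * B * ?q)" using b01 B0 by (intro mult_right_mono) auto
      then show ?thesis using 3 4 5 by (simp add: E_def algebra_simps)
    qed
    have K2: "- K * second_diff rat_bump ((1/R) *\<^sub>R (x - x0)) ((1/R) *\<^sub>R l) \<le> K * C0 * quad_cut R (norm l)"
    proof -
      have "- second_diff rat_bump ((1/R) *\<^sub>R (x - x0)) ((1/R) *\<^sub>R l) \<le> C0 * quad_cut R (norm l)"
        using C0(2)[of "(1/R) *\<^sub>R (x - x0)" "(1/R) *\<^sub>R l"] pos(2) by (simp add: quad_cut_def)
      from mult_left_mono[OF this pos(3)] show ?thesis by simp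
    qed
    \<comment> \<open>The contact values of \<psi>1 and \<psi>2 add up to \<open>M0\<close>, so the
      two second differences combine into the estimate \<open>D\<close> at l and at -l.\<close>
    have "second_diff ?f1 x l - second_diff ?f2 y l = (\<psi>1 (t, x + l) + \<psi>2 (s, y + l) - M0) + (\<psi>1 (t, x + - l) + \<psi>2 (s, y + - l) - M0)"
      using \<psi>1(3) \<psi>2(3) by (simp add: second_diff_def M0_def)
    also have "\<dots> \<le> (K * (kx x - kx (x + l)) + E) + (K * (kx x - kx (x + - l)) + E)"
      by (intro add_mono D) auto
    also have "\<dots> = - K * second_diff rat_bump ((1/R) *\<^sub>R (x - x0)) ((1/R) *\<^sub>R l) + 2 * E"
      by (simp add: kx_def second_diff_def algebra_simps)
    finally show "second_diff ?f1 x l \<le> second_diff ?f2 y l + (K * C0 * quad_cut R (norm l)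
        + (18 * N * C0 * \<rho>\<^sup>2 + 4 * e) * quad_cut \<rho> (norm l) + 8 * B * quad_cut R2 (norm l))"
      using K2 by (simp add: E_def algebra_simps)
  qed (use pos C0 B0 \<rho> R2 e Lup in auto)
  moreover have "?J * ((K * C0) * R powr (-\<alpha>) + (18 * N * C0 * \<rho>\<^sup>2 + 4 * e) * \<rho> powr (-\<alpha>) + (8 * B) * R2 powr (-\<alpha>)) < c / 2"
  proof -
    have "\<rho>\<^sup>2 * \<rho> powr (-\<alpha>) = \<rho> powr (2 - \<alpha>)"
      using \<rho>(1) by (simp add: powr_diff powr_minus divide_inverse)
    then have eq: "?J * ((K * C0) * R powr (-\<alpha>) + (18 * N * C0 * \<rho>\<^sup>2 + 4 * e) * \<rho> powr (-\<alpha>) + (8 * B) * R2 powr (-\<alpha>))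
      = ?J * (K * C0) * R powr (-\<alpha>) + ?J * (18 * N * C0) * \<rho> powr (2 - \<alpha>) + ?J * 4 * \<rho> powr (-\<alpha>) * e + ?J * (8 * B) * R2 powr (-\<alpha>)"
      by (simp add: algebra_simps)
    have "?J * 4 * \<rho> powr (-\<alpha>) * e < c/8" using e by simp
    then show ?thesis unfolding eq using R \<rho>(2) R2(2) by linarith
  qed
  moreover have "c / 2 \<le> c * cos t"
    using mult_left_mono[OF cos_ge_half[of t], of c] ts pos(1) by simp
  ultimately show False by linarith
qed

lemma visc_comparison:
  fixes u v :: "real \<Rightarrow> 'v::euclidean_space \<Rightarrow> real"
  assumes alpha: "0 < \<alpha>" "\<alpha> \<le> 1" and Lup: "0 < Lup"
    and sub: "visc_sub \<alpha> Llo Lup \<phi> u" and super: "visc_super \<alpha> Llo Lup \<phi> v"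
    and cont: "continuous_on ({0..1} \<times> UNIV) (\<lambda>(t,x). u t x)" "continuous_on ({0..1} \<times> UNIV) (\<lambda>(t,x). v t x)"
    and t0: "t0 \<in> {0..1}"
  shows "u t0 x0 \<le> v t0 x0"
proof (rule ccontr)
  assume neg: "\<not> u t0 x0 \<le> v t0 x0"
  \<comment> \<open>Half of the gap: at the diagonal point over (t0, x0) the doubled functional is 2
    c - c sin t0, hence at least c.\<close>
  define c where "c = (u t0 x0 - v t0 x0) / 2"
  have c: "0 < c" using neg by (simp add: c_def)
  obtain B1 where B1: "\<And>t x. t \<in> {0..1} \<Longrightarrow> \<bar>u t x\<bar> \<le> B1"
    using conjunct1[OF sub[unfolded visc_sub_def]] unfolding bounded_fun_def by blast
  obtain B2 where B2: "\<And>t x. t \<in> {0..1} \<Longrightarrow> \<bar>v t x\<bar> \<le> B2"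
    using conjunct1[OF super[unfolded visc_super_def]] unfolding bounded_fun_def by blast
  define B where "B = max B1 B2"
  have B: "\<bar>u t x\<bar> \<le> B" "\<bar>v t x\<bar> \<le> B" if "t \<in> {0..1}" for t x
    using B1[OF that, of x] B2[OF that, of x] by (auto simp: B_def)
  have B0: "0 \<le> B" using B(1)[OF t0, of x0] by linarith
  \<comment> \<open>Outside the ball of radius R the localising penalty is at least K / 2 = 2 B + 1,
    which exceeds any possible value of u - v.\<close>
  define K where "K = 4 * B + 2"
  have K0: "0 \<le> K" using B0 by (simp add: K_def)
  obtain C0 where C0: "0 \<le> C0" "\<And>(z::'v) l. \<bar>second_diff rat_bump z l\<bar> \<le> C0 * quad_cut 1 (norm l)"
    using cb_class_second_diff_bound[OF cb_class_rat_bump] by blast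
  obtain R where R: "0 < R" "Lup / 2 * levy_mass \<alpha> * (K * C0) * R powr (-\<alpha>) < c / 8"
    by (rule small_powr[of "c/8" "-\<alpha>" "Lup / 2 * levy_mass \<alpha> * (K * C0)"]) (use c alpha in auto)
  define \<Phi> where "\<Phi> N p q = (case p of (t,x) \<Rightarrow> u t x) - (case q of (t,x) \<Rightarrow> v t x) - c * sin (fst p)
      - N * (1 - cos (fst p - fst q)) - N * (1 - rat_bump (snd p - snd q))
      - K * (1 - rat_bump ((1/R) *\<^sub>R (snd p - x0)))" for N and p q :: "real \<times> 'v"
  \<comment> \<open>The second ball is larger by 1: if p lies in the first and q outside the second,
    their spatial distance exceeds 1 and the coupling penalty is at least N / 2.\<close>
  define DP where "DP = {0..1::real} \<times> cball x0 R"
  define DQ where "DQ = {0..1::real} \<times> cball x0 (R + 1)"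
  have comp: "compact DP" "compact DQ" unfolding DP_def DQ_def by (intro compact_Times; simp)+
  have p0: "(t0, x0) \<in> DP" "(t0, x0) \<in> DQ" using t0 R by (auto simp: DP_def DQ_def)
  have subs: "DP \<subseteq> {0..1} \<times> UNIV" "DQ \<subseteq> {0..1} \<times> UNIV" by (auto simp: DP_def DQ_def)
  have \<Phi>0: "c \<le> \<Phi> N (t0, x0) (t0, x0)" for N
  proof -
    have "c * sin t0 \<le> c" using c by simp
    then show ?thesis by (simp add: \<Phi>_def c_def)
  qed
  have "\<exists>pq. pq \<in> DP \<times> DQ \<and> (\<forall>z\<in>DP \<times> DQ. \<Phi> N (fst z) (snd z) \<le> \<Phi> N (fst pq) (snd pq))" for N :: nat
  proof -
    have "continuous_on (DP \<times> DQ) (\<lambda>z. (\<lambda>(t,x). u t x) (fst z))" "continuous_on (DP \<times> DQ) (\<lambda>z. (\<lambda>(t,x). v t x) (snd z))"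
      using subs by (auto intro!: continuous_on_compose2[OF cont(1)] continuous_on_compose2[OF cont(2)] continuous_intros)
    then have "continuous_on (DP \<times> DQ) (\<lambda>z. \<Phi> N (fst z) (snd z))"
      unfolding \<Phi>_def by (intro continuous_intros)
    moreover have "DP \<times> DQ \<noteq> {}" using p0 by auto
    ultimately show ?thesis
      using continuous_attains_sup[OF compact_Times[OF comp]] by blast
  qed
  then have "\<forall>N::nat. \<exists>pq. pq \<in> DP \<times> DQ \<and> (\<forall>z\<in>DP \<times> DQ. \<Phi> N (fst z) (snd z) \<le> \<Phi> N (fst pq) (snd pq))" by blast
  from choice[OF this] obtain Z :: "nat \<Rightarrow> (real \<times> 'v) \<times> (real \<times> 'v)"
    where "\<forall>N. Z N \<in> DP \<times> DQ \<and> (\<forall>z\<in>DP \<times> DQ. \<Phi> N (fst z) (snd z) \<le> \<Phi> N (fst (Z N)) (snd (Z N)))" ..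
  then have Z: "\<And>N::nat. Z N \<in> DP \<times> DQ"
    "\<And>(N::nat) z. z \<in> DP \<times> DQ \<Longrightarrow> \<Phi> N (fst z) (snd z) \<le> \<Phi> N (fst (Z N)) (snd (Z N))" by blast+
  define P where "P N = fst (Z N)" for N
  define Q where "Q N = snd (Z N)" for N
  have PQ: "P N \<in> DP" "Q N \<in> DQ" for N using Z(1)[of N] by (auto simp: P_def Q_def mem_Times_iff)
  have PQ01: "fst (P N) \<in> {0..1}" "fst (Q N) \<in> {0..1}" for N
    using PQ[of N] by (auto simp: DP_def DQ_def mem_Times_iff)
  have max: "\<Phi> N p q \<le> \<Phi> N (P N) (Q N)" if "p \<in> DP" "q \<in> DQ" for N :: nat and p q
    using Z(2)[of "(p, q)" N] that by (simp add: P_def Q_def)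
  have ge_c: "c \<le> \<Phi> N (P N) (Q N)" for N :: nat using \<Phi>0[of N] max[OF p0, of N] by linarith
  have nn: "0 \<le> real N * (1 - cos a)" "0 \<le> real N * (1 - rat_bump b)" "0 \<le> K * (1 - rat_bump b)" for N a and b :: 'v
    using K0 rat_bump_le_1[of b] by auto
  have sinP: "0 \<le> c * sin a" if "a \<in> {0..1}" for a
    using that c sin_ge_zero[of a] pi_gt3 by auto
  have diff2B: "(case p of (t,x) \<Rightarrow> u t x) - (case q of (t,x) \<Rightarrow> v t x) \<le> 2 * B"
    if "fst p \<in> {0..1}" "fst q \<in> {0..1}" for p q
    using B(1)[OF that(1), of "snd p"] B(2)[OF that(2), of "snd q"] by (simp add: case_prod_beta)
  \<comment> \<open>For large N the maximum over the compact set is global, as required by test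
    functions that touch everywhere: off the compact set one of the penalties makes the functional
    negative, while its maximum is at least c.\<close>
  have gmax: "\<Phi> N p q \<le> \<Phi> N (P N) (Q N)"
    if N: "4 * B + 2 \<le> real N" and pq: "fst p \<in> {0..1}" "fst q \<in> {0..1}" for N :: nat and p q
  proof -
    note b = nn(1)[of N] nn(2)[of N] nn(3) sinP[OF pq(1)] diff2B[OF pq]
    have c0: "0 < \<Phi> N (P N) (Q N)" using ge_c[of N] c by linarith
    consider "\<not> norm (snd p - x0) \<le> R" | "norm (snd p - x0) \<le> R" "\<not> norm (snd q - x0) \<le> R + 1"
      | "norm (snd p - x0) \<le> R" "norm (snd q - x0) \<le> R + 1" by blast
    then show ?thesis
    proof cases
      case 1
      then have "rat_bump ((1/R) *\<^sub>R (snd p - x0)) \<le> 1/2" using R(1)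
        by (intro rat_bump_le_half, unfold norm_scaleR) (simp add: field_simps)
      then have "K * (1/2) \<le> K * (1 - rat_bump ((1/R) *\<^sub>R (snd p - x0)))" using K0 by (intro mult_left_mono) auto
      then have "\<Phi> N p q \<le> 2 * B - K / 2"
        unfolding \<Phi>_def using b(1)[of "fst p - fst q"] b(2)[of "snd p - snd q"] b(4,5) by linarith
      then show ?thesis using c0 B0 unfolding K_def by argo
    next
      case 2
      have "norm (snd q - x0) \<le> norm (snd p - snd q) + norm (snd p - x0)"
        using norm_triangle_ineq[of "snd q - snd p" "snd p - x0"] by (simp add: norm_minus_commute)
      then have "rat_bump (snd p - snd q) \<le> 1/2" using 2 by (intro rat_bump_le_half) linarith
      then have "real N * (1/2) \<le> real N * (1 - rat_bump (snd p - snd q))" by (intro mult_left_mono) auto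
      then have "\<Phi> N p q \<le> 2 * B - real N / 2"
        unfolding \<Phi>_def using b(1)[of "fst p - fst q"] nn(3)[of "(1/R) *\<^sub>R (snd p - x0)"] b(4,5) by linarith
      then show ?thesis using c0 N B0 by argo
    next
      case 3
      then show ?thesis using pq
        by (intro max) (auto simp: DP_def DQ_def mem_Times_iff dist_norm norm_minus_commute)
    qed
  qed
  obtain z r where zr: "z \<in> DP \<times> DQ" "strict_mono r" "(Z \<circ> r) \<longlonglongrightarrow> z"
    using compact_Times[OF comp] Z(1) unfolding compact_def by blast
  have lP: "(\<lambda>n. P (r n)) \<longlonglongrightarrow> fst z" and lQ: "(\<lambda>n. Q (r n)) \<longlonglongrightarrow> snd z"
    using tendsto_fst[OF zr(3)] tendsto_snd[OF zr(3)] by (simp_all add: P_def Q_def o_def)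
  have z01: "fst (fst z) \<in> {0..1}" "fst (snd z) \<in> {0..1}" using zr(1) by (auto simp: DP_def DQ_def mem_Times_iff)
  \<comment> \<open>The maximum is at least c > 0 and the remaining terms subtracted are
    nonnegative, so each coupling penalty alone is at most u - v \<le> 2 B.\<close>
  have pen: "real N * (1 - cos (fst (P N) - fst (Q N))) \<le> 2 * B" "real N * (1 - rat_bump (snd (P N) - snd (Q N))) \<le> 2 * B"
    and uvc: "c \<le> (case P N of (t,x) \<Rightarrow> u t x) - (case Q N of (t,x) \<Rightarrow> v t x)" for N :: nat
    using ge_c[of N, unfolded \<Phi>_def] c diff2B[OF PQ01(1)[of N] PQ01(2)[of N]] sinP[OF PQ01(1)[of N]]
      nn(1)[of N "fst (P N) - fst (Q N)"] nn(2)[of N "snd (P N) - snd (Q N)"]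
      nn(3)[of "(1/R) *\<^sub>R (snd (P N) - x0)"]
    by linarith+
  \<comment> \<open>Since r n \<ge> n, boundedness of \<open>real (r n) * f n\<close> forces f to 0.
    Applied to both coupling penalties this puts the limit point on the diagonal.\<close>
  have small: "a = 0" if "\<And>n. real (r n) * f n \<le> 2 * B" "\<And>n. 0 \<le> f n" "f \<longlonglongrightarrow> a" for a and f :: "nat \<Rightarrow> real"
  proof -
    have "f \<longlonglongrightarrow> 0"
    proof (rule Lim_null_comparison)
      show "\<forall>\<^sub>F n in sequentially. norm (f n) \<le> 2 * B / real n"
        unfolding eventually_sequentially
      proof (intro exI[of _ 1] allI impI)
        fix n :: nat assume n: "1 \<le> n"
        have "real n * f n \<le> real (r n) * f n"
          using seq_suble[OF zr(2), of n] that(2)[of n] by (intro mult_right_mono) auto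
        then have "real n * f n \<le> 2 * B" using that(1)[of n] by linarith
        then show "norm (f n) \<le> 2 * B / real n" using n that(2)[of n] by (simp add: field_simps)
      qed
      show "(\<lambda>n. 2 * B / real n) \<longlonglongrightarrow> 0" by (rule lim_const_over_n)
    qed
    then show ?thesis using LIMSEQ_unique that(3) by blast
  qed
  have "1 - cos (fst (fst z) - fst (snd z)) = 0"
  proof (rule small[OF pen(1)])
    show "(\<lambda>n. 1 - cos (fst (P (r n)) - fst (Q (r n)))) \<longlonglongrightarrow> 1 - cos (fst (fst z) - fst (snd z))"
      by (intro tendsto_intros lP lQ)
  qed simp
  then have "cos \<bar>fst (fst z) - fst (snd z)\<bar> = 1" by simp
  moreover have "\<bar>fst (fst z) - fst (snd z)\<bar> \<le> pi" using z01 pi_gt3 by (simp add: abs_le_iff)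
  ultimately have "\<not> 0 < \<bar>fst (fst z) - fst (snd z)\<bar>"
    using cos_monotone_0_pi[of 0 "\<bar>fst (fst z) - fst (snd z)\<bar>"] by auto
  then have tz: "fst (fst z) = fst (snd z)" by simp
  have "1 - rat_bump (snd (fst z) - snd (snd z)) = 0"
  proof (rule small[OF pen(2)])
    have "continuous_on UNIV (rat_bump :: 'v \<Rightarrow> real)"
      by (intro cb_class_continuous cb_class_rat_bump)
    then have "isCont rat_bump (a::'v)" for a by (simp add: continuous_on_eq_continuous_at)
    then show "(\<lambda>n. 1 - rat_bump (snd (P (r n)) - snd (Q (r n)))) \<longlonglongrightarrow> 1 - rat_bump (snd (fst z) - snd (snd z))"
      by (intro tendsto_diff tendsto_const isCont_tendsto_compose[of _ rat_bump] tendsto_snd lP lQ)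
  qed (simp add: rat_bump_le_1)
  then have xz: "snd (fst z) = snd (snd z)" by (simp add: rat_bump_eq_1_iff)
  have eqz: "fst z = snd z" using tz xz by (simp add: prod_eq_iff)
  have z1: "fst z \<in> {0..1} \<times> UNIV" using z01 by (simp add: mem_Times_iff)
  have "(\<lambda>n. (case P (r n) of (t,x) \<Rightarrow> u t x)) \<longlonglongrightarrow> (case fst z of (t,x) \<Rightarrow> u t x)"
    using PQ subs z1 by (intro continuous_on_tendsto_compose[OF cont(1) lP] always_eventually) auto
  moreover have "(\<lambda>n. (case Q (r n) of (t,x) \<Rightarrow> v t x)) \<longlonglongrightarrow> (case fst z of (t,x) \<Rightarrow> v t x)"
    using PQ subs z1 lQ unfolding eqz[symmetric] by (intro continuous_on_tendsto_compose[OF cont(2)] always_eventually) auto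
  ultimately have gap: "c \<le> (case fst z of (t,x) \<Rightarrow> u t x) - (case fst z of (t,x) \<Rightarrow> v t x)"
    using uvc by (intro LIMSEQ_le_const[OF tendsto_diff]) auto
  have init: "(case fst z of (t,x) \<Rightarrow> u t x) \<le> (case fst z of (t,x) \<Rightarrow> v t x)" if "fst (fst z) = 0"
  proof -
    have "u 0 (snd (fst z)) \<le> v 0 (snd (fst z))"
      using sub super unfolding visc_sub_def visc_super_def by (meson order_trans)
    then show ?thesis using that by (simp add: case_prod_beta)
  qed
  \<comment> \<open>At time 0 the initial conditions give u \<le> v, against the gap c. Hence both
    times are eventually positive, and test functions on (0,1] become applicable.\<close>
  have "fst (fst z) \<noteq> 0"
  proof
    assume "fst (fst z) = 0"
    from init[OF this] gap c show False by linarith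
  qed
  then have zpos: "0 < fst (fst z)" using z01 by simp
  have "\<forall>\<^sub>F n in sequentially. 0 < fst (P (r n))"
    by (rule order_tendstoD(1)[OF tendsto_fst[OF lP] zpos])
  moreover have "\<forall>\<^sub>F n in sequentially. 0 < fst (Q (r n))"
    by (rule order_tendstoD(1)[OF tendsto_fst[OF lQ]]) (use zpos eqz in simp)
  moreover have "\<forall>\<^sub>F n in sequentially. 4 * B + 2 \<le> real (r n)"
    using filterlim_compose[OF filterlim_real_sequentially filterlim_subseq[OF zr(2)]]
    unfolding filterlim_at_top by blast
  ultimately have "\<forall>\<^sub>F n in sequentially. 0 < fst (P (r n)) \<and> 0 < fst (Q (r n)) \<and> 4 * B + 2 \<le> real (r n)"
    by (intro eventually_conj)
  then obtain n where n: "0 < fst (P (r n))" "0 < fst (Q (r n))" "4 * B + 2 \<le> real (r n)"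
    using eventually_happens'[OF sequentially_bot] by blast
  show False
  proof (rule no_doubled_maximum[OF alpha Lup c R(1) K0 _ sub super cont B C0 R(2),
        where N="real (r n)" and t="fst (P (r n))" and x="snd (P (r n))" and s="fst (Q (r n))" and y="snd (Q (r n))" and ?x0.0=x0])
    fix t' x' s' y' assume "t' \<in> {0..1::real}" "s' \<in> {0..1::real}"
    then show "u t' x' - v s' y' - c * sin t' - real (r n) * (1 - cos (t' - s')) - real (r n) * (1 - rat_bump (x' - y'))
        - K * (1 - rat_bump ((1/R) *\<^sub>R (x' - x0)))
      \<le> u (fst (P (r n))) (snd (P (r n))) - v (fst (Q (r n))) (snd (Q (r n))) - c * sin (fst (P (r n)))
        - real (r n) * (1 - cos (fst (P (r n)) - fst (Q (r n)))) - real (r n) * (1 - rat_bump (snd (P (r n)) - snd (Q (r n))))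
        - K * (1 - rat_bump ((1/R) *\<^sub>R (snd (P (r n)) - x0)))"
      using gmax[OF n(3), of "(t', x')" "(s', y')"] by (simp add: \<Phi>_def case_prod_beta)
  qed (use n PQ01[of "r n"] in auto)
qed

section \<open>Passage to the limit, existence and uniqueness\<close>

theorem theorem4p7:
  fixes H :: "('w \<Rightarrow> real) set" and E :: "('w \<Rightarrow> real) \<Rightarrow> real"
    and Z :: "nat \<Rightarrow> 'w \<Rightarrow> 'v::euclidean_space"
    and \<alpha> \<delta> Llo Lup :: real
    and H' :: "('w2 \<Rightarrow> real) set" and E' :: "('w2 \<Rightarrow> real) \<Rightarrow> real"
    and \<zeta> :: "real \<Rightarrow> 'w2 \<Rightarrow> 'v"
    and \<phi> :: "'v \<Rightarrow> real"
  defines "S \<equiv> (\<lambda>n w. \<Sum>i<n. Z i w)"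
  defines "u \<equiv> (\<lambda>t x. E' (\<lambda>w. \<phi> (x + \<zeta> t w)))"
  assumes alpha: "0 < \<alpha>" "\<alpha> \<le> 1"
    and Lambda: "0 < Llo" "0 < Lup"
    and sle: "sublinear_expectation H E"
    and iid: "iid_seq H E Z"
    and infinite_mean: "upper_exp_infinite E (Z 0) norm"
    and A1: "0 < \<delta>" "\<delta> < \<alpha>"
            "\<exists>C. \<forall>n\<ge>1. upper_exp_le E (\<lambda>w. real n powr (-1/\<alpha>) *\<^sub>R S n w) (\<lambda>y. norm y powr \<delta>) C"
    and A2: "\<forall>f. Cb_k 3 f \<longrightarrow> (\<exists>l :: real \<Rightarrow> real. (l \<longlongrightarrow> 0) (at_right 0) \<and>
               (\<forall>s>0. \<forall>x. (1/s) * \<bar>E (\<lambda>w. f (x + s powr (1/\<alpha>) *\<^sub>R Z 0 w) - f x)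
                                    - s * levy_gen \<alpha> Llo Lup f x\<bar> \<le> l s))"
    and levy: "nonlinear_levy H' E' \<zeta>"
    and conv: "\<forall>f. bdd_lip f \<longrightarrow>
               (\<lambda>n. E (\<lambda>w. f (real n powr (-1/\<alpha>) *\<^sub>R S n w))) \<longlonglongrightarrow> E' (\<lambda>w. f (\<zeta> 1 w))"
    and marg: "\<forall>s\<in>{0..1}. \<exists>sk :: nat \<Rightarrow> real. (\<forall>k. dyadic (sk k) \<and> s \<le> sk k) \<and> decseq sk \<and>
               sk \<longlonglongrightarrow> s \<and>
               (\<exists>nn :: nat \<Rightarrow> nat \<Rightarrow> nat. (\<forall>k. filterlim (nn k) at_top sequentially) \<and>
                 (\<forall>f. bdd_lip f \<longrightarrow> (\<exists>a :: nat \<Rightarrow> real.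
                    (\<forall>k. (\<lambda>m. E (\<lambda>w. f ((sk k / real (nn k m)) powr (1/\<alpha>) *\<^sub>R S (nn k m) w)))
                           \<longlonglongrightarrow> a k) \<and>
                    a \<longlonglongrightarrow> E' (\<lambda>w. f (\<zeta> s w)))))"
    and phi: "bdd_lip \<phi>"
  shows "visc_sol \<alpha> Llo Lup \<phi> u \<and>
         (\<forall>v. visc_sol \<alpha> Llo Lup \<phi> v \<longrightarrow> (\<forall>t\<in>{0..1}. \<forall>x. v t x = u t x))"
proof -
  obtain C' where C': "\<And>n. n \<ge> 1 \<Longrightarrow> upper_exp_le E (\<lambda>w. real n powr (-1/\<alpha>) *\<^sub>R S n w) (\<lambda>y. norm y powr \<delta>) C'"
    using A1(3) by blast
  \<comment> \<open>Made nonnegative, so that the moment bounds are monotone in time.\<close>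
  define C where "C = max C' 0"
  have C0: "0 \<le> C" by (simp add: C_def)
  have C: "upper_exp_le E (\<lambda>w. real n powr (-1/\<alpha>) *\<^sub>R (\<Sum>i<n. Z i w)) (\<lambda>y. norm y powr \<delta>) C" if "n \<ge> 1" for n
    using C'[OF that] unfolding upper_exp_le_def S_def C_def by fastforce
  define \<kappa> where "\<kappa> = \<delta> / \<alpha>"
  have kappa: "0 < \<kappa>" using A1 alpha by (simp add: \<kappa>_def)
  have sle': "sublinear_expectation H' E'" using levy by (simp add: nonlinear_levy_def)
  have z0: "\<zeta> 0 w = 0" for w using levy by (simp add: nonlinear_levy_def)
  note exps = A1(1,2) alpha(2)
  \<comment> \<open>Transfers a bound on normalised sums to the marginal at time s. The
    approximating times lie above s and may exceed 1, so \<open>est\<close> is asked for all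
    \<sigma> > 0 and \<open>b\<close> only has to be continuous at s; the error in l disappears as n
    grows. Taking \<eta> = 1 and \<eta> = -1 gives upper and lower bounds from one
    statement.\<close>
  have limit_le: "\<eta> * E' (\<lambda>w. f (\<zeta> s w)) \<le> b s"
    if s: "0 < s" "s \<le> 1" and f: "bdd_lip f" and b: "isCont b s" and l: "(l \<longlongrightarrow> 0) (at_right 0)"
      and est: "\<And>\<sigma> n. 0 < \<sigma> \<Longrightarrow> n \<ge> 1 \<Longrightarrow>
        \<eta> * E (\<lambda>w. f ((\<sigma> / real n) powr (1/\<alpha>) *\<^sub>R S n w)) \<le> b \<sigma> + \<sigma> * l (\<sigma> / real n)"
    for s \<eta> f b and l :: "real \<Rightarrow> real"
  proof -
    have "s \<in> {0..1}" using s by simp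
    from marg[rule_format, OF this] obtain sk where sk: "\<And>k. s \<le> sk k" "sk \<longlonglongrightarrow> s"
      and ex: "\<exists>nn :: nat \<Rightarrow> nat \<Rightarrow> nat. (\<forall>k. filterlim (nn k) at_top sequentially) \<and>
                 (\<forall>f. bdd_lip f \<longrightarrow> (\<exists>a :: nat \<Rightarrow> real.
                    (\<forall>k. (\<lambda>m. E (\<lambda>w. f ((sk k / real (nn k m)) powr (1/\<alpha>) *\<^sub>R S (nn k m) w)))
                           \<longlonglongrightarrow> a k) \<and>
                    a \<longlonglongrightarrow> E' (\<lambda>w. f (\<zeta> s w))))" by (elim exE conjE) (rule that, auto)
    from ex obtain nn where nn: "\<And>k. filterlim (nn k) at_top sequentially"
      and ex': "\<forall>f. bdd_lip f \<longrightarrow> (\<exists>a :: nat \<Rightarrow> real.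
                    (\<forall>k. (\<lambda>m. E (\<lambda>w. f ((sk k / real (nn k m)) powr (1/\<alpha>) *\<^sub>R S (nn k m) w)))
                           \<longlonglongrightarrow> a k) \<and>
                    a \<longlonglongrightarrow> E' (\<lambda>w. f (\<zeta> s w)))" by (elim exE conjE) (rule that, auto)
    from ex'[rule_format, OF f] obtain a where
      a: "\<And>k. (\<lambda>m. E (\<lambda>w. f ((sk k / real (nn k m)) powr (1/\<alpha>) *\<^sub>R S (nn k m) w))) \<longlonglongrightarrow> a k"
        "a \<longlonglongrightarrow> E' (\<lambda>w. f (\<zeta> s w))" by blast
    show ?thesis
    proof (rule marginal_limit_le[OF tendsto_mult_left[OF a(1)] tendsto_mult_left[OF a(2)], where b="\<lambda>k. b (sk k)" and r="\<lambda>k m. sk k * l (sk k / real (nn k m))"])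
      fix k
      have skp: "0 < sk k" using sk(1)[of k] s by linarith
      have ge1: "\<forall>\<^sub>F m in sequentially. 1 \<le> nn k m" using nn[of k] by (simp add: filterlim_at_top)
      then show "\<forall>\<^sub>F m in sequentially. \<eta> * E (\<lambda>w. f ((sk k / real (nn k m)) powr (1/\<alpha>) *\<^sub>R S (nn k m) w))
          \<le> b (sk k) + sk k * l (sk k / real (nn k m))"
        by (rule eventually_mono) (rule est[OF skp])
      have "(\<lambda>m. sk k / real (nn k m)) \<longlonglongrightarrow> 0"
        by (rule filterlim_compose[OF lim_const_over_n nn])
      then have "filterlim (\<lambda>m. sk k / real (nn k m)) (at_right 0) sequentially"
        unfolding filterlim_at using ge1 skp by (auto elim!: eventually_mono)
      from tendsto_mult_left[OF filterlim_compose[OF l this], of "sk k"]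
      show "(\<lambda>m. sk k * l (sk k / real (nn k m))) \<longlonglongrightarrow> 0" by simp
    next
      show "(\<lambda>k. b (sk k)) \<longlonglongrightarrow> b s" by (rule isCont_tendsto_compose[OF b sk(2)])
    qed
  qed
  have moment: "E' (\<lambda>w. trunc_norm (\<zeta> s w)) \<le> C * s powr \<kappa>" if s: "s \<in> {0..1}" for s
  proof (cases "s = 0")
    case True
    then show ?thesis by (simp add: z0 trunc_norm_def sublinear_const(1)[OF sle'])
  next
    case False
    have "1 * E' (\<lambda>w. trunc_norm (\<zeta> s w)) \<le> C * s powr \<kappa>"
    proof (rule limit_le[OF _ _ bdd_lip_trunc_norm _ tendsto_const])
      show "isCont (\<lambda>s. C * s powr \<kappa>) s" using False s by (intro continuous_intros) auto
      fix \<sigma> :: real and n :: nat assume "0 < \<sigma>" "1 \<le> n"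
      then show "1 * E (\<lambda>w. trunc_norm ((\<sigma> / real n) powr (1/\<alpha>) *\<^sub>R S n w)) \<le> C * \<sigma> powr \<kappa> + \<sigma> * 0"
        using trunc_moment[OF sle iid exps C, of "\<sigma> / real n" n] by (simp add: S_def \<kappa>_def)
    qed (use False s in auto)
    then show ?thesis by simp
  qed
  have generator: "\<exists>K\<ge>0. \<forall>s\<in>{0..1}. \<forall>x. \<bar>E' (\<lambda>w. f (x + \<zeta> s w)) - f x - s * levy_gen \<alpha> Llo Lup f x\<bar> \<le> s * (K * s powr \<kappa>)"
    if f: "cb_class 3 f" for f
  proof -
    let ?G = "levy_gen \<alpha> Llo Lup f"
    have lip: "bdd_lip f" using cb_class_imp_bdd_lip[of 2 f] f by (simp add: numeral_3_eq_3 numeral_2_eq_2)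
    obtain \<Lambda> where \<Lambda>: "\<Lambda> \<ge> 0" "\<And>x y. \<bar>?G x - ?G y\<bar> \<le> \<Lambda> * trunc_norm (x - y)"
      using levy_gen_increment[OF alpha f, of Lup] Lambda by (metis less_imp_le)
    obtain l where l: "(l \<longlongrightarrow> 0) (at_right 0)" "\<And>s x. s > 0 \<Longrightarrow> (1/s) * \<bar>E (\<lambda>w. f (x + s powr (1/\<alpha>) *\<^sub>R Z 0 w) - f x)
                                    - s * ?G x\<bar> \<le> l s"
      using A2[rule_format, OF cb_class_imp_Cb_k[OF f]] by blast
    have Z0: "random_var H (Z 0)" using iid by (simp add: iid_seq_def)
    have step: "\<bar>E (\<lambda>w. f (y + \<tau> powr (1/\<alpha>) *\<^sub>R Z 0 w)) - f y - \<tau> * ?G y\<bar> \<le> \<tau> * l \<tau>" if "0 < \<tau>" for \<tau> y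
    proof -
      have "(\<lambda>w. f (y + \<tau> powr (1/\<alpha>) *\<^sub>R Z 0 w)) \<in> H"
        using Z0 bdd_lip_affine[OF lip, of y "\<tau> powr (1/\<alpha>)"] unfolding random_var_def by blast
      from sublinear_add_const[OF sle this, of "- f y"]
      have "E (\<lambda>w. f (y + \<tau> powr (1/\<alpha>) *\<^sub>R Z 0 w) - f y) = E (\<lambda>w. f (y + \<tau> powr (1/\<alpha>) *\<^sub>R Z 0 w)) - f y" by simp
      then show ?thesis using l(2)[OF that, of y] that by (simp add: field_simps)
    qed
    define K where "K = \<Lambda> * C"
    \<comment> \<open>With step size \<sigma>/n the total time is \<sigma> for every n. The (A2)
      error l(\<sigma>/n) will vanish in the limit, and only the displacement error of order
      \<sigma>^(1 + \<kappa>) remains.\<close>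
    have scheme: "\<bar>E (\<lambda>w. f (x + (\<sigma> / real n) powr (1/\<alpha>) *\<^sub>R S n w)) - f x - \<sigma> * ?G x\<bar> \<le> \<sigma> * (K * \<sigma> powr \<kappa>) + \<sigma> * l (\<sigma> / real n)"
      if "0 < \<sigma>" "1 \<le> n" for \<sigma> n x
      using scheme_consistency[OF sle iid exps C lip _ \<Lambda>(1) C0 \<Lambda>(2) step[of "\<sigma> / real n"], of x n] that
      by (simp add: S_def K_def \<kappa>_def algebra_simps)
    have "\<bar>E' (\<lambda>w. f (x + \<zeta> s w)) - f x - s * ?G x\<bar> \<le> s * (K * s powr \<kappa>)" if s: "s \<in> {0..1}" for s x
    proof (cases "s = 0")
      case True
      then show ?thesis by (simp add: z0 sublinear_const(1)[OF sle'])
    next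
      case False
      have "\<eta> * E' (\<lambda>w. f (x + \<zeta> s w)) \<le> \<eta> * (f x + s * ?G x) + s * (K * s powr \<kappa>)"
        if eta: "\<eta> = 1 \<or> \<eta> = -1" for \<eta>
      proof (rule limit_le[OF _ _ bdd_lip_shift[OF lip] _ l(1)])
        show "isCont (\<lambda>s. \<eta> * (f x + s * ?G x) + s * (K * s powr \<kappa>)) s"
          using False s by (intro continuous_intros) auto
        fix \<sigma> :: real and n :: nat assume "0 < \<sigma>" "1 \<le> n"
        note sc = scheme[OF this, of x]
        from eta show "\<eta> * E (\<lambda>w. f (x + (\<sigma> / real n) powr (1/\<alpha>) *\<^sub>R S n w))
            \<le> \<eta> * (f x + \<sigma> * ?G x) + \<sigma> * (K * \<sigma> powr \<kappa>) + \<sigma> * l (\<sigma> / real n)"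
          by (elim disjE; simp only: mult_1 mult_minus_left) (use sc in linarith)+
      qed (use False s in auto)
      from this[OF disjI1[OF refl]] this[OF disjI2[OF refl]] show ?thesis
        by (simp add: abs_le_iff algebra_simps)
    qed
    then show ?thesis using \<Lambda>(1) C0 by (intro exI[of _ K]) (auto simp: K_def)
  qed
  have sol: "visc_sol \<alpha> Llo Lup \<phi> u"
    unfolding u_def by (rule visc_sol_value[OF levy phi kappa C0 moment generator])
  \<comment> \<open>Comparison applies in both directions, since a viscosity solution is by
    definition continuous and both a sub- and a supersolution.\<close>
  moreover have "v t x = u t x" if "visc_sol \<alpha> Llo Lup \<phi> v" "t \<in> {0..1}" for v t x
    using visc_comparison[OF alpha Lambda(2), of Llo \<phi> u v t x] visc_comparison[OF alpha Lambda(2), of Llo \<phi> v u t x]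
      sol that unfolding visc_sol_def by fastforce
  ultimately show ?thesis by blast
qed

end
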